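(* Let $\alpha>0$, $\sigma>0$, and let $\{\eta^{(d)}\in\mathbb{R}^d\}_{d\ge d_0}$ be a deterministic sequence of loading vectors, each satisfying $|\eta^{(d)}_1|\ge\cdots\ge|\eta^{(d)}_d|>0$. Suppose there exist constants $c>0$, $c'>0$ and $\gamma_0\in(0,2)$, and a sequence $s_{\rm cut}=s_{\rm cut}(d)\in[d]$ diverging to infinity as $d\to\infty$, such that for all $d\ge d_0$ $$\frac{\Phi_{\rm adp}(s;\eta^{(d)})}{\Phi_{\rm o}(s;\eta^{(d)})}\le c\quad\forall\,1\le s\le s_{\rm cut},\qquad\text{and}\qquad \frac{\Phi_{\rm adp}(s;\eta^{(d)})}{\Phi_{\rm o}(1;\eta^{(d)})}\ge c'(\min(s,s_0))^{\gamma_0}\quad\forall\, s_{\rm cut}\le s\le d .$$ Then there exists $\tau_{\alpha,\gamma_0}>0$ such that for every $\tau\ge\tau_{\alpha,\gamma_0}$, the function $(s,d)\mapsto\sigma^2\Phi_{\rm adp}(s;\eta^{(d)})$ is the adaptive rate of convergence on the scale of classes $\{\Theta_s\times\mathcal G_{\alpha,\tau}^{\otimes}:s\in[d]\}$.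
   Context: Model: $[d]=\{1,\dots,d\}$; one observes $y_j=\theta_j+\sigma\xi_j$, $j\in[d]$, $\theta\in\mathbb{R}^d$ unknown, $\sigma>0$ known, $\xi_1,\dots,\xi_d$ independent with joint law $\mathcal P_\xi$; $\mathbb{E}_{\theta,\mathcal P_\xi}$ is the corresponding expectation. With $\eta=\eta^{(d)}$, $L(\theta)=\sum_{j=1}^d\eta_j\theta_j$; $\Theta_s=\{\theta\in\mathbb{R}^d:\#\{j:\theta_j\ne0\}\le s\}$. Estimators are measurable real functions of $(y_1,\dots,y_d)$ (one for each $d$, not depending on $s$). Noise class: $\mathcal G_{\alpha,\tau}$ is the class of laws on $\mathbb{R}$ of random variables $W$ symmetric around $0$ with $\mathbb{E}(W^2)=1$ and $\mathbb{P}(|W|\ge t)\le2\exp\{-2(t/\tau)^\alpha\}$ for all $t\ge0$; $\mathcal G_{\alpha,\tau}^{\otimes}=\{\otimes_{j=1}^dP_j:P_j\in\mathcal G_{\alpha,\tau}\}$. Rates (for a given $\eta=\eta^{(d)}$): let $\phi(\beta)=\sum_{j=1}^d|\eta_j|e^{-\beta/|\eta_j|^\alpha}\big/\sqrt{\sum_{j=1}^d\eta_j^2e^{-\beta/|\eta_j|^\alpha}}$, $\beta\in\mathbb{R}$, continuous and strictly decreasing from $+\infty$ to $0$. For real $s\in[1,d]$: let $\beta$ solve $\phi(\beta)=s/2$, $\lambda_o=(\max(\beta,0))^{1/\alpha}$, $\nu=\sqrt{\sum_j\eta_j^2\exp(-(\lambda_o/|\eta_j|)^\alpha)}$, $\Phi_{\rm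 o}(s;\eta)=(\lambda_os+\nu)^2$. Let $\beta_*(s)$ solve $\phi(\beta_* )=s/(2\sqrt{\log(es)})$, $\lambda_*(s)=(\max(\beta_*(s),0))^{1/\alpha}$, $\nu_*(s)=\sqrt{\log(es)\sum_j\eta_j^2\exp(-(\lambda_*(s)/|\eta_j|)^\alpha)}$. Let $s_*=\max\{s\in[d]:\lambda_*(s)>0\}$ ($0$ if empty), $s_0=s_*+1$; $\Phi_*(s;\eta)=s^2\lambda_*^2(s)+\nu_*^2(s)$ if $s\le s_0$, $\Phi_*(s;\eta)=\Phi_*(s_0;\eta)$ otherwise. $\Phi_{\rm adp}(s;\eta)=\max\{\Phi_*(s;\eta),\Phi_*(1;\eta)\log^2(e\min(s,s_0))\}$ if $0<\alpha<2$, and $\Phi_{\rm adp}(s;\eta)=\Phi_*(s;\eta)$ if $\alpha\ge2$. Definition (adaptive rate of convergence). A positive function $(s,d)\mapsto\psi_*(s;\eta^{(d)})$ is called the adaptive rate of convergence on the scale of classes $\{\Theta_s\times\mathcal G_{\alpha,\tau}^{\otimes}:s\in[d]\}$ if: 1. There exist an estimator $\hat L$ and a constant $C>0$ such that for all $d\ge d_0$, $\max_{s\in[d]}\sup_{\theta\in\Theta_s}\sup_{\mathcal P_\xi\in\mathcal G_{\alpha,\tau}^{\otimes}}\mathbb{E}_{\theta,\mathcal P_\xi}(\hat L-L(\theta))^2/\psi_*(s;\eta^{(d)})\le C$. 2. If there exist another positive function $(s,d)\mapsto\psi_*'(s;\eta^{(d)})$ and a constant $C'>0$ such that for all $d\ge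 d_0$, $\inf_{\hat T}\max_{s\in[d]}\sup_{\theta\in\Theta_s}\sup_{\mathcal P_\xi\in\mathcal G_{\alpha,\tau}^{\otimes}}\mathbb{E}_{\theta,\mathcal P_\xi}(\hat T-L(\theta))^2/\psi_*'(s;\eta^{(d)})\le C'$, and $\min_{s\in[d]}\psi_*'(s;\eta^{(d)})/\psi_*(s;\eta^{(d)})\to0$ as $d\to\infty$, then there exists a sequence $\bar s=\bar s(d)\in[d]$ such that $$\frac{\psi_*'(\bar s;\eta^{(d)})}{\psi_*(\bar s;\eta^{(d)})}\cdot\min_{s\in[d]}\frac{\psi_*'(s;\eta^{(d)})}{\psi_*(s;\eta^{(d)})}\to\infty\quad\text{as }d\to\infty.$$ *)

theory Defs
  imports "HOL-Probability.Probability"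
begin

text \<open>
  A vector of \<open>\<real>\<^sup>d\<close> is a function in \<open>{1..d} \<rightarrow>\<^sub>E UNIV\<close>, the carrier of the product
  \<sigma>-algebra \<open>Pi\<^sub>M {1..d} (\<lambda>_. borel)\<close>, so that the dimension can vary inside one statement.
  Loadings \<open>\<eta>\<close> are plain functions of which only the values on \<open>{1..d}\<close> are used.
\<close>

subsection \<open>Model\<close>

definition noise_laws :: "real \<Rightarrow> real \<Rightarrow> real measure set" where
  "noise_laws \<alpha> \<tau> =
     {P. real_distribution P
       \<and> distr P borel uminus = P
       \<and> has_bochner_integral P (\<lambda>x. x\<^sup>2) 1
       \<and> (\<forall>t\<ge>0. measure P {x. t \<le> \<bar>x\<bar>} \<le> 2 * exp (- 2 * (t / \<tau>) powr \<alpha>))}"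

definition noise_products :: "real \<Rightarrow> real \<Rightarrow> nat \<Rightarrow> (nat \<Rightarrow> real) measure set" where
  "noise_products \<alpha> \<tau> d = {Pi\<^sub>M {1..d} P | P. \<forall>j\<in>{1..d}. P j \<in> noise_laws \<alpha> \<tau>}"

definition sparse_class :: "nat \<Rightarrow> nat \<Rightarrow> (nat \<Rightarrow> real) set" where
  "sparse_class d s = {\<theta> \<in> {1..d} \<rightarrow>\<^sub>E UNIV. card {j \<in> {1..d}. \<theta> j \<noteq> 0} \<le> s}"

definition lin_functional :: "nat \<Rightarrow> (nat \<Rightarrow> real) \<Rightarrow> (nat \<Rightarrow> real) \<Rightarrow> real" where
  "lin_functional d \<eta> \<theta> = (\<Sum>j=1..d. \<eta> j * \<theta> j)"

definition observation :: "real \<Rightarrow> nat \<Rightarrow> (nat \<Rightarrow> real) \<Rightarrow> (nat \<Rightarrow> real) \<Rightarrow> nat \<Rightarrow> real" where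
  "observation \<sigma> d \<theta> \<xi> = (\<lambda>j\<in>{1..d}. \<theta> j + \<sigma> * \<xi> j)"

definition estimators :: "nat \<Rightarrow> ((nat \<Rightarrow> real) \<Rightarrow> real) set" where
  "estimators d = borel_measurable (Pi\<^sub>M {1..d} (\<lambda>_. borel))"

text \<open>The risk takes values in \<open>ennreal\<close> because it may be infinite.\<close>

definition risk ::
  "real \<Rightarrow> nat \<Rightarrow> (nat \<Rightarrow> real) \<Rightarrow> ((nat \<Rightarrow> real) \<Rightarrow> real) \<Rightarrow> (nat \<Rightarrow> real) \<Rightarrow> (nat \<Rightarrow> real) measure \<Rightarrow> ennreal"
where
  "risk \<sigma> d \<eta> T \<theta> P =
     (\<integral>\<^sup>+\<xi>. ennreal ((T (observation \<sigma> d \<theta> \<xi>) - lin_functional d \<eta> \<theta>)\<^sup>2) \<partial>P)"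

definition max_normalized_risk ::
  "real \<Rightarrow> real \<Rightarrow> real \<Rightarrow> nat \<Rightarrow> (nat \<Rightarrow> real) \<Rightarrow> (nat \<Rightarrow> real) \<Rightarrow> ((nat \<Rightarrow> real) \<Rightarrow> real) \<Rightarrow> ennreal"
where
  "max_normalized_risk \<alpha> \<tau> \<sigma> d \<eta> \<psi> T =
     (MAX s\<in>{1..d}. SUP \<theta>\<in>sparse_class d s. SUP P\<in>noise_products \<alpha> \<tau> d.
        risk \<sigma> d \<eta> T \<theta> P / ennreal (\<psi> s))"

subsection \<open>Rates\<close>

definition phi :: "real \<Rightarrow> nat \<Rightarrow> (nat \<Rightarrow> real) \<Rightarrow> real \<Rightarrow> real" where
  "phi \<alpha> d \<eta> \<beta> =
     (\<Sum>j=1..d. \<bar>\<eta> j\<bar> * exp (- \<beta> / \<bar>\<eta> j\<bar> powr \<alpha>))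
       / sqrt (\<Sum>j=1..d. (\<eta> j)\<^sup>2 * exp (- \<beta> / \<bar>\<eta> j\<bar> powr \<alpha>))"

text \<open>
  For \<open>\<alpha> > 0\<close>, \<open>d \<ge> 1\<close> and \<open>\<eta>\<close> without zero entries on \<open>{1..d}\<close>, \<open>phi \<alpha> d \<eta>\<close> is a strictly
  decreasing bijection from \<open>\<real>\<close> onto \<open>(0, \<infinity>)\<close>, so the solutions below exist and are unique.
\<close>

definition beta_o :: "real \<Rightarrow> nat \<Rightarrow> (nat \<Rightarrow> real) \<Rightarrow> real \<Rightarrow> real" where
  "beta_o \<alpha> d \<eta> s = (THE \<beta>. phi \<alpha> d \<eta> \<beta> = s / 2)"

definition lambda_o :: "real \<Rightarrow> nat \<Rightarrow> (nat \<Rightarrow> real) \<Rightarrow> real \<Rightarrow> real" where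
  "lambda_o \<alpha> d \<eta> s = (max (beta_o \<alpha> d \<eta> s) 0) powr (1 / \<alpha>)"

definition nu_o :: "real \<Rightarrow> nat \<Rightarrow> (nat \<Rightarrow> real) \<Rightarrow> real \<Rightarrow> real" where
  "nu_o \<alpha> d \<eta> s =
     sqrt (\<Sum>j=1..d. (\<eta> j)\<^sup>2 * exp (- ((lambda_o \<alpha> d \<eta> s / \<bar>\<eta> j\<bar>) powr \<alpha>)))"

definition Phi_o :: "real \<Rightarrow> nat \<Rightarrow> (nat \<Rightarrow> real) \<Rightarrow> real \<Rightarrow> real" where
  "Phi_o \<alpha> d \<eta> s = (lambda_o \<alpha> d \<eta> s * s + nu_o \<alpha> d \<eta> s)\<^sup>2"

definition beta_star :: "real \<Rightarrow> nat \<Rightarrow> (nat \<Rightarrow> real) \<Rightarrow> real \<Rightarrow> real" where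
  "beta_star \<alpha> d \<eta> s = (THE \<beta>. phi \<alpha> d \<eta> \<beta> = s / (2 * sqrt (ln (exp 1 * s))))"

definition lambda_star :: "real \<Rightarrow> nat \<Rightarrow> (nat \<Rightarrow> real) \<Rightarrow> real \<Rightarrow> real" where
  "lambda_star \<alpha> d \<eta> s = (max (beta_star \<alpha> d \<eta> s) 0) powr (1 / \<alpha>)"

definition nu_star :: "real \<Rightarrow> nat \<Rightarrow> (nat \<Rightarrow> real) \<Rightarrow> real \<Rightarrow> real" where
  "nu_star \<alpha> d \<eta> s =
     sqrt (ln (exp 1 * s) *
       (\<Sum>j=1..d. (\<eta> j)\<^sup>2 * exp (- ((lambda_star \<alpha> d \<eta> s / \<bar>\<eta> j\<bar>) powr \<alpha>))))"

definition s_star :: "real \<Rightarrow> nat \<Rightarrow> (nat \<Rightarrow> real) \<Rightarrow> nat" where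
  "s_star \<alpha> d \<eta> =
     (let S = {s \<in> {1..d}. lambda_star \<alpha> d \<eta> (real s) > 0} in if S = {} then 0 else Max S)"

definition s_zero :: "real \<Rightarrow> nat \<Rightarrow> (nat \<Rightarrow> real) \<Rightarrow> nat" where
  "s_zero \<alpha> d \<eta> = s_star \<alpha> d \<eta> + 1"

text \<open>
  \<open>s_zero\<close> can be \<open>d + 1\<close>; then \<open>s \<le> s_zero\<close> for all \<open>s \<in> [1, d]\<close> and the second branch of
  \<open>Phi_star\<close> is not reached. Truncating the argument at \<open>s_zero\<close> is the case distinction
  \<open>s \<le> s_zero\<close> / \<open>s > s_zero\<close>.
\<close>

definition Phi_star :: "real \<Rightarrow> nat \<Rightarrow> (nat \<Rightarrow> real) \<Rightarrow> real \<Rightarrow> real" where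
  "Phi_star \<alpha> d \<eta> s =
     (let u = (if s \<le> real (s_zero \<alpha> d \<eta>) then s else real (s_zero \<alpha> d \<eta>))
      in u\<^sup>2 * (lambda_star \<alpha> d \<eta> u)\<^sup>2 + (nu_star \<alpha> d \<eta> u)\<^sup>2)"

definition Phi_adp :: "real \<Rightarrow> nat \<Rightarrow> (nat \<Rightarrow> real) \<Rightarrow> real \<Rightarrow> real" where
  "Phi_adp \<alpha> d \<eta> s =
     (if \<alpha> < 2
      then max (Phi_star \<alpha> d \<eta> s)
             (Phi_star \<alpha> d \<eta> 1 * (ln (exp 1 * min s (real (s_zero \<alpha> d \<eta>))))\<^sup>2)
      else Phi_star \<alpha> d \<eta> s)"

subsection \<open>Adaptive rate of convergence\<close>

text \<open>Here \<open>\<eta> d\<close> is the loading vector in dimension \<open>d\<close>, and rates \<open>\<psi> s d\<close> matter only for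
  \<open>d \<ge> d0\<close> and \<open>s \<in> {1..d}\<close>.\<close>

definition positive_rate :: "nat \<Rightarrow> (nat \<Rightarrow> nat \<Rightarrow> real) \<Rightarrow> bool" where
  "positive_rate d0 \<psi> \<longleftrightarrow> (\<forall>d\<ge>d0. \<forall>s\<in>{1..d}. \<psi> s d > 0)"

definition min_ratio :: "(nat \<Rightarrow> nat \<Rightarrow> real) \<Rightarrow> (nat \<Rightarrow> nat \<Rightarrow> real) \<Rightarrow> nat \<Rightarrow> real" where
  "min_ratio \<psi>' \<psi> d = (MIN s\<in>{1..d}. \<psi>' s d / \<psi> s d)"

definition adaptive_rate ::
  "real \<Rightarrow> real \<Rightarrow> real \<Rightarrow> nat \<Rightarrow> (nat \<Rightarrow> nat \<Rightarrow> real) \<Rightarrow> (nat \<Rightarrow> nat \<Rightarrow> real) \<Rightarrow> bool"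
where
  "adaptive_rate \<alpha> \<tau> \<sigma> d0 \<eta> \<psi> \<longleftrightarrow>
     positive_rate d0 \<psi>
   \<and> (\<exists>L. \<exists>C::real. C > 0 \<and>
        (\<forall>d\<ge>d0. L d \<in> estimators d \<and>
           max_normalized_risk \<alpha> \<tau> \<sigma> d (\<eta> d) (\<lambda>s. \<psi> s d) (L d) \<le> ennreal C))
   \<and> (\<forall>\<psi>'. positive_rate d0 \<psi>'
        \<and> (\<exists>C'::real. C' > 0 \<and>
             (\<forall>d\<ge>d0. (INF T\<in>estimators d.
                max_normalized_risk \<alpha> \<tau> \<sigma> d (\<eta> d) (\<lambda>s. \<psi>' s d) T) \<le> ennreal C'))
        \<and> min_ratio \<psi>' \<psi> \<longlonglongrightarrow> 0
        \<longrightarrow> (\<exists>s_bar. (\<forall>d\<ge>d0. s_bar d \<in> {1..d})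
              \<and> filterlim (\<lambda>d. \<psi>' (s_bar d) d / \<psi> (s_bar d) d * min_ratio \<psi>' \<psi> d)
                  at_top sequentially))"

end

theory Submission
  imports Defs
begin

text \<open>
  Upper bound: keeping \<open>\<eta>\<^sub>j y\<^sub>j\<close> only where it exceeds \<open>\<tau> \<sigma> \<lambda>\<close> gives an estimator whose error on \<open>s\<close>-sparse
  vectors is at most \<open>\<tau> \<sigma> \<lambda> s\<close> plus a centred noise sum of variance \<open>\<sigma>\<^sup>2 \<Sum> \<eta>\<^sub>j\<^sup>2 exp (-(\<lambda>/|\<eta>\<^sub>j|)\<^sup>\<alpha>)\<close>.
  The noise in the difference of two such estimators is truncated at \<open>\<lambda>\<^sub>*(1)\<close> (if \<open>\<alpha> < 2\<close>) or subgaussian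
  (if \<open>\<alpha> \<ge> 2\<close>), hence has exponential tails at the scale of the square root of \<open>\<Phi>\<^sub>a\<^sub>d\<^sub>p\<close>, so that the
  sparsity level can be selected from the data by the Goldenshluger--Lepski rule.

  Lower bound: under noise with density proportional to \<open>exp (-b|x|\<^sup>\<alpha>)\<close>, a shift by \<open>h\<close> has chi-square cost at most
  \<open>C exp (K h\<^sup>\<alpha>)\<close>. A prior with independent signals of size \<open>c (1 + \<lambda>/|\<eta>\<^sub>j|)\<close>, present with probability
  proportional to \<open>|\<eta>\<^sub>j| exp (-(\<lambda>/|\<eta>\<^sub>j|)\<^sup>\<alpha>)\<close>, moves the functional by the order of the rate. At logarithmically
  increased intensity its chi-square cost is a small power of \<open>s\<close>. An estimator that beats the rate at some
  \<open>s > s\<^sub>c\<^sub>u\<^sub>t\<close> therefore pays a factor \<open>s\<^bsup>\<gamma>/2\<^esup>\<close> at sparsity \<open>1\<close>, while its gain at \<open>s\<close> is at most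
  logarithmic, because the nonadaptive lower bound still holds there.
\<close>

section \<open>Weights and the balance equation\<close>

text \<open>The balance equation is where upper and lower bound meet. Shifting coordinate j by c (1
  + l/|eta_j|) costs a second moment of the likelihood ratio of order \<open>1 / weight l j\<close>.
  With signal probability \<open>t * \<bar>\<eta> j\<bar> * weight l j\<close> one such factor
  cancels, so the total chi-square exponent is of order t^2 \<open>V l\<close>, and
  \<open>V l\<close> also bounds, up to a constant, the noise variance left by thresholding. The
  expected number of signals is t \<open>A l\<close>. For t = 1 / sqrt(\<open>V l\<close>) the cost
  is bounded, and having s/2 expected signals means phi = s/2. Allowing a cost of order log(es)
  raises t by the factor sqrt(log(es)) and gives the equation of \<open>beta_star\<close>. Two
  obstacles shape the rest. At the raised intensity the probabilities can exceed 1, so large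
  coordinates are discarded and their loss is charged to the rate at sparsity 1. For \<alpha> < 2,
  exponential moments of clipped noise are controlled only for slopes up to the inverse of the
  truncation level; the log^2 branch of \<open>Phi_adp\<close> pays for this.\<close>

lemma power_exp_bounded:
  fixes \<alpha> b :: real and k :: nat
  assumes "\<alpha> > 0" "b > 0"
  shows "\<exists>C\<ge>1. \<forall>x\<ge>0. x ^ k * exp (- b * x powr \<alpha>) \<le> C"
proof -
  \<comment> \<open>With this n, x^k is at most the n-th power of \<open>x powr \<alpha>\<close> for
    x > 1, and a single term of the exponential series beats that power.\<close>
  define n where "n = nat \<lceil>real k / \<alpha>\<rceil>"
  have n: "real k \<le> \<alpha> * real n"
  proof -
    have "real k / \<alpha> \<le> real n" unfolding n_def by linarith
    then show ?thesis using assms by (simp add: field_simps)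
  qed
  define C where "C = 1 + fact n / b ^ n"
  have C1: "C \<ge> 1" using assms by (simp add: C_def)
  have "x ^ k * exp (- b * x powr \<alpha>) \<le> C" if "x \<ge> 0" for x :: real
  proof (cases "x \<le> 1")
    case True
    have "x ^ k * exp (- b * x powr \<alpha>) \<le> 1 * 1"
      using True that assms by (intro mult_mono power_le_one) auto
    then show ?thesis using C1 by simp
  next
    case False
    define y where "y = x powr \<alpha>"
    have x: "x > 1" using False by simp
    have y0: "y > 0" using x by (simp add: y_def)
    have "x ^ k = x powr real k" using x by (simp add: powr_realpow)
    also have "\<dots> \<le> x powr (\<alpha> * real n)" using x n by (intro powr_mono) auto
    also have "\<dots> = y ^ n" using x y0 by (simp add: y_def powr_powr[symmetric] powr_realpow)
    finally have xk: "x ^ k \<le> y ^ n" .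
    have "(b * y) ^ n / fact n \<le> exp (b * y)"
    proof -
      have "(b * y) ^ n /\<^sub>R fact n \<le> (\<Sum>i. (b * y) ^ i /\<^sub>R fact i)"
        using sum_le_suminf[OF summable_exp_generic[of "b * y"], of "{n}"] assms y0 by (simp add: less_imp_le)
      then show ?thesis by (simp add: exp_def field_simps)
    qed
    then have "y ^ n * exp (- (b * y)) \<le> fact n / b ^ n"
      using assms by (simp add: field_simps power_mult_distrib exp_minus)
    moreover have "x ^ k * exp (- (b * y)) \<le> y ^ n * exp (- (b * y))"
      using xk by (intro mult_right_mono) auto
    ultimately have "x ^ k * exp (- (b * y)) \<le> C" unfolding C_def by linarith
    then show ?thesis by (simp add: y_def)
  qed
  then show ?thesis using C1 by blast
qed

text \<open>Turns a bound on V in which sqrt V reappears on the right into an explicit one: if x > b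
  + c, then (x - b) x already exceeds c^2.\<close>

lemma le_add_if_square_le:
  fixes x b c :: real
  assumes "x\<^sup>2 \<le> b * x + c\<^sup>2" "b \<ge> 0" "c \<ge> 0" "x \<ge> 0"
  shows "x \<le> b + c"
proof (rule ccontr)
  assume "\<not> x \<le> b + c"
  then have "x - b > c" by simp
  then have "c * c \<le> (x - b) * c" "(x - b) * c \<le> (x - b) * x" "x > 0" "c \<le> x"
    using assms by (auto intro!: mult_mono)
  moreover have "(x - b) * x \<le> c * c" using assms(1) by (simp add: algebra_simps power2_eq_square)
  ultimately have "(x - b) * x = c * c" by linarith
  moreover have "c * c \<le> c * x" using \<open>c \<le> x\<close> assms by (intro mult_mono) auto
  moreover have "c * x < (x - b) * x" using \<open>x - b > c\<close> \<open>x > 0\<close> by simp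
  ultimately show False by linarith
qed

locale loading =
  fixes \<alpha> :: real and d :: nat and \<eta> :: "nat \<Rightarrow> real"
  assumes alpha_pos: "\<alpha> > 0" and d_pos: "d \<ge> 1"
    and nonzero: "\<And>j. j \<in> {1..d} \<Longrightarrow> \<eta> j \<noteq> 0"
begin

definition weight :: "real \<Rightarrow> nat \<Rightarrow> real" where
  "weight l j = exp (- ((l / \<bar>\<eta> j\<bar>) powr \<alpha>))"

definition V :: "real \<Rightarrow> real" where "V l = (\<Sum>j=1..d. (\<eta> j)\<^sup>2 * weight l j)"
definition A :: "real \<Rightarrow> real" where "A l = (\<Sum>j=1..d. \<bar>\<eta> j\<bar> * weight l j)"

text \<open>What remains of phi(beta) = q for l = max(beta, 0)^(1/\<alpha>). The quotient
  \<open>A l / sqrt (V l)\<close> is phi at max(beta, 0), so the truncation keeps the equation when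
  l > 0 and otherwise leaves an inequality, phi being decreasing.\<close>

definition balanced :: "real \<Rightarrow> real \<Rightarrow> bool" where
  "balanced q l \<longleftrightarrow> 0 \<le> l \<and> A l \<le> q * sqrt (V l) \<and> (l > 0 \<longrightarrow> A l = q * sqrt (V l))"

lemma weight_pos: "weight l j > 0" by (simp add: weight_def)
lemma weight_le_1: "weight l j \<le> 1" by (simp add: weight_def)

lemma weight_antimono:
  assumes "0 \<le> l'" "l' \<le> l"
  shows "weight l j \<le> weight l' j"
proof -
  have "(l' / \<bar>\<eta> j\<bar>) powr \<alpha> \<le> (l / \<bar>\<eta> j\<bar>) powr \<alpha>"
    using alpha_pos assms by (intro powr_mono2 divide_right_mono) auto
  then show ?thesis unfolding weight_def exp_le_cancel_iff neg_le_iff_le .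
qed

lemma weight_ge: "0 \<le> l \<Longrightarrow> l \<le> \<bar>\<eta> j\<bar> \<Longrightarrow> exp (-1) \<le> weight l j"
proof -
  assume l: "0 \<le> l" "l \<le> \<bar>\<eta> j\<bar>"
  then have "(l / \<bar>\<eta> j\<bar>) powr \<alpha> \<le> 1 powr \<alpha>"
    using alpha_pos by (intro powr_mono2) (auto simp: divide_le_eq_1)
  then show ?thesis by (simp add: weight_def)
qed

lemma V_pos: "V l > 0"
  unfolding V_def
proof (intro sum_pos)
  show "0 < (\<eta> j)\<^sup>2 * weight l j" if "j \<in> {1..d}" for j
    using nonzero[OF that] weight_pos[of l j] by simp
qed (use d_pos in auto)

lemma V_antimono: "0 \<le> l' \<Longrightarrow> l' \<le> l \<Longrightarrow> V l \<le> V l'"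
  unfolding V_def by (intro sum_mono mult_left_mono weight_antimono) auto

text \<open>The square of phi is a^2 / v. Raising \<beta> multiplies the j-th weight by
  \<open>r j\<close>, which is ordered like |eta_j|. Chebyshev's association inequality, proved here
  by the symmetrised double sum, gives v a' \<le> v' a; together with a' < a this makes a^2 / v drop
  strictly.\<close>

lemma phi_strict_antimono:
  assumes "\<beta> < \<beta>'"
  shows "phi \<alpha> d \<eta> \<beta>' < phi \<alpha> d \<eta> \<beta>"
proof -
  define w where "w j = exp (- \<beta> / \<bar>\<eta> j\<bar> powr \<alpha>)" for j
  define r where "r j = exp (- (\<beta>' - \<beta>) / \<bar>\<eta> j\<bar> powr \<alpha>)" for j
  let ?I = "{1..d}"
  define a where "a = (\<Sum>j\<in>?I. \<bar>\<eta> j\<bar> * w j)"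
  define a' where "a' = (\<Sum>j\<in>?I. \<bar>\<eta> j\<bar> * w j * r j)"
  define v where "v = (\<Sum>j\<in>?I. (\<eta> j)\<^sup>2 * w j)"
  define v' where "v' = (\<Sum>j\<in>?I. (\<eta> j)\<^sup>2 * w j * r j)"
  have wr: "exp (- \<beta>' / \<bar>\<eta> j\<bar> powr \<alpha>) = w j * r j" for j
    unfolding w_def r_def exp_add[symmetric] by (simp add: add_divide_distrib[symmetric] diff_divide_distrib)
  have wp: "w j > 0" for j by (simp add: w_def)
  have rp: "r j > 0" for j by (simp add: r_def)
  have pos: "a > 0" "a' > 0" "v > 0" "v' > 0"
    unfolding a_def a'_def v_def v'_def using d_pos nonzero
    by (auto intro!: sum_pos mult_pos_pos wp rp)
  have aa: "a' < a"
    unfolding a_def a'_def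
  proof (intro sum_strict_mono)
    fix j assume j: "j \<in> ?I"
    have "r j < 1" using assms nonzero[OF j] by (simp add: r_def divide_neg_pos)
    then show "\<bar>\<eta> j\<bar> * w j * r j < \<bar>\<eta> j\<bar> * w j" using wp[of j] nonzero[OF j] by simp
  qed (use d_pos in auto)
  have dsum: "(\<Sum>i\<in>?I. \<Sum>j\<in>?I. f i * g j) = (\<Sum>i\<in>?I. f i) * (\<Sum>j\<in>?I. g j)" for f g :: "nat \<Rightarrow> real"
    by (simp add: sum_product)
  have id: "\<bar>x\<bar> * a * (\<bar>y\<bar> * b) * ((\<bar>x\<bar> - \<bar>y\<bar>) * (r - r'))
      = x\<^sup>2 * a * r * (\<bar>y\<bar> * b) + \<bar>x\<bar> * a * (y\<^sup>2 * b * r') - x\<^sup>2 * a * (\<bar>y\<bar> * b * r')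
        - \<bar>x\<bar> * a * r * (y\<^sup>2 * b)" for x y a b r r' :: real
  proof -
    have "x\<^sup>2 = \<bar>x\<bar> * \<bar>x\<bar>" "y\<^sup>2 = \<bar>y\<bar> * \<bar>y\<bar>" by (simp_all add: power2_eq_square)
    then show ?thesis by (simp add: algebra_simps)
  qed
  have "0 \<le> (\<Sum>i\<in>?I. \<Sum>j\<in>?I. \<bar>\<eta> i\<bar> * w i * (\<bar>\<eta> j\<bar> * w j) * ((\<bar>\<eta> i\<bar> - \<bar>\<eta> j\<bar>) * (r i - r j)))"
  proof (intro sum_nonneg)
    fix i j assume ij: "i \<in> ?I" "j \<in> ?I"
    have "0 \<le> (\<bar>\<eta> i\<bar> - \<bar>\<eta> j\<bar>) * (r i - r j)"
    proof (cases "\<bar>\<eta> j\<bar> \<le> \<bar>\<eta> i\<bar>")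
      case True
      then have "\<bar>\<eta> j\<bar> powr \<alpha> \<le> \<bar>\<eta> i\<bar> powr \<alpha>" using alpha_pos by (intro powr_mono2) auto
      then have "r j \<le> r i" using assms nonzero[OF ij(2)]
        by (auto simp: r_def divide_simps intro!: divide_left_mono)
      then show ?thesis using True by simp
    next
      case False
      then have "\<bar>\<eta> i\<bar> powr \<alpha> \<le> \<bar>\<eta> j\<bar> powr \<alpha>" using alpha_pos by (intro powr_mono2) auto
      then have "r i \<le> r j" using assms nonzero[OF ij(1)]
        by (auto simp: r_def divide_simps intro!: divide_left_mono)
      then show ?thesis using False by (simp add: mult_nonpos_nonpos)
    qed
    then show "0 \<le> \<bar>\<eta> i\<bar> * w i * (\<bar>\<eta> j\<bar> * w j) * ((\<bar>\<eta> i\<bar> - \<bar>\<eta> j\<bar>) * (r i - r j))"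
      using wp[of i] wp[of j] by simp
  qed
  also have "\<dots> = (\<Sum>i\<in>?I. \<Sum>j\<in>?I. ((\<eta> i)\<^sup>2 * w i * r i) * (\<bar>\<eta> j\<bar> * w j))
      + (\<Sum>i\<in>?I. \<Sum>j\<in>?I. (\<bar>\<eta> i\<bar> * w i) * ((\<eta> j)\<^sup>2 * w j * r j))
      - (\<Sum>i\<in>?I. \<Sum>j\<in>?I. ((\<eta> i)\<^sup>2 * w i) * (\<bar>\<eta> j\<bar> * w j * r j))
      - (\<Sum>i\<in>?I. \<Sum>j\<in>?I. (\<bar>\<eta> i\<bar> * w i * r i) * ((\<eta> j)\<^sup>2 * w j))"
    unfolding sum.distrib[symmetric] sum_subtractf[symmetric]
    by (rule sum.cong[OF refl], rule sum.cong[OF refl], rule id)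
  also have "\<dots> = 2 * (v' * a - v * a')"
    unfolding dsum a_def[symmetric] v_def[symmetric] a'_def[symmetric] v'_def[symmetric]
    by (simp add: algebra_simps)
  finally have cheb: "v * a' \<le> v' * a" by simp
  have "a'\<^sup>2 * v \<le> a' * (a * v')" using cheb pos by (simp add: power2_eq_square mult_ac mult_left_mono)
  also have "\<dots> < a * (a * v')" using aa pos by (intro mult_strict_right_mono) auto
  finally have "a'\<^sup>2 / v' < a\<^sup>2 / v" using pos by (simp add: field_simps power2_eq_square)
  then have "sqrt (a'\<^sup>2 / v') < sqrt (a\<^sup>2 / v)" by simp
  then have "a' / sqrt v' < a / sqrt v" using pos by (simp add: real_sqrt_divide)
  then show ?thesis unfolding phi_def wr a_def a'_def v_def v'_def w_def by (simp add: mult_ac)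
qed

lemma phi_continuous: "continuous_on UNIV (phi \<alpha> d \<eta>)"
proof -
  have "(\<Sum>j=1..d. (\<eta> j)\<^sup>2 * exp (- x / \<bar>\<eta> j\<bar> powr \<alpha>)) > 0" for x
    using d_pos nonzero by (intro sum_pos) auto
  then have "sqrt (\<Sum>j=1..d. (\<eta> j)\<^sup>2 * exp (- x / \<bar>\<eta> j\<bar> powr \<alpha>)) \<noteq> 0" for x
    by (simp add: less_imp_neq[symmetric])
  then show ?thesis unfolding phi_def[abs_def] using nonzero by (intro continuous_intros) auto
qed

text \<open>Intermediate value theorem. To the right, Cauchy-Schwarz bounds phi^2 by the sum of the
  weights, which tends to 0. To the left, v \<le> m a with m the largest |eta_j|, so phi^2 \<ge> a /
  m, which is unbounded.\<close>

lemma phi_root_ex1: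
  assumes "q > 0"
  shows "\<exists>!\<beta>. phi \<alpha> d \<eta> \<beta> = q"
proof -
  define w where "w \<beta> j = exp (- \<beta> / \<bar>\<eta> j\<bar> powr \<alpha>)" for \<beta> j
  define a where "a \<beta> = (\<Sum>j=1..d. \<bar>\<eta> j\<bar> * w \<beta> j)" for \<beta>
  define v where "v \<beta> = (\<Sum>j=1..d. (\<eta> j)\<^sup>2 * w \<beta> j)" for \<beta>
  have phi: "phi \<alpha> d \<eta> \<beta> = a \<beta> / sqrt (v \<beta>)" for \<beta> by (simp add: phi_def a_def v_def w_def)
  have pos: "a \<beta> > 0" "v \<beta> > 0" for \<beta>
    unfolding a_def v_def w_def using d_pos nonzero by (auto intro!: sum_pos mult_pos_pos)
  have tend: "((\<lambda>\<beta>. \<Sum>j=1..d. w \<beta> j) \<longlongrightarrow> (\<Sum>j=1..d. 0)) at_top"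
  proof (intro tendsto_sum)
    fix j assume "j \<in> {1..d}"
    then have "\<bar>\<eta> j\<bar> powr \<alpha> > 0" using nonzero by simp
    then show "((\<lambda>\<beta>. w \<beta> j) \<longlongrightarrow> 0) at_top" unfolding w_def by real_asymp
  qed
  then have "eventually (\<lambda>\<beta>. (\<Sum>j=1..d. w \<beta> j) < q\<^sup>2) at_top"
    using assms by (intro order_tendstoD(2)) auto
  then obtain b1 where b1: "(\<Sum>j=1..d. w b1 j) < q\<^sup>2" by (meson eventually_at_top_linorder order_refl)
  have up: "phi \<alpha> d \<eta> b1 \<le> q"
  proof -
    have "(a b1)\<^sup>2 \<le> v b1 * (\<Sum>j=1..d. w b1 j)"
    proof -
      have "(\<Sum>j=1..d. (\<bar>\<eta> j\<bar> * sqrt (w b1 j)) * sqrt (w b1 j))\<^sup>2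
        \<le> (\<Sum>j=1..d. (\<bar>\<eta> j\<bar> * sqrt (w b1 j))\<^sup>2) * (\<Sum>j=1..d. (sqrt (w b1 j))\<^sup>2)"
        by (rule Cauchy_Schwarz_ineq_sum)
      then show ?thesis by (simp add: a_def v_def w_def power_mult_distrib mult.assoc)
    qed
    also have "\<dots> \<le> v b1 * q\<^sup>2" using b1 pos(2)[of b1] by (intro mult_left_mono) auto
    finally have "a b1 \<le> sqrt (v b1 * q\<^sup>2)" by (intro real_le_rsqrt)
    also have "\<dots> = sqrt (v b1) * q" using assms by (simp add: real_sqrt_mult)
    finally show ?thesis unfolding phi using pos[of b1] by (simp add: divide_simps mult.commute)
  qed
  define m where "m = Max ((\<lambda>j. \<bar>\<eta> j\<bar>) ` {1..d})"
  have m: "\<bar>\<eta> j\<bar> \<le> m" if "j \<in> {1..d}" for j using that unfolding m_def by (intro Max_ge) auto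
  have "\<bar>\<eta> 1\<bar> > 0" using nonzero[of 1] d_pos by auto
  then have m0: "m > 0" using m[of 1] d_pos by fastforce
  have vm: "v \<beta> \<le> m * a \<beta>" for \<beta>
    unfolding v_def a_def sum_distrib_left
  proof (intro sum_mono)
    fix j assume j: "j \<in> {1..d}"
    have "(\<eta> j)\<^sup>2 = \<bar>\<eta> j\<bar> * \<bar>\<eta> j\<bar>" by (simp add: power2_eq_square)
    also have "\<dots> \<le> m * \<bar>\<eta> j\<bar>" using m[OF j] by (intro mult_right_mono) auto
    finally show "(\<eta> j)\<^sup>2 * w \<beta> j \<le> m * (\<bar>\<eta> j\<bar> * w \<beta> j)" by (simp add: w_def)
  qed
  have "filterlim (\<lambda>\<beta>. \<bar>\<eta> 1\<bar> * w \<beta> 1) at_top at_bot"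
    using \<open>\<bar>\<eta> 1\<bar> > 0\<close> unfolding w_def
  proof -
    have "\<bar>\<eta> 1\<bar> powr \<alpha> > 0" using \<open>\<bar>\<eta> 1\<bar> > 0\<close> by simp
    then show "filterlim (\<lambda>\<beta>. \<bar>\<eta> 1\<bar> * exp (- \<beta> / \<bar>\<eta> 1\<bar> powr \<alpha>)) at_top at_bot"
      using \<open>\<bar>\<eta> 1\<bar> > 0\<close> by real_asymp
  qed
  then have "eventually (\<lambda>\<beta>. \<bar>\<eta> 1\<bar> * w \<beta> 1 \<ge> m * q\<^sup>2) at_bot" by (simp add: filterlim_at_top)
  then have "eventually (\<lambda>\<beta>. \<beta> \<le> b1 \<and> \<bar>\<eta> 1\<bar> * w \<beta> 1 \<ge> m * q\<^sup>2) at_bot"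
    by (intro eventually_conj eventually_le_at_bot)
  then obtain b0 where b0: "b0 \<le> b1" "\<bar>\<eta> 1\<bar> * w b0 1 \<ge> m * q\<^sup>2"
    unfolding eventually_at_bot_linorder by blast
  have "\<bar>\<eta> 1\<bar> * w b0 1 \<le> a b0"
    unfolding a_def using d_pos by (intro member_le_sum) (auto simp: w_def)
  then have ab0: "a b0 \<ge> m * q\<^sup>2" using b0 by simp
  have lo: "q \<le> phi \<alpha> d \<eta> b0"
  proof -
    have "v b0 * q\<^sup>2 \<le> m * a b0 * q\<^sup>2" using vm[of b0] by (intro mult_right_mono) auto
    also have "\<dots> \<le> a b0 * a b0" using ab0 pos(1)[of b0] by (simp add: mult_ac)
    finally have "sqrt (v b0 * q\<^sup>2) \<le> a b0" using pos(1)[of b0] by (intro real_le_lsqrt) (auto simp: power2_eq_square)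
    then have "sqrt (v b0) * q \<le> a b0" using assms by (simp add: real_sqrt_mult)
    then show ?thesis unfolding phi using pos[of b0] by (simp add: divide_simps mult.commute)
  qed
  have "\<exists>x. b0 \<le> x \<and> x \<le> b1 \<and> phi \<alpha> d \<eta> x = q"
    using lo up b0(1) continuous_on_subset[OF phi_continuous] by (intro IVT2') auto
  then show ?thesis
    using phi_strict_antimono by (metis less_irrefl linorder_less_linear)
qed

lemma balanced_root:
  assumes q: "q > 0" and b: "\<beta> = (THE \<beta>. phi \<alpha> d \<eta> \<beta> = q)" and l: "l = (max \<beta> 0) powr (1 / \<alpha>)"
  shows "balanced q l"
proof -
  have root: "phi \<alpha> d \<eta> \<beta> = q" unfolding b using phi_root_ex1[OF q] by (rule theI')
  have l0: "l \<ge> 0" by (simp add: l)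
  have la: "l powr \<alpha> = max \<beta> 0" unfolding l using alpha_pos by (simp add: powr_powr)
  have w: "weight l j = exp (- max \<beta> 0 / \<bar>\<eta> j\<bar> powr \<alpha>)" for j
    using l0 by (simp add: weight_def powr_divide la)
  have phi: "phi \<alpha> d \<eta> (max \<beta> 0) = A l / sqrt (V l)"
    unfolding phi_def A_def V_def w ..
  have "phi \<alpha> d \<eta> (max \<beta> 0) \<le> q" using phi_strict_antimono[of \<beta> 0] root by (cases "\<beta> = 0") (auto simp: max_def)
  then have 1: "A l \<le> q * sqrt (V l)" using phi V_pos[of l] by (simp add: divide_simps)
  have "A l = q * sqrt (V l)" if "l > 0"
  proof -
    have "\<beta> > 0" using that by (auto simp: l max_def split: if_splits)
    then show ?thesis using root phi V_pos[of l] by (auto simp: divide_simps max_def)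
  qed
  then show ?thesis using 1 l0 by (simp add: balanced_def)
qed

section \<open>Comparison of the bias and noise terms at two thresholds\<close>

lemma root_antimono:
  assumes "0 < q" "q \<le> q'"
  shows "(max (THE \<beta>. phi \<alpha> d \<eta> \<beta> = q') 0) powr (1 / \<alpha>) \<le> (max (THE \<beta>. phi \<alpha> d \<eta> \<beta> = q) 0) powr (1 / \<alpha>)"
proof -
  have "phi \<alpha> d \<eta> (THE \<beta>. phi \<alpha> d \<eta> \<beta> = q) = q" using theI'[OF phi_root_ex1[of q]] assms by simp
  moreover have "phi \<alpha> d \<eta> (THE \<beta>. phi \<alpha> d \<eta> \<beta> = q') = q'" using theI'[OF phi_root_ex1[of q']] assms by simp
  ultimately have "(THE \<beta>. phi \<alpha> d \<eta> \<beta> = q') \<le> (THE \<beta>. phi \<alpha> d \<eta> \<beta> = q)"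
    using phi_strict_antimono assms by (metis leD leI)
  then show ?thesis using alpha_pos by (intro powr_mono2) auto
qed

text \<open>Limits the noise gained by lowering the threshold. Coordinates with |eta_j| \<le> l
  satisfy eta_j^2 \<le> l |eta_j| and contribute at most \<open>l * A l'\<close>, which balance
  bounds by q' l sqrt(\<open>V l'\<close>). The others have weight at least 1/e at l already and
  contribute at most 4 \<open>V l\<close>. What results is a quadratic inequality in
  sqrt(\<open>V l'\<close>).\<close>

lemma balanced_growth:
  assumes l: "0 \<le> l'" "l' \<le> l" and bal: "balanced q' l'" "q' \<ge> 0"
  shows "sqrt (V l') \<le> q' * l + 2 * sqrt (V l)"
proof -
  let ?S = "{j\<in>{1..d}. \<bar>\<eta> j\<bar> \<le> l}" and ?B = "{j\<in>{1..d}. \<not> \<bar>\<eta> j\<bar> \<le> l}"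
  have split: "(\<Sum>j=1..d. f j) = (\<Sum>j\<in>?S. f j) + (\<Sum>j\<in>?B. f j)" for f :: "nat \<Rightarrow> real"
    by (subst sum.union_disjoint[symmetric]) (auto intro: sum.cong)
  have "(\<Sum>j\<in>?S. (\<eta> j)\<^sup>2 * weight l' j) \<le> (\<Sum>j\<in>?S. l * (\<bar>\<eta> j\<bar> * weight l' j))"
  proof (intro sum_mono)
    fix j assume j: "j \<in> ?S"
    have "(\<eta> j)\<^sup>2 = \<bar>\<eta> j\<bar> * \<bar>\<eta> j\<bar>" by (simp add: power2_eq_square)
    also have "\<dots> \<le> l * \<bar>\<eta> j\<bar>" using j by (intro mult_right_mono) auto
    finally show "(\<eta> j)\<^sup>2 * weight l' j \<le> l * (\<bar>\<eta> j\<bar> * weight l' j)"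
      using weight_pos[of l' j] by (simp add: mult_right_mono)
  qed
  also have "\<dots> \<le> (\<Sum>j=1..d. l * (\<bar>\<eta> j\<bar> * weight l' j))"
    using l by (intro sum_mono2) (auto simp: less_imp_le[OF weight_pos])
  also have "\<dots> = l * A l'" by (simp add: A_def sum_distrib_left)
  also have "\<dots> \<le> l * (q' * sqrt (V l'))" using bal l by (intro mult_left_mono) (auto simp: balanced_def)
  finally have 1: "(\<Sum>j\<in>?S. (\<eta> j)\<^sup>2 * weight l' j) \<le> q' * l * sqrt (V l')" by (simp add: mult_ac)
  have "(\<Sum>j\<in>?B. (\<eta> j)\<^sup>2 * weight l' j) \<le> (\<Sum>j\<in>?B. 4 * ((\<eta> j)\<^sup>2 * weight l j))"
  proof (intro sum_mono)
    fix j assume j: "j \<in> ?B"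
    have "exp (-1) \<le> weight l j" using j l by (intro weight_ge) auto
    moreover have "exp (1::real) \<le> 4" using exp_le by linarith
    then have "1 / 4 \<le> exp (-1::real)" by (simp add: exp_minus field_simps)
    ultimately have "1 \<le> 4 * weight l j" by linarith
    then have "weight l' j \<le> 4 * weight l j" using weight_le_1[of l' j] by simp
    then have "(\<eta> j)\<^sup>2 * weight l' j \<le> (\<eta> j)\<^sup>2 * (4 * weight l j)" by (intro mult_left_mono) auto
    then show "(\<eta> j)\<^sup>2 * weight l' j \<le> 4 * ((\<eta> j)\<^sup>2 * weight l j)" by (simp add: mult_ac)
  qed
  also have "\<dots> \<le> (\<Sum>j=1..d. 4 * ((\<eta> j)\<^sup>2 * weight l j))"
    by (intro sum_mono2) (auto simp: less_imp_le[OF weight_pos])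
  also have "\<dots> = (2 * sqrt (V l))\<^sup>2"
    using V_pos[of l] by (simp add: V_def sum_distrib_left power_mult_distrib)
  finally have "V l' \<le> q' * l * sqrt (V l') + (2 * sqrt (V l))\<^sup>2"
    using 1 unfolding V_def[of l'] split[of "\<lambda>j. (\<eta> j)\<^sup>2 * weight l' j"] by simp
  then have "(sqrt (V l'))\<^sup>2 \<le> q' * l * sqrt (V l') + (2 * sqrt (V l))\<^sup>2"
    using V_pos[of l'] by simp
  moreover have "0 \<le> q' * l" "0 \<le> 2 * sqrt (V l)" "0 \<le> sqrt (V l')"
    using l bal less_imp_le[OF V_pos] by auto
  ultimately show ?thesis by (rule le_add_if_square_le)
qed

text \<open>Among thresholds l' \<le> l, the balanced l nearly minimises q l' +
  sqrt(\<open>V l'\<close>). If l' < l/2, Cauchy-Schwarz and balance give q^2 \<le> the sum of the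
  weights at l. In each summand l^2 times the weight at l is at most C eta_j^2 times the weight at
  l/2, because the exponent lost by halving still absorbs a square; this defines C.\<close>

lemma balanced_optimal:
  assumes l: "0 \<le> l'" "l' \<le> l" and bal: "balanced q l" "q \<ge> 0"
    and C: "C \<ge> 1" "\<And>x. x \<ge> 0 \<Longrightarrow> x\<^sup>2 * exp (- (1 - (1/2) powr \<alpha>) * x powr \<alpha>) \<le> C"
  shows "q * l \<le> 2 * C * (q * l' + sqrt (V l'))"
proof (cases "l / 2 \<le> l'")
  case True
  have "q * l \<le> q * (2 * l')" using True bal by (intro mult_left_mono) auto
  also have "\<dots> \<le> 2 * C * (q * l')" using mult_right_mono[OF C(1), of "q * l'"] bal(2) l by (simp add: mult_ac)
  also have "\<dots> \<le> 2 * C * (q * l' + sqrt (V l'))" using C(1) V_pos[of l'] by (simp add: less_imp_le)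
  finally show ?thesis .
next
  case False
  then have lp: "l > 0" using l by auto
  have "(A l)\<^sup>2 \<le> V l * (\<Sum>j=1..d. weight l j)"
  proof -
    have "(\<Sum>j=1..d. (\<bar>\<eta> j\<bar> * sqrt (weight l j)) * sqrt (weight l j))\<^sup>2
        \<le> (\<Sum>j=1..d. (\<bar>\<eta> j\<bar> * sqrt (weight l j))\<^sup>2) * (\<Sum>j=1..d. (sqrt (weight l j))\<^sup>2)"
      by (rule Cauchy_Schwarz_ineq_sum)
    then show ?thesis by (simp add: A_def V_def less_imp_le[OF weight_pos] power_mult_distrib mult.assoc)
  qed
  moreover have "(A l)\<^sup>2 = q\<^sup>2 * V l"
    using bal lp V_pos[of l] by (simp add: balanced_def power_mult_distrib)
  ultimately have N: "q\<^sup>2 \<le> (\<Sum>j=1..d. weight l j)"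
    using V_pos[of l] by (simp add: mult.commute)
  have "l\<^sup>2 * q\<^sup>2 \<le> (\<Sum>j=1..d. l\<^sup>2 * weight l j)"
    using N by (simp add: sum_distrib_left[symmetric] mult_left_mono)
  also have "\<dots> \<le> (\<Sum>j=1..d. C * ((\<eta> j)\<^sup>2 * weight l' j))"
  proof (intro sum_mono)
    fix j assume j: "j \<in> {1..d}"
    define x where "x = l / \<bar>\<eta> j\<bar>"
    have e: "\<bar>\<eta> j\<bar> > 0" using nonzero[OF j] by simp
    have x0: "x \<ge> 0" using lp by (simp add: x_def)
    have "weight (l/2) j \<le> weight l' j" using False l by (intro weight_antimono) auto
    moreover have "weight (l/2) j = exp (- ((1/2) powr \<alpha> * x powr \<alpha>))"
      using x0 lp by (simp add: weight_def x_def powr_mult[symmetric])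
    moreover have "weight l j = exp (- (x powr \<alpha>))" by (simp add: weight_def x_def)
    moreover have "x\<^sup>2 * exp (- (x powr \<alpha>)) \<le> C * exp (- ((1/2) powr \<alpha> * x powr \<alpha>))"
    proof -
      have "x\<^sup>2 * exp (- (x powr \<alpha>)) = x\<^sup>2 * exp (- (1 - (1/2) powr \<alpha>) * x powr \<alpha>) * exp (- ((1/2) powr \<alpha> * x powr \<alpha>))"
        by (simp add: mult.assoc exp_add[symmetric] algebra_simps)
      also have "\<dots> \<le> C * exp (- ((1/2) powr \<alpha> * x powr \<alpha>))"
        using C(2)[OF x0] by (intro mult_right_mono) auto
      finally show ?thesis .
    qed
    ultimately have "x\<^sup>2 * weight l j \<le> C * weight l' j"
      using C(1) by (smt (verit) mult_left_mono)
    then have "(\<eta> j)\<^sup>2 * (x\<^sup>2 * weight l j) \<le> (\<eta> j)\<^sup>2 * (C * weight l' j)" by (intro mult_left_mono) auto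
    moreover have "(\<eta> j)\<^sup>2 * (x\<^sup>2 * weight l j) = l\<^sup>2 * weight l j" using e by (simp add: x_def power_divide)
    moreover have "(\<eta> j)\<^sup>2 * (C * weight l' j) = C * ((\<eta> j)\<^sup>2 * weight l' j)" by (rule mult.left_commute)
    ultimately show "l\<^sup>2 * weight l j \<le> C * ((\<eta> j)\<^sup>2 * weight l' j)" by linarith
  qed
  also have "\<dots> = C * V l'" by (simp add: V_def sum_distrib_left)
  also have "\<dots> \<le> C\<^sup>2 * V l'" using C(1) V_pos[of l'] by (simp add: power2_eq_square mult_le_cancel_right)
  finally have "(q * l)\<^sup>2 \<le> (C * sqrt (V l'))\<^sup>2"
    using V_pos[of l'] by (simp add: power_mult_distrib mult.commute)
  then have "q * l \<le> C * sqrt (V l')" 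
    by (rule power2_le_imp_le) (use C(1) V_pos[of l'] in simp)
  also have "\<dots> \<le> 2 * C * (q * l' + sqrt (V l'))"
  proof -
    have "0 \<le> C * (q * l')" using C(1) l bal(2) by (intro mult_nonneg_nonneg) auto
    moreover have "0 \<le> C * sqrt (V l')" using C(1) V_pos[of l'] by (intro mult_nonneg_nonneg) auto
    ultimately show ?thesis by (simp add: algebra_simps)
  qed
  finally show ?thesis .
qed

end

section \<open>The rates\<close>

definition elog :: "real \<Rightarrow> real" where "elog s = ln (exp 1 * s)"

lemma elog_eq: "s > 0 \<Longrightarrow> elog s = 1 + ln s"
  by (simp add: elog_def ln_mult)

lemma elog_ge_1: "s \<ge> 1 \<Longrightarrow> elog s \<ge> 1"
  by (simp add: elog_eq)

lemma elog_1 [simp]: "elog 1 = 1"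
  by (simp add: elog_def)

lemma elog_mono: "1 \<le> s \<Longrightarrow> s \<le> u \<Longrightarrow> elog s \<le> elog u"
  by (simp add: elog_eq)

lemma elog_le: "s \<ge> 1 \<Longrightarrow> elog s \<le> s"
  using ln_le_minus_one[of s] by (simp add: elog_eq)

text \<open>That is, elog s / s decreases: ln grows by at most u/s - 1 from s to u, and elog s \<ge>
  1 turns this increment into a factor.\<close>

lemma elog_ratio:
  assumes "1 \<le> s" "s \<le> u"
  shows "elog u \<le> (u / s) * elog s"
proof -
  have "ln (u / s) \<le> u / s - 1" using assms by (intro ln_le_minus_one) auto
  moreover have "ln (u / s) = ln u - ln s" using assms by (intro ln_divide_pos) auto
  ultimately have "elog u \<le> elog s + (u / s - 1)" using assms by (simp add: elog_eq)
  moreover have "(u / s - 1) * 1 \<le> (u / s - 1) * elog s"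
    using assms elog_ge_1[of s] by (intro mult_left_mono) auto
  ultimately show ?thesis by (simp add: algebra_simps)
qed

lemma sqrt_elog_ratio:
  assumes "1 \<le> s" "s \<le> u"
  shows "sqrt (elog u) \<le> (u / s) * sqrt (elog s)"
proof -
  have r: "1 \<le> u / s" using assms by simp
  have "elog u \<le> (u / s) * elog s" using assms by (rule elog_ratio)
  also have "\<dots> \<le> (u / s)\<^sup>2 * elog s"
    using r elog_ge_1[of s] assms by (intro mult_right_mono self_le_power) auto
  finally have "sqrt (elog u) \<le> sqrt ((u / s)\<^sup>2 * elog s)" by simp
  also have "\<dots> = (u / s) * sqrt (elog s)" using r assms by (simp add: real_sqrt_mult)
  finally show ?thesis .
qed

text \<open>Right side of the equation for \<open>beta_star\<close>. Multiplied by sqrt(elog s) it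
  is s/2, which turns balance at this level into statements about \<open>G\<close>.\<close>

definition star_level :: "real \<Rightarrow> real" where "star_level s = s / (2 * sqrt (elog s))"

lemma star_level_pos: "s \<ge> 1 \<Longrightarrow> star_level s > 0"
  using elog_ge_1[of s] by (auto simp: star_level_def)

lemma star_level_mono:
  assumes "1 \<le> s" "s \<le> u"
  shows "star_level s \<le> star_level u"
proof -
  have p: "sqrt (elog s) > 0" "sqrt (elog u) > 0" using elog_ge_1[of s] elog_ge_1[of u] assms by auto
  have "s * sqrt (elog u) \<le> u * sqrt (elog s)"
    using sqrt_elog_ratio[OF assms] assms by (simp add: field_simps)
  then show ?thesis using p by (simp add: star_level_def divide_simps)
qed

lemma star_level_le: "s \<ge> 1 \<Longrightarrow> star_level s \<le> s / 2"
proof -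
  assume s: "s \<ge> 1"
  then have "1 \<le> sqrt (elog s)" using elog_ge_1[OF s] by simp
  then have "s / (2 * sqrt (elog s)) \<le> s / 2" using s by (intro divide_left_mono) auto
  then show ?thesis by (simp add: star_level_def)
qed

lemma star_level_mult: "s \<ge> 1 \<Longrightarrow> sqrt (elog s) * star_level s = s / 2"
  using elog_ge_1[of s] by (auto simp: star_level_def)

text \<open>Fixed once for each \<alpha>, so that the same constant serves all dimensions and
  loadings. It is the C of \<open>balanced_optimal\<close>.\<close>

definition opt_const :: "real \<Rightarrow> real" where
  "opt_const \<alpha> = (SOME C. C \<ge> 1 \<and> (\<forall>x\<ge>0. x\<^sup>2 * exp (- (1 - (1/2) powr \<alpha>) * x powr \<alpha>) \<le> C))"

lemma opt_const:
  assumes "\<alpha> > 0"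
  shows "opt_const \<alpha> \<ge> 1"
    and "x \<ge> 0 \<Longrightarrow> x\<^sup>2 * exp (- (1 - (1/2) powr \<alpha>) * x powr \<alpha>) \<le> opt_const \<alpha>"
proof -
  have "(1/2) powr \<alpha> < (1/2) powr (0::real)" using assms by (intro powr_less_mono') auto
  then have "1 - (1/2) powr \<alpha> > (0::real)" by simp
  then have "\<exists>C. C \<ge> 1 \<and> (\<forall>x\<ge>0. x\<^sup>2 * exp (- (1 - (1/2) powr \<alpha>) * x powr \<alpha>) \<le> C)"
    using power_exp_bounded[OF assms, of "1 - (1/2) powr \<alpha>" 2] by blast
  then have *: "opt_const \<alpha> \<ge> 1 \<and> (\<forall>x\<ge>0. x\<^sup>2 * exp (- (1 - (1/2) powr \<alpha>) * x powr \<alpha>) \<le> opt_const \<alpha>)"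
    unfolding opt_const_def by (rule someI_ex)
  show "opt_const \<alpha> \<ge> 1" using * by blast
  show "x \<ge> 0 \<Longrightarrow> x\<^sup>2 * exp (- (1 - (1/2) powr \<alpha>) * x powr \<alpha>) \<le> opt_const \<alpha>" using * by blast
qed

context loading
begin

abbreviation lo :: "real \<Rightarrow> real" where "lo \<equiv> lambda_o \<alpha> d \<eta>"
abbreviation ls :: "real \<Rightarrow> real" where "ls \<equiv> lambda_star \<alpha> d \<eta>"
abbreviation no :: "real \<Rightarrow> real" where "no \<equiv> nu_o \<alpha> d \<eta>"
abbreviation ns :: "real \<Rightarrow> real" where "ns \<equiv> nu_star \<alpha> d \<eta>"
abbreviation s0 :: nat where "s0 \<equiv> s_zero \<alpha> d \<eta>"

text \<open>Square-root scale version of \<open>Phi_star\<close>: up to saturation,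
  \<open>Phi_star\<close> and G^2 agree within a factor 2. On this scale the balance inequalities
  are linear.\<close>

definition G :: "real \<Rightarrow> real" where "G s = s * ls s + ns s"

lemma no_eq: "no s = sqrt (V (lo s))"
  by (simp add: nu_o_def V_def weight_def)

lemma ns_eq: "ns s = sqrt (elog s) * sqrt (V (ls s))"
  by (simp add: nu_star_def V_def weight_def elog_def real_sqrt_mult)

lemma lo_nonneg: "lo s \<ge> 0" by (simp add: lambda_o_def)
lemma ls_nonneg: "ls s \<ge> 0" by (simp add: lambda_star_def)
lemma no_pos: "no s > 0" by (simp add: no_eq V_pos)
lemma ns_pos: "s \<ge> 1 \<Longrightarrow> ns s > 0" using elog_ge_1[of s] by (simp add: ns_eq V_pos)
lemma G_pos: "s \<ge> 1 \<Longrightarrow> G s > 0" using ns_pos[of s] ls_nonneg[of s] by (simp add: G_def add_nonneg_pos)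

lemma beta_star_eq: "beta_star \<alpha> d \<eta> s = (THE \<beta>. phi \<alpha> d \<eta> \<beta> = star_level s)"
  by (simp add: beta_star_def star_level_def elog_def)

lemma balanced_o: "s \<ge> 1 \<Longrightarrow> balanced (s / 2) (lo s)"
  by (rule balanced_root[OF _ _ lambda_o_def]) (auto simp: beta_o_def)

lemma balanced_star: "s \<ge> 1 \<Longrightarrow> balanced (star_level s) (ls s)"
  by (rule balanced_root[OF _ _ lambda_star_def]) (auto simp: beta_star_eq star_level_pos)

lemma ls_antimono: "1 \<le> s \<Longrightarrow> s \<le> u \<Longrightarrow> ls u \<le> ls s"
  unfolding lambda_star_def beta_star_eq by (intro root_antimono star_level_pos star_level_mono)

lemma lo_antimono: "1 \<le> s \<Longrightarrow> s \<le> u \<Longrightarrow> lo u \<le> lo s"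
  unfolding lambda_o_def beta_o_def by (intro root_antimono) auto

lemma lo_le_ls: "1 \<le> s \<Longrightarrow> lo s \<le> ls s"
  unfolding lambda_o_def beta_o_def lambda_star_def beta_star_eq
  by (intro root_antimono star_level_pos star_level_le)

lemma ls_1: "ls 1 = lo 1"
  unfolding lambda_o_def beta_o_def lambda_star_def beta_star_eq by (simp add: star_level_def)

lemma ns_1: "ns 1 = no 1"
  by (simp add: ns_eq no_eq ls_1)

abbreviation Ko :: real where "Ko \<equiv> opt_const \<alpha>"

lemma Ko_ge_1: "Ko \<ge> 1" using opt_const(1)[OF alpha_pos] .

lemma ls_optimal:
  assumes "s \<ge> 1" "0 \<le> l'" "l' \<le> ls s"
  shows "s * ls s \<le> 2 * Ko * (s * l' + 2 * sqrt (elog s) * sqrt (V l'))"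
proof -
  have "star_level s * ls s \<le> 2 * Ko * (star_level s * l' + sqrt (V l'))"
    using assms balanced_star star_level_pos[of s]
    by (intro balanced_optimal opt_const[OF alpha_pos]) auto
  then have "2 * sqrt (elog s) * (star_level s * ls s)
      \<le> 2 * sqrt (elog s) * (2 * Ko * (star_level s * l' + sqrt (V l')))"
    using elog_ge_1[OF assms(1)] by (intro mult_left_mono) auto
  moreover have "2 * sqrt (elog s) * (star_level s * x) = s * x" for x
    using star_level_mult[OF assms(1)] by (simp add: mult.assoc[symmetric])
  ultimately show ?thesis
    by (simp add: distrib_left mult.left_commute[of _ "2 * Ko"] del: mult_le_cancel_left_pos)
qed

text \<open>Near-optimality of the threshold at s, tested against the smaller threshold at u. The
  bias of the estimator of level s is thus covered by the rate at every larger level, as the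
  comparison of two levels requires.\<close>

lemma ls_le_G:
  assumes "1 \<le> s" "s \<le> u"
  shows "s * ls s \<le> 4 * Ko * G u"
proof -
  have "s * ls s \<le> 2 * Ko * (s * ls u + 2 * sqrt (elog s) * sqrt (V (ls u)))"
    using assms ls_antimono ls_nonneg by (intro ls_optimal) auto
  also have "\<dots> \<le> 2 * Ko * (2 * (u * ls u) + 2 * (sqrt (elog u) * sqrt (V (ls u))))"
  proof (intro mult_left_mono add_mono)
    show "s * ls u \<le> 2 * (u * ls u)"
      using mult_right_mono[OF assms(2) ls_nonneg[of u]] ls_nonneg[of u] assms
      by (smt (verit) mult_nonneg_nonneg)
    show "2 * sqrt (elog s) * sqrt (V (ls u)) \<le> 2 * (sqrt (elog u) * sqrt (V (ls u)))"
      using elog_mono[OF assms] V_pos[of "ls u"] by (simp add: mult_right_mono)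
  qed (use Ko_ge_1 in auto)
  finally show ?thesis by (simp add: G_def ns_eq algebra_simps)
qed

text \<open>Thresholds decrease in s, so the bias term grows at most linearly. The noise term is
  \<open>balanced_growth\<close> multiplied by sqrt(elog u), which turns \<open>star_level u\<close>
  into u/2.\<close>

lemma G_growth:
  assumes "1 \<le> s" "s \<le> u"
  shows "G u \<le> 2 * (u / s) * G s"
proof -
  have r: "u / s \<ge> 1" using assms by simp
  have "sqrt (V (ls u)) \<le> star_level u * ls s + 2 * sqrt (V (ls s))"
    using assms ls_antimono ls_nonneg balanced_star[of u] star_level_pos[of u]
    by (intro balanced_growth) auto
  then have "ns u \<le> sqrt (elog u) * (star_level u * ls s + 2 * sqrt (V (ls s)))"
    unfolding ns_eq using elog_ge_1[of u] assms by (intro mult_left_mono) auto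
  also have "\<dots> = (u / 2) * ls s + 2 * (sqrt (elog u) * sqrt (V (ls s)))"
    using star_level_mult[of u] assms by (simp add: distrib_left mult.assoc[symmetric])
  also have "\<dots> \<le> (u / 2) * ls s + 2 * ((u / s) * sqrt (elog s) * sqrt (V (ls s)))"
    using sqrt_elog_ratio[OF assms] V_pos[of "ls s"]
    by (intro add_left_mono mult_left_mono mult_right_mono) auto
  finally have 1: "ns u \<le> (u / 2) * ls s + 2 * ((u / s) * ns s)" by (simp add: ns_eq mult.assoc)
  have "u * ls u \<le> u * ls s" using assms ls_antimono[OF assms] by (intro mult_left_mono) auto
  then have "G u \<le> (3/2) * (u * ls s) + 2 * ((u / s) * ns s)" using 1 by (simp add: G_def)
  also have "\<dots> \<le> 2 * (u * ls s) + 2 * ((u / s) * ns s)" using ls_nonneg[of s] assms by simp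
  also have "\<dots> = 2 * (u / s) * G s" using assms by (simp add: G_def field_simps)
  finally show ?thesis .
qed

text \<open>The nonadaptive threshold \<open>lo s\<close> lies below \<open>ls s\<close>, so it is
  an admissible competitor for the bias, and V is smaller at \<open>ls s\<close>. The price of
  adaptation on this scale is therefore at most of order sqrt(log(es)).\<close>

lemma G_le_o:
  assumes "1 \<le> s"
  shows "G s \<le> 5 * Ko * sqrt (elog s) * (lo s * s + no s)"
proof -
  define x where "x = sqrt (elog s)"
  have x1: "x \<ge> 1" using elog_ge_1[OF assms] by (simp add: x_def)
  have "s * ls s \<le> 2 * Ko * (s * lo s + 2 * x * no s)"
    unfolding x_def no_eq using assms lo_nonneg lo_le_ls by (intro ls_optimal) auto
  also have "\<dots> \<le> 2 * Ko * (2 * (x * (s * lo s)) + 2 * (x * no s))"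
  proof (intro mult_left_mono add_mono)
    show "s * lo s \<le> 2 * (x * (s * lo s))" using mult_right_mono[OF x1, of "s * lo s"] assms lo_nonneg[of s] by simp
  qed (use Ko_ge_1 in auto)
  also have "\<dots> = 4 * Ko * x * (lo s * s + no s)" by (simp add: algebra_simps)
  finally have 1: "s * ls s \<le> 4 * Ko * x * (lo s * s + no s)" .
  have "ns s \<le> x * no s"
    unfolding ns_eq x_def no_eq using V_antimono[OF lo_nonneg lo_le_ls[OF assms]] elog_ge_1[OF assms] by simp
  also have "\<dots> \<le> Ko * (x * (lo s * s + no s))"
  proof -
    have "x * no s \<le> x * (lo s * s + no s)" using x1 lo_nonneg[of s] assms by (intro mult_left_mono) auto
    also have "1 * (x * (lo s * s + no s)) \<le> Ko * (x * (lo s * s + no s))"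
      using Ko_ge_1 x1 lo_nonneg[of s] no_pos[of s] assms by (intro mult_right_mono) auto
    finally show ?thesis by simp
  qed
  finally show ?thesis using 1 by (simp add: G_def x_def algebra_simps)
qed

text \<open>Serves the second branch of \<open>Phi_adp\<close>. Since \<open>lo s\<close> is below
  the threshold at sparsity 1, the rate at sparsity 1 is dominated by the nonadaptive rate at every
  s.\<close>

lemma G_1_le_o:
  assumes "1 \<le> s"
  shows "G 1 \<le> 5 * Ko * (lo s * s + no s)"
proof -
  have le: "lo s \<le> ls 1" using lo_antimono[of 1 s] assms by (simp add: ls_1)
  have "1 * ls 1 \<le> 2 * Ko * (1 * lo s + 2 * sqrt (elog 1) * sqrt (V (lo s)))"
    using assms lo_nonneg le by (intro ls_optimal) auto
  also have "\<dots> \<le> 2 * Ko * (2 * (lo s * s) + 2 * no s)"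
  proof (intro mult_left_mono add_mono)
    show "1 * lo s \<le> 2 * (lo s * s)"
      using mult_left_mono[of 1 s "lo s"] assms lo_nonneg[of s] by simp
  qed (use Ko_ge_1 in \<open>auto simp: no_eq\<close>)
  finally have 1: "ls 1 \<le> 4 * Ko * (lo s * s + no s)" by (simp add: algebra_simps)
  have "ns 1 \<le> no s" unfolding ns_eq no_eq using V_antimono[OF lo_nonneg le] by simp
  also have "\<dots> \<le> 1 * (lo s * s + no s)" using lo_nonneg[of s] assms by simp
  also have "\<dots> \<le> Ko * (lo s * s + no s)"
    using Ko_ge_1 lo_nonneg[of s] no_pos[of s] assms by (intro mult_right_mono) auto
  finally show ?thesis using 1 by (simp add: G_def algebra_simps)
qed

section \<open>The saturation index and growth bounds for the adaptive rate\<close>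

lemma s_zero_bounds: "1 \<le> s0" "s0 \<le> d + 1"
proof -
  show "1 \<le> s0" by (simp add: s_zero_def)
  show "s0 \<le> d + 1"
  proof (cases "{s \<in> {1..d}. ls (real s) > 0} = {}")
    case False
    then have "Max {s \<in> {1..d}. ls (real s) > 0} \<in> {s \<in> {1..d}. ls (real s) > 0}" by (intro Max_in) auto
    then show ?thesis using False by (auto simp: s_zero_def s_star_def Let_def)
  qed (simp add: s_zero_def s_star_def Let_def)
qed

lemma ls_s_zero:
  assumes "s0 \<le> d"
  shows "ls (real s0) = 0"
proof (rule ccontr)
  assume "ls (real s0) \<noteq> 0"
  then have "ls (real s0) > 0" using ls_nonneg[of "real s0"] by simp
  then have *: "s0 \<in> {s \<in> {1..d}. ls (real s) > 0}" using assms s_zero_bounds by auto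
  then have "s0 \<le> Max {s \<in> {1..d}. ls (real s) > 0}" by (intro Max_ge) auto
  also have "\<dots> = s_star \<alpha> d \<eta>" using * unfolding s_star_def Let_def by (subst if_not_P) auto
  finally show False by (simp add: s_zero_def)
qed

text \<open>Thresholds decrease in s, so positivity at \<open>s_star\<close> passes down. It yields
  equality in the balance relation for all m < s0, on which the lower bound rests.\<close>

lemma ls_pos_below:
  assumes "1 \<le> m" "m < s0"
  shows "ls (real m) > 0"
proof -
  let ?S = "{s \<in> {1..d}. ls (real s) > 0}"
  have ne: "?S \<noteq> {}" using assms by (auto simp: s_zero_def s_star_def Let_def split: if_splits)
  then have "s_star \<alpha> d \<eta> = Max ?S" unfolding s_star_def Let_def by (subst if_not_P) auto
  moreover have "Max ?S \<in> ?S" using ne by (intro Max_in) auto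
  ultimately have "ls (real (s_star \<alpha> d \<eta>)) > 0" by auto
  moreover have "m \<le> s_star \<alpha> d \<eta>" using assms by (simp add: s_zero_def)
  ultimately show ?thesis using ls_antimono[of "real m" "real (s_star \<alpha> d \<eta>)"] assms by simp
qed

lemma Phi_star_eq: "s \<le> real s0 \<Longrightarrow> Phi_star \<alpha> d \<eta> s = (s * ls s)\<^sup>2 + (ns s)\<^sup>2"
  by (simp add: Phi_star_def power_mult_distrib)

lemma Phi_star_le_G:
  assumes "1 \<le> s" "s \<le> real s0"
  shows "Phi_star \<alpha> d \<eta> s \<le> (G s)\<^sup>2"
  using assms ls_nonneg[of s] ns_pos[of s] by (simp add: Phi_star_eq G_def power2_sum)

lemma G_le_Phi_star:
  assumes "1 \<le> s" "s \<le> real s0"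
  shows "(G s)\<^sup>2 \<le> 2 * Phi_star \<alpha> d \<eta> s"
  using sum_squares_bound[of "s * ls s" "ns s"] assms by (simp add: Phi_star_eq G_def power2_sum)

lemma Phi_star_pos: "1 \<le> s \<Longrightarrow> s \<le> real s0 \<Longrightarrow> Phi_star \<alpha> d \<eta> s > 0"
  using ns_pos[of s] by (simp add: Phi_star_eq add_nonneg_pos)

lemma Phi_adp_eq:
  assumes "s \<le> real s0"
  shows "Phi_adp \<alpha> d \<eta> s = (if \<alpha> < 2 then max (Phi_star \<alpha> d \<eta> s) (Phi_star \<alpha> d \<eta> 1 * (elog s)\<^sup>2)
      else Phi_star \<alpha> d \<eta> s)"
  using assms by (simp add: Phi_adp_def elog_def min_def)

lemma Phi_adp_ge_star: "s \<le> real s0 \<Longrightarrow> Phi_star \<alpha> d \<eta> s \<le> Phi_adp \<alpha> d \<eta> s"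
  by (simp add: Phi_adp_eq)

lemma Phi_adp_saturates: "real s0 \<le> s \<Longrightarrow> Phi_adp \<alpha> d \<eta> s = Phi_adp \<alpha> d \<eta> (real s0)"
  by (cases "s = real s0") (simp_all add: Phi_adp_def Phi_star_def min_def)

lemma Phi_adp_pos:
  assumes "1 \<le> s"
  shows "Phi_adp \<alpha> d \<eta> s > 0"
proof (cases "s \<le> real s0")
  case True
  then show ?thesis using Phi_star_pos[OF assms True] Phi_adp_ge_star[OF True] by linarith
next
  case False
  then show ?thesis using Phi_adp_saturates[of s] Phi_star_pos[of "real s0"] Phi_adp_ge_star[of "real s0"] s_zero_bounds
    by simp
qed

text \<open>The factor 8 is 4 from squaring \<open>G_growth\<close> times 2 from replacing G^2 by
  \<open>Phi_star\<close>. The logarithmic branch grows no faster, by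
  \<open>elog_ratio\<close>.\<close>

lemma Phi_adp_growth:
  assumes "1 \<le> s" "s \<le> u" "u \<le> real s0"
  shows "Phi_adp \<alpha> d \<eta> u \<le> 8 * (u / s)\<^sup>2 * Phi_adp \<alpha> d \<eta> s"
proof -
  have r: "(u / s)\<^sup>2 \<ge> 0" by simp
  have "Phi_star \<alpha> d \<eta> u \<le> (G u)\<^sup>2" using assms by (intro Phi_star_le_G) auto
  also have "\<dots> \<le> (2 * (u / s) * G s)\<^sup>2" using G_growth[OF assms(1,2)] G_pos[of u] assms by (intro power_mono) auto
  also have "\<dots> = 4 * (u / s)\<^sup>2 * (G s)\<^sup>2" by (simp add: power_mult_distrib power_divide)
  also have "\<dots> \<le> 4 * (u / s)\<^sup>2 * (2 * Phi_star \<alpha> d \<eta> s)" using assms by (intro mult_left_mono G_le_Phi_star) auto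
  finally have 1: "Phi_star \<alpha> d \<eta> u \<le> 8 * (u / s)\<^sup>2 * Phi_star \<alpha> d \<eta> s" by simp
  also have "\<dots> \<le> 8 * (u / s)\<^sup>2 * Phi_adp \<alpha> d \<eta> s" using assms by (intro mult_left_mono Phi_adp_ge_star) auto
  finally have 2: "Phi_star \<alpha> d \<eta> u \<le> 8 * (u / s)\<^sup>2 * Phi_adp \<alpha> d \<eta> s" .
  show ?thesis
  proof (cases "\<alpha> < 2")
    case True
    have P1: "Phi_star \<alpha> d \<eta> 1 > 0" using s_zero_bounds by (intro Phi_star_pos) auto
    have "(elog u)\<^sup>2 \<le> ((u / s) * elog s)\<^sup>2"
      using elog_ratio[OF assms(1,2)] elog_ge_1[of u] assms by (intro power_mono) auto
    then have "Phi_star \<alpha> d \<eta> 1 * (elog u)\<^sup>2 \<le> (u / s)\<^sup>2 * (Phi_star \<alpha> d \<eta> 1 * (elog s)\<^sup>2)"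
      using P1 by (simp only: power_mult_distrib) (simp add: mult_ac mult_left_mono)
    also have "\<dots> \<le> (u / s)\<^sup>2 * Phi_adp \<alpha> d \<eta> s" using True assms by (intro mult_left_mono) (auto simp: Phi_adp_eq)
    also have "\<dots> \<le> 8 * (u / s)\<^sup>2 * Phi_adp \<alpha> d \<eta> s"
    proof -
      have "0 \<le> (u / s)\<^sup>2 * Phi_adp \<alpha> d \<eta> s" using Phi_adp_pos[OF assms(1)] by (intro mult_nonneg_nonneg) auto
      then show ?thesis by (simp only: mult.assoc)
    qed
    finally show ?thesis using 2 True assms by (simp add: Phi_adp_eq[of u])
  next
    case False
    then show ?thesis using 2 assms by (simp add: Phi_adp_eq[of u])
  qed
qed

text \<open>The first branch loses sqrt(log) in \<open>G_le_o\<close>, hence one logarithm after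
  squaring; the second carries its log^2 explicitly. Read backwards, no estimator can beat
  \<open>Phi_adp\<close> by more than order log^2.\<close>

lemma Phi_adp_le_o:
  assumes "1 \<le> s" "s \<le> real s0"
  shows "Phi_adp \<alpha> d \<eta> s \<le> 25 * Ko\<^sup>2 * (elog s)\<^sup>2 * Phi_o \<alpha> d \<eta> s"
proof -
  let ?P = "(lo s * s + no s)"
  have P: "?P > 0" using lo_nonneg[of s] no_pos[of s] assms by (intro add_nonneg_pos) auto
  have l1: "elog s \<ge> 1" using elog_ge_1 assms by auto
  have "Phi_star \<alpha> d \<eta> s \<le> (G s)\<^sup>2" using assms by (intro Phi_star_le_G) auto
  also have "\<dots> \<le> (5 * Ko * sqrt (elog s) * ?P)\<^sup>2" using G_le_o[of s] G_pos[of s] assms by (intro power_mono) auto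
  also have "\<dots> = 25 * Ko\<^sup>2 * ?P\<^sup>2 * elog s" using l1 by (simp add: power_mult_distrib)
  also have "\<dots> \<le> 25 * Ko\<^sup>2 * ?P\<^sup>2 * (elog s)\<^sup>2" using l1 by (intro mult_left_mono self_le_power) auto
  finally have 1: "Phi_star \<alpha> d \<eta> s \<le> 25 * Ko\<^sup>2 * ?P\<^sup>2 * (elog s)\<^sup>2" .
  have "Phi_star \<alpha> d \<eta> 1 \<le> (G 1)\<^sup>2" using s_zero_bounds by (intro Phi_star_le_G) auto
  also have "\<dots> \<le> (5 * Ko * ?P)\<^sup>2" using G_1_le_o[of s] G_pos[of 1] assms by (intro power_mono) auto
  also have "\<dots> = 25 * Ko\<^sup>2 * ?P\<^sup>2" by (simp add: power_mult_distrib)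
  finally have "Phi_star \<alpha> d \<eta> 1 * (elog s)\<^sup>2 \<le> 25 * Ko\<^sup>2 * ?P\<^sup>2 * (elog s)\<^sup>2" by (intro mult_right_mono) auto
  then show ?thesis using 1 assms by (auto simp: Phi_adp_eq Phi_o_def mult_ac)
qed

end

section \<open>A noise law with controlled shifts\<close>

text \<open>Bounds for the powers n and n + 2 against the exponential add up to domination by a
  multiple of 1 / (1 + x^2).\<close>

lemma integrable_stretched_exp:
  fixes \<alpha> b :: real
  assumes "\<alpha> > 0" "b > 0"
  shows "integrable lborel (\<lambda>x::real. x ^ n * exp (- b * \<bar>x\<bar> powr \<alpha>))"
proof -
  obtain C1 where C1: "C1 \<ge> 1" "\<And>x. x \<ge> 0 \<Longrightarrow> x ^ n * exp (- b * x powr \<alpha>) \<le> C1"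
    using power_exp_bounded[OF assms, of n] by blast
  obtain C2 where C2: "C2 \<ge> 1" "\<And>x. x \<ge> 0 \<Longrightarrow> x ^ (n + 2) * exp (- b * x powr \<alpha>) \<le> C2"
    using power_exp_bounded[OF assms, of "n + 2"] by blast
  have "integrable lborel (\<lambda>x::real. inverse (1 + x\<^sup>2))"
    using integrable_inverse_1_plus_square by (simp add: set_integrable_def)
  then have int: "integrable lborel (\<lambda>x::real. (C1 + C2) * inverse (1 + x\<^sup>2))" by simp
  show ?thesis
  proof (rule Bochner_Integration.integrable_bound[OF int])
    show "AE x in lborel. norm (x ^ n * exp (- b * \<bar>x\<bar> powr \<alpha>)) \<le> norm ((C1 + C2) * inverse (1 + x\<^sup>2))"
    proof (intro AE_I2)
      fix x :: real
      let ?e = "exp (- b * \<bar>x\<bar> powr \<alpha>)"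
      have "\<bar>x\<bar> ^ n * ?e * (1 + x\<^sup>2) = \<bar>x\<bar> ^ n * ?e + \<bar>x\<bar> ^ (n + 2) * ?e"
        by (simp add: algebra_simps power_add power2_eq_square)
      also have "\<dots> \<le> C1 + C2" by (intro add_mono C1 C2) auto
      finally have "\<bar>x\<bar> ^ n * ?e \<le> (C1 + C2) / (1 + x\<^sup>2)" by (simp add: pos_le_divide_eq add_pos_nonneg)
      then show "norm (x ^ n * ?e) \<le> norm ((C1 + C2) * inverse (1 + x\<^sup>2))"
        using C1(1) C2(1) by (simp add: abs_mult power_abs divide_inverse)
    qed
  qed simp
qed

text \<open>Covers all \<alpha> > 0 at once: if |h| is small compared with |u|, enlarge |u| by the
  factor 1 + \<epsilon>, otherwise bound everything by |h|. The coefficient 3/2 has to stay below 2,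
  because the integrand g(x)^2 / g(x + h) of the chi-square cost has only twice the exponent of g to
  spend.\<close>

lemma powr_shift_le:
  fixes \<alpha> u h :: real
  assumes "\<alpha> > 0"
  defines "\<epsilon> \<equiv> (3/2) powr (1 / \<alpha>) - 1"
  shows "\<bar>u + h\<bar> powr \<alpha> \<le> 3/2 * \<bar>u\<bar> powr \<alpha> + (1 + 1 / \<epsilon>) powr \<alpha> * \<bar>h\<bar> powr \<alpha>"
proof -
  have "(3/2::real) powr 0 < (3/2) powr (1 / \<alpha>)" using assms by (intro powr_less_mono) auto
  then have e: "\<epsilon> > 0" by (simp add: \<epsilon>_def)
  have e1: "(1 + \<epsilon>) powr \<alpha> = 3/2" using assms by (simp add: \<epsilon>_def powr_powr)
  show ?thesis
  proof (cases "\<bar>h\<bar> \<le> \<epsilon> * \<bar>u\<bar>")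
    case True
    then have "\<bar>u + h\<bar> \<le> (1 + \<epsilon>) * \<bar>u\<bar>" by (simp add: algebra_simps)
    then have "\<bar>u + h\<bar> powr \<alpha> \<le> ((1 + \<epsilon>) * \<bar>u\<bar>) powr \<alpha>" using assms by (intro powr_mono2) auto
    also have "\<dots> = 3/2 * \<bar>u\<bar> powr \<alpha>" using e e1 by (simp add: powr_mult)
    finally show ?thesis by (simp add: add_increasing2)
  next
    case False
    then have "\<bar>u\<bar> \<le> \<bar>h\<bar> / \<epsilon>" using e by (simp add: field_simps)
    then have "\<bar>u + h\<bar> \<le> (1 + 1 / \<epsilon>) * \<bar>h\<bar>" by (simp add: algebra_simps)
    then have "\<bar>u + h\<bar> powr \<alpha> \<le> ((1 + 1 / \<epsilon>) * \<bar>h\<bar>) powr \<alpha>" using assms by (intro powr_mono2) auto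
    also have "\<dots> = (1 + 1 / \<epsilon>) powr \<alpha> * \<bar>h\<bar> powr \<alpha>" using e by (simp add: powr_mult)
    finally show ?thesis by (simp add: add_increasing)
  qed
qed

text \<open>The exponent \<open>2\<close> in the definition of \<^const>\<open>noise_laws\<close> and the factor \<open>2\<close> absorb any
  constant \<open>C\<close> once \<open>\<tau>\<close> is large.\<close>

lemma tail_bound_rescale:
  fixes \<alpha> b C :: real
  assumes "\<alpha> > 0" "b > 0"
  shows "\<exists>\<tau>0>0. \<forall>\<tau>\<ge>\<tau>0. \<forall>t\<ge>0. \<forall>p\<le>1. p \<le> C * exp (- b * t powr \<alpha>) \<longrightarrow> p \<le> 2 * exp (- 2 * (t / \<tau>) powr \<alpha>)"
proof -
  define L where "L = ln (max C 2)"
  have L0: "L > 0" by (simp add: L_def)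
  have LC: "C \<le> exp L" by (simp add: L_def)
  \<comment> \<open>The second entry makes the target at least 1 as long as T \<le> 2L/b. Beyond
    that, e^L is paid by half of the exponent, and the first entry fits the target into the other
    half.\<close>
  define u0 where "u0 = min (b / 4) (b * ln 2 / (4 * L))"
  have u0: "u0 > 0" "u0 \<le> b / 4" "u0 \<le> b * ln 2 / (4 * L)" using assms L0 by (auto simp: u0_def)
  define \<tau>0 where "\<tau>0 = u0 powr (- 1 / \<alpha>)"
  have "p \<le> 2 * exp (- 2 * (t / \<tau>) powr \<alpha>)"
    if tau: "\<tau> \<ge> \<tau>0" and t: "t \<ge> 0" and p: "p \<le> 1" "p \<le> C * exp (- b * t powr \<alpha>)" for \<tau> t p
  proof -
    have tp: "\<tau>0 > 0" using u0 by (simp add: \<tau>0_def)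
    define T where "T = t powr \<alpha>"
    have "\<tau>0 powr \<alpha> \<le> \<tau> powr \<alpha>" using tau tp assms by (intro powr_mono2) auto
    moreover have "\<tau>0 powr \<alpha> = 1 / u0" using assms u0 unfolding \<tau>0_def powr_powr by (simp add: powr_minus_divide)
    ultimately have "1 / \<tau> powr \<alpha> \<le> u0" using u0 tp tau by (simp add: field_simps)
    then have "T * (1 / \<tau> powr \<alpha>) \<le> T * u0" by (intro mult_left_mono) (auto simp: T_def)
    then have Tu: "(t / \<tau>) powr \<alpha> \<le> T * u0" using t tp tau by (simp add: T_def powr_divide)
    have T0: "T \<ge> 0" by (simp add: T_def)
    show ?thesis
    proof (cases "T \<le> 2 * L / b")
      case True
      then have "T * u0 \<le> (2 * L / b) * (b * ln 2 / (4 * L))" using u0 T0 L0 assms by (intro mult_mono) auto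
      also have "\<dots> = ln 2 / 2" using L0 assms by simp
      finally have "2 * (t / \<tau>) powr \<alpha> \<le> ln 2" using Tu by linarith
      then have "exp (- ln 2) \<le> exp (- 2 * (t / \<tau>) powr \<alpha>)" by simp
      then show ?thesis using p by (simp add: exp_minus)
    next
      case False
      then have "L \<le> b * T / 2" using assms by (simp add: field_simps)
      have "C * exp (- b * T) \<le> exp L * exp (- b * T)" using LC by (intro mult_right_mono) auto
      also have "\<dots> = exp (L - b * T)" by (simp add: exp_diff exp_minus divide_inverse)
      also have "\<dots> \<le> exp (- 2 * (t / \<tau>) powr \<alpha>)"
      proof -
        have "2 * (T * u0) \<le> 2 * (T * (b / 4))" using u0 T0 by (intro mult_left_mono) auto
        then show ?thesis using Tu \<open>L \<le> b * T / 2\<close> by (simp add: mult.commute)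
      qed
      also have "\<dots> \<le> 2 * exp (- 2 * (t / \<tau>) powr \<alpha>)" by simp
      finally show ?thesis using p by (simp add: T_def)
    qed
  qed
  moreover have "\<tau>0 > 0" using u0 by (simp add: \<tau>0_def)
  ultimately show ?thesis by blast
qed

lemma integral_stretched_exp_pos:
  fixes \<alpha> b :: real
  assumes "\<alpha> > 0" "b > 0" "even n"
  shows "(\<integral>x. (x::real) ^ n * exp (- b * \<bar>x\<bar> powr \<alpha>) \<partial>lborel) > 0"
proof -
  let ?f = "\<lambda>x::real. x ^ n * exp (- b * \<bar>x\<bar> powr \<alpha>)"
  have int: "integrable lborel ?f" using assms by (intro integrable_stretched_exp)
  have nn: "?f x \<ge> 0" for x using assms by (simp add: zero_le_even_power)
  have "integral\<^sup>L lborel ?f \<noteq> 0"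
  proof
    assume "integral\<^sup>L lborel ?f = 0"
    then have "AE x in lborel. ?f x = 0" using integral_nonneg_eq_0_iff_AE[OF int] nn by simp
    then have "AE x in (lborel :: real measure). False"
      using AE_lborel_singleton[of "0::real"] by eventually_elim auto
    then show False by (simp add: eventually_False ae_filter_eq_bot_iff)
  qed
  moreover have "integral\<^sup>L lborel ?f \<ge> 0" using nn by (intro integral_nonneg_AE) auto
  ultimately show ?thesis by simp
qed

text \<open>What the lower bound needs of the noise. \<open>r h\<close> is the likelihood ratio of
  the law shifted by h with respect to P, and \<open>chi\<close> bounds its second moment, that is,
  one plus the chi-square divergence.\<close>

locale shiftable_noise =
  fixes P :: "real measure" and r :: "real \<Rightarrow> real \<Rightarrow> ennreal" and \<alpha> C K :: real
  assumes prob: "prob_space P" and sets_P: "sets P = sets borel"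
    and r_meas: "\<And>h. r h \<in> borel_measurable borel"
    and shift: "\<And>h F. F \<in> borel_measurable borel \<Longrightarrow> (\<integral>\<^sup>+x. F x * r h x \<partial>P) = (\<integral>\<^sup>+x. F (x + h) \<partial>P)"
    and chi: "\<And>h. (\<integral>\<^sup>+x. (r h x)\<^sup>2 \<partial>P) \<le> ennreal (C * exp (K * \<bar>h\<bar> powr \<alpha>))"
    and C_ge_1: "C \<ge> 1" and K_pos: "K > 0"

lemma shiftable_noise_exists:
  fixes \<alpha> :: real
  assumes \<alpha>: "\<alpha> > 0"
  shows "\<exists>P r C K \<tau>0. shiftable_noise P r \<alpha> C K \<and> \<tau>0 > 0 \<and> (\<forall>\<tau>\<ge>\<tau>0. P \<in> noise_laws \<alpha> \<tau>)"
proof -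
  define Z where "Z = (\<integral>x. (x::real) ^ 0 * exp (- 1 * \<bar>x\<bar> powr \<alpha>) \<partial>lborel)"
  define M2 where "M2 = (\<integral>x. (x::real) ^ 2 * exp (- 1 * \<bar>x\<bar> powr \<alpha>) \<partial>lborel)"
  have Z: "Z > 0" and M2: "M2 > 0" unfolding Z_def M2_def using \<alpha> by (intro integral_stretched_exp_pos; simp)+
  \<comment> \<open>The law with density proportional to exp(-|x|^\<alpha>) has variance M2/Z = k^2.
    Dividing the variable by k gives unit variance and the density (k/Z) exp(-|k x|^\<alpha>),
    whence b and c.\<close>
  define k where "k = sqrt (M2 / Z)"
  have k: "k > 0" "k\<^sup>2 = M2 / Z" using Z M2 by (auto simp: k_def)
  define b where "b = k powr \<alpha>"
  have b: "b > 0" using k by (simp add: b_def)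
  define c where "c = k / Z"
  have c: "c > 0" using k Z by (simp add: c_def)
  define g where "g x = c * exp (- b * \<bar>x\<bar> powr \<alpha>)" for x :: real
  have g_meas[measurable]: "g \<in> borel_measurable borel" unfolding g_def by measurable
  have g0: "g x > 0" for x using c by (simp add: g_def)
  have bk: "b * \<bar>x\<bar> powr \<alpha> = \<bar>k * x\<bar> powr \<alpha>" for x using k by (simp add: b_def abs_mult powr_mult)
  have moment: "has_bochner_integral lborel (\<lambda>x. x ^ n * exp (- b * \<bar>x\<bar> powr \<alpha>))
      ((\<integral>x. (x::real) ^ n * exp (- 1 * \<bar>x\<bar> powr \<alpha>) \<partial>lborel) / k ^ (n + 1))" for n
  proof -
    have "has_bochner_integral lborel (\<lambda>x::real. x ^ n * exp (- 1 * \<bar>x\<bar> powr \<alpha>)) (\<integral>x. (x::real) ^ n * exp (- 1 * \<bar>x\<bar> powr \<alpha>) \<partial>lborel)"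
      using \<alpha> by (intro has_bochner_integral_integrable integrable_stretched_exp) auto
    then have "has_bochner_integral lborel (\<lambda>x::real. (0 + k * x) ^ n * exp (- 1 * \<bar>0 + k * x\<bar> powr \<alpha>)) ((\<integral>x. (x::real) ^ n * exp (- 1 * \<bar>x\<bar> powr \<alpha>) \<partial>lborel) /\<^sub>R \<bar>k\<bar>)"
      using k by (subst (asm) lborel_has_bochner_integral_real_affine_iff[of k _ _ 0]) auto
    then have "has_bochner_integral lborel (\<lambda>x::real. inverse (k ^ n) * ((0 + k * x) ^ n * exp (- 1 * \<bar>0 + k * x\<bar> powr \<alpha>))) (inverse (k ^ n) * ((\<integral>x. (x::real) ^ n * exp (- 1 * \<bar>x\<bar> powr \<alpha>) \<partial>lborel) /\<^sub>R \<bar>k\<bar>))"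
      by (rule has_bochner_integral_mult_right)
    moreover have "inverse (k ^ n) * ((0 + k * x) ^ n * exp (- 1 * \<bar>0 + k * x\<bar> powr \<alpha>)) = x ^ n * exp (- b * \<bar>x\<bar> powr \<alpha>)" for x
      using k bk[of x] by (simp add: power_mult_distrib field_simps)
    moreover have "inverse (k ^ n) * ((\<integral>x. (x::real) ^ n * exp (- 1 * \<bar>x\<bar> powr \<alpha>) \<partial>lborel) /\<^sub>R \<bar>k\<bar>)
        = (\<integral>x. (x::real) ^ n * exp (- 1 * \<bar>x\<bar> powr \<alpha>) \<partial>lborel) / k ^ (n + 1)"
      using k by (simp add: field_simps)
    ultimately show ?thesis by simp
  qed
  define P where "P = density lborel (\<lambda>x. ennreal (g x))"
  have sets_P[simp, measurable_cong]: "sets P = sets borel" by (simp add: P_def)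
  have space_P[simp]: "space P = UNIV" by (simp add: P_def)
  have nn_P: "(\<integral>\<^sup>+x. F x \<partial>P) = (\<integral>\<^sup>+x. ennreal (g x) * F x \<partial>lborel)" if "F \<in> borel_measurable borel" for F
    unfolding P_def using that by (intro nn_integral_density) auto
  have hb0: "has_bochner_integral lborel g 1"
    using has_bochner_integral_mult_right[OF moment[of 0], of c] k Z c
    by (simp add: g_def[abs_def] c_def Z_def[symmetric, simplified] del: has_bochner_integral_mult_right)
  have prob: "prob_space P"
  proof
    have "emeasure P (space P) = (\<integral>\<^sup>+x. ennreal (g x) \<partial>lborel)" by (simp add: P_def emeasure_density)
    also have "\<dots> = 1" using hb0 g0
      by (subst nn_integral_eq_integral) (auto simp: has_bochner_integral_iff less_imp_le)
    finally show "emeasure P (space P) = 1" .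
  qed
  interpret prob_space P by (rule prob)
  have rd: "real_distribution P" by unfold_locales simp
  have sym: "distr P borel uminus = P"
  proof (rule measure_eqI)
    fix A assume "A \<in> sets (distr P borel uminus)"
    then have A[measurable]: "A \<in> sets borel" by simp
    have A'[measurable]: "uminus -` A \<in> sets (borel::real measure)"
      using measurable_sets[OF borel_measurable_uminus[OF measurable_ident], of A] A by (simp add: id_def)
    have "emeasure (distr P borel uminus) A = emeasure P (uminus -` A)" by (subst emeasure_distr) auto
    also have "\<dots> = (\<integral>\<^sup>+x. ennreal (g x) * indicator (uminus -` A) x \<partial>lborel)"
      unfolding P_def by (subst emeasure_density) auto
    also have "\<dots> = (\<integral>\<^sup>+x. ennreal (g (-x)) * indicator A (- x) \<partial>lborel)"
      by (intro nn_integral_cong) (auto simp: g_def indicator_def)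
    also have "\<dots> = (\<integral>\<^sup>+x. ennreal (g x) * indicator A x \<partial>lborel)"
      using nn_integral_real_affine[of "\<lambda>x. ennreal (g x) * indicator A x" "-1" 0] by simp
    also have "\<dots> = emeasure P A" unfolding P_def by (subst emeasure_density) auto
    finally show "emeasure (distr P borel uminus) A = emeasure P A" .
  qed simp
  have var: "has_bochner_integral P (\<lambda>x. x\<^sup>2) 1"
    unfolding P_def
  proof (rule has_bochner_integral_density)
    have "k ^ 3 = k * (M2 / Z)" using k by (simp add: power3_eq_cube power2_eq_square)
    then have 1: "c * (M2 / k ^ (2 + 1)) = 1" using k(1) Z M2 by (simp add: c_def)
    have "has_bochner_integral lborel (\<lambda>x. c * (x\<^sup>2 * exp (- b * \<bar>x\<bar> powr \<alpha>))) (c * (M2 / k ^ (2 + 1)))"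
      unfolding M2_def by (rule has_bochner_integral_mult_right[OF moment])
    then show "has_bochner_integral lborel (\<lambda>x. g x *\<^sub>R x\<^sup>2) 1"
      unfolding 1 by (simp add: g_def mult_ac)
  qed (auto simp: less_imp_le[OF g0])
  define D where "D = c * (\<integral>x. (x::real) ^ 0 * exp (- (b/2) * \<bar>x\<bar> powr \<alpha>) \<partial>lborel)"
  have D: "(\<integral>\<^sup>+x. ennreal (c * exp (- (b/2) * \<bar>x\<bar> powr \<alpha>)) \<partial>lborel) = ennreal D"
    using integrable_stretched_exp[OF \<alpha>, of "b/2" 0] b c unfolding D_def
    by (subst nn_integral_eq_integral) auto
  have D0: "D \<ge> 0" using c unfolding D_def by (intro mult_nonneg_nonneg integral_nonneg_AE) auto
  \<comment> \<open>Half of the exponent pays for the tail, and the other half keeps the remaining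
    integral D finite.\<close>
  have tail: "measure P {x. t \<le> \<bar>x\<bar>} \<le> D * exp (- (b/2) * t powr \<alpha>)" if "t \<ge> 0" for t
  proof -
    have "emeasure P {x. t \<le> \<bar>x\<bar>} = (\<integral>\<^sup>+x. ennreal (g x) * indicator {x. t \<le> \<bar>x\<bar>} x \<partial>lborel)"
      unfolding P_def by (subst emeasure_density) auto
    also have "\<dots> \<le> (\<integral>\<^sup>+x. ennreal (exp (- (b/2) * t powr \<alpha>)) * ennreal (c * exp (- (b/2) * \<bar>x\<bar> powr \<alpha>)) \<partial>lborel)"
    proof (intro nn_integral_mono)
      fix x :: real
      show "ennreal (g x) * indicator {x. t \<le> \<bar>x\<bar>} x \<le> ennreal (exp (- (b/2) * t powr \<alpha>)) * ennreal (c * exp (- (b/2) * \<bar>x\<bar> powr \<alpha>))"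
      proof (cases "t \<le> \<bar>x\<bar>")
        case True
        have "t powr \<alpha> \<le> \<bar>x\<bar> powr \<alpha>" using True that \<alpha> by (intro powr_mono2) auto
        then have "b * t powr \<alpha> \<le> b * \<bar>x\<bar> powr \<alpha>" using b by simp
        then have "g x \<le> c * exp (- (b/2) * t powr \<alpha> + - (b/2) * \<bar>x\<bar> powr \<alpha>)"
          unfolding g_def using c by (intro mult_left_mono) auto
        also have "\<dots> = exp (- (b/2) * t powr \<alpha>) * (c * exp (- (b/2) * \<bar>x\<bar> powr \<alpha>))"
          unfolding exp_add by (rule mult.left_commute)
        finally have "g x \<le> exp (- (b/2) * t powr \<alpha>) * (c * exp (- (b/2) * \<bar>x\<bar> powr \<alpha>))" .
        then have "ennreal (g x) \<le> ennreal (exp (- (b/2) * t powr \<alpha>) * (c * exp (- (b/2) * \<bar>x\<bar> powr \<alpha>)))"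
          by (rule ennreal_leI)
        then show ?thesis using True c by (simp add: ennreal_mult)
      qed simp
    qed
    also have "\<dots> = ennreal (exp (- (b/2) * t powr \<alpha>)) * ennreal D"
      unfolding D[symmetric] by (rule nn_integral_cmult) measurable
    also have "\<dots> = ennreal (D * exp (- (b/2) * t powr \<alpha>))" using D0 by (simp add: ennreal_mult mult.commute)
    finally show ?thesis using D0 by (simp add: measure_def enn2real_leI)
  qed
  obtain \<tau>0 where \<tau>0: "\<tau>0 > 0" "\<And>\<tau> t p. \<tau> \<ge> \<tau>0 \<Longrightarrow> t \<ge> 0 \<Longrightarrow> p \<le> 1 \<Longrightarrow> p \<le> D * exp (- (b/2) * t powr \<alpha>) \<Longrightarrow> p \<le> 2 * exp (- 2 * (t / \<tau>) powr \<alpha>)"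
    using tail_bound_rescale[OF \<alpha>, of "b/2" D] b by (auto simp: field_simps)
  have in_class: "P \<in> noise_laws \<alpha> \<tau>" if "\<tau> \<ge> \<tau>0" for \<tau>
    unfolding noise_laws_def using rd sym var \<tau>0(2)[OF that] tail by auto
  define r where "r h x = ennreal (g (x - h) / g x)" for h x
  have r_meas: "r h \<in> borel_measurable borel" for h unfolding r_def by measurable
  have shift: "(\<integral>\<^sup>+x. F x * r h x \<partial>P) = (\<integral>\<^sup>+x. F (x + h) \<partial>P)" if F[measurable]: "F \<in> borel_measurable borel" for F h
  proof -
    note r_meas[measurable]
    have "(\<integral>\<^sup>+x. F x * r h x \<partial>P) = (\<integral>\<^sup>+x. ennreal (g x) * (F x * r h x) \<partial>lborel)" by (intro nn_P) measurable
    also have "\<dots> = (\<integral>\<^sup>+x. ennreal (g (x - h)) * F x \<partial>lborel)"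
    proof (intro nn_integral_cong)
      fix x
      have "ennreal (g x) * r h x = ennreal (g (x - h))"
        unfolding r_def using g0[of x] g0[of "x-h"] by (subst ennreal_mult[symmetric]) auto
      then show "ennreal (g x) * (F x * r h x) = ennreal (g (x - h)) * F x"
        by (simp add: mult.left_commute[of _ "F x"] mult.commute[of _ "F x"])
    qed
    also have "\<dots> = (\<integral>\<^sup>+x. ennreal (g x) * F (x + h) \<partial>lborel)"
      using nn_integral_real_affine[of "\<lambda>x. ennreal (g (x - h)) * F x" 1 h] by (simp add: add.commute)
    also have "\<dots> = (\<integral>\<^sup>+x. F (x + h) \<partial>P)" by (intro nn_P[symmetric]) measurable
    finally show ?thesis .
  qed
  define \<epsilon> where "\<epsilon> = (3/2::real) powr (1 / \<alpha>) - 1"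
  define K where "K = max 1 (b * (1 + 1 / \<epsilon>) powr \<alpha>)"
  \<comment> \<open>Apply \<open>shift\<close> to \<open>r h\<close> itself: the second moment
    becomes the integral of g(x)^2 / g(x + h). By \<open>powr_shift_le\<close> its exponent is at
    most K |h|^\<alpha> - (b/2) |x|^\<alpha>.\<close>
  have chi: "(\<integral>\<^sup>+x. (r h x)\<^sup>2 \<partial>P) \<le> ennreal (max 1 D * exp (K * \<bar>h\<bar> powr \<alpha>))" for h
  proof -
    note r_meas[measurable]
    have "(\<integral>\<^sup>+x. (r h x)\<^sup>2 \<partial>P) = (\<integral>\<^sup>+x. r h (x + h) \<partial>P)"
      using shift[of "r h" h] by (simp add: power2_eq_square)
    also have "\<dots> = (\<integral>\<^sup>+x. ennreal (g x) * r h (x + h) \<partial>lborel)" by (intro nn_P) measurable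
    also have "\<dots> \<le> (\<integral>\<^sup>+x. ennreal (exp (K * \<bar>h\<bar> powr \<alpha>)) * ennreal (c * exp (- (b/2) * \<bar>x\<bar> powr \<alpha>)) \<partial>lborel)"
    proof (intro nn_integral_mono)
      fix x :: real
      have "\<bar>x + h\<bar> powr \<alpha> \<le> 3/2 * \<bar>x\<bar> powr \<alpha> + (1 + 1 / \<epsilon>) powr \<alpha> * \<bar>h\<bar> powr \<alpha>"
        unfolding \<epsilon>_def by (rule powr_shift_le[OF \<alpha>])
      then have "b * \<bar>x + h\<bar> powr \<alpha> \<le> b * (3/2 * \<bar>x\<bar> powr \<alpha> + (1 + 1 / \<epsilon>) powr \<alpha> * \<bar>h\<bar> powr \<alpha>)"
        using b by (intro mult_left_mono) auto
      also have "\<dots> = 3/2 * b * \<bar>x\<bar> powr \<alpha> + (b * (1 + 1 / \<epsilon>) powr \<alpha>) * \<bar>h\<bar> powr \<alpha>" by (simp add: algebra_simps)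
      also have "\<dots> \<le> 3/2 * b * \<bar>x\<bar> powr \<alpha> + K * \<bar>h\<bar> powr \<alpha>"
        unfolding K_def by (intro add_left_mono mult_right_mono) auto
      finally have *: "- 2 * b * \<bar>x\<bar> powr \<alpha> + b * \<bar>x + h\<bar> powr \<alpha> \<le> K * \<bar>h\<bar> powr \<alpha> + - (b/2) * \<bar>x\<bar> powr \<alpha>" by simp
      have "g x * (g x / g (x + h)) = c * exp (- 2 * b * \<bar>x\<bar> powr \<alpha> + b * \<bar>x + h\<bar> powr \<alpha>)"
      proof -
        have "exp (- 2 * b * \<bar>x\<bar> powr \<alpha> + b * \<bar>x + h\<bar> powr \<alpha>)
            = exp (- b * \<bar>x\<bar> powr \<alpha> + - b * \<bar>x\<bar> powr \<alpha> - - b * \<bar>x + h\<bar> powr \<alpha>)"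
          by (simp add: algebra_simps)
        then show ?thesis using c unfolding g_def exp_diff exp_add by simp
      qed
      also have "\<dots> \<le> c * exp (K * \<bar>h\<bar> powr \<alpha> + - (b/2) * \<bar>x\<bar> powr \<alpha>)"
        using * c by (intro mult_left_mono) auto
      also have "\<dots> = exp (K * \<bar>h\<bar> powr \<alpha>) * (c * exp (- (b/2) * \<bar>x\<bar> powr \<alpha>))" unfolding exp_add by (rule mult.left_commute)
      finally have "g x * (g x / g (x + h)) \<le> exp (K * \<bar>h\<bar> powr \<alpha>) * (c * exp (- (b/2) * \<bar>x\<bar> powr \<alpha>))" .
      moreover have "ennreal (g x) * r h (x + h) = ennreal (g x * (g x / g (x + h)))"
        unfolding r_def using g0[of x] g0[of "x + h"] by (subst ennreal_mult[symmetric]) auto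
      moreover have "ennreal (exp (K * \<bar>h\<bar> powr \<alpha>)) * ennreal (c * exp (- (b/2) * \<bar>x\<bar> powr \<alpha>)) = ennreal (exp (K * \<bar>h\<bar> powr \<alpha>) * (c * exp (- (b/2) * \<bar>x\<bar> powr \<alpha>)))"
        using c by (subst ennreal_mult[symmetric]) auto
      ultimately show "ennreal (g x) * r h (x + h) \<le> ennreal (exp (K * \<bar>h\<bar> powr \<alpha>)) * ennreal (c * exp (- (b/2) * \<bar>x\<bar> powr \<alpha>))"
        by (simp add: ennreal_leI)
    qed
    also have "\<dots> = ennreal (exp (K * \<bar>h\<bar> powr \<alpha>)) * ennreal D"
      unfolding D[symmetric] by (rule nn_integral_cmult) measurable
    also have "\<dots> \<le> ennreal (exp (K * \<bar>h\<bar> powr \<alpha>)) * ennreal (max 1 D)" by (intro mult_left_mono ennreal_leI) auto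
    also have "\<dots> = ennreal (max 1 D * exp (K * \<bar>h\<bar> powr \<alpha>))" by (subst ennreal_mult[symmetric]) (auto simp: mult.commute)
    finally show ?thesis .
  qed
  have "shiftable_noise P r \<alpha> (max 1 D) K"
  proof (rule shiftable_noise.intro)
    show "K > 0" by (simp add: K_def)
  qed (fact prob sets_P r_meas shift chi max.cobounded1)+
  then show ?thesis using \<tau>0(1) in_class by blast
qed

section \<open>Lower bounds from sparse priors\<close>

text \<open>Probability that independent Bernoulli variables with parameters \<open>p j\<close>
  equal 1 exactly on S.\<close>

definition subset_prob :: "'a set \<Rightarrow> ('a \<Rightarrow> real) \<Rightarrow> 'a set \<Rightarrow> real" where
  "subset_prob J p S = (\<Prod>j\<in>S. p j) * (\<Prod>j\<in>J - S. 1 - p j)"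

lemma subset_prob_nonneg: "(\<And>j. j \<in> J \<Longrightarrow> 0 \<le> p j \<and> p j \<le> 1) \<Longrightarrow> S \<subseteq> J \<Longrightarrow> subset_prob J p S \<ge> 0"
  unfolding subset_prob_def by (intro mult_nonneg_nonneg prod_nonneg) auto

text \<open>Expand the product of \<open>p j\<close> + g_j with g_j = 0 on K and 1 -
  \<open>p j\<close> elsewhere: only the sets S containing K survive.\<close>

lemma sum_subset_prob_superset:
  assumes "finite J" "K \<subseteq> J"
  shows "(\<Sum>S | S \<subseteq> J \<and> K \<subseteq> S. subset_prob J p S) = (\<Prod>j\<in>K. p j)"
proof -
  let ?g = "\<lambda>j. if j \<in> K then 0 else 1 - p j"
  have fK: "finite K" using assms finite_subset by auto
  have "(\<Prod>j\<in>J. p j + ?g j) = (\<Sum>S\<in>Pow J. (\<Prod>j\<in>S. p j) * (\<Prod>j\<in>J - S. ?g j))"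
    by (rule prod_add[OF assms(1)])
  also have "\<dots> = (\<Sum>S\<in>Pow J. if K \<subseteq> S then subset_prob J p S else 0)"
  proof (intro sum.cong refl)
    fix S assume "S \<in> Pow J"
    show "(\<Prod>j\<in>S. p j) * (\<Prod>j\<in>J - S. ?g j) = (if K \<subseteq> S then subset_prob J p S else 0)"
    proof (cases "K \<subseteq> S")
      case True
      then have "(\<Prod>j\<in>J - S. ?g j) = (\<Prod>j\<in>J - S. 1 - p j)" by (intro prod.cong) auto
      then show ?thesis using True by (simp add: subset_prob_def)
    next
      case False
      then have "\<exists>j\<in>J - S. ?g j = 0" using assms by auto
      then have "(\<Prod>j\<in>J - S. ?g j) = 0" using assms by (intro prod_zero) auto
      then show ?thesis using False by simp
    qed
  qed
  also have "\<dots> = (\<Sum>S | S \<subseteq> J \<and> K \<subseteq> S. subset_prob J p S)"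
    using assms by (simp add: sum.inter_filter[symmetric] Pow_def)
  finally have "(\<Sum>S | S \<subseteq> J \<and> K \<subseteq> S. subset_prob J p S) = (\<Prod>j\<in>J. p j + ?g j)" by simp
  also have "\<dots> = (\<Prod>j\<in>J. if j \<in> K then p j else 1)" by (intro prod.cong) auto
  also have "\<dots> = (\<Prod>j\<in>K. p j)" using assms by (simp add: prod.If_cases Int_absorb1)
  finally show ?thesis .
qed

text \<open>Markov's inequality given j in S: the other members of S number at most s/2 on average,
  so they reach s with probability at most 1/2. Truncation to at most s elements thus loses at most
  half of the mass of each coordinate.\<close>

lemma subset_prob_truncated:
  assumes J: "finite J" and p: "\<And>j. j \<in> J \<Longrightarrow> 0 \<le> p j \<and> p j \<le> 1"
    and s: "s \<ge> 1" "(\<Sum>j\<in>J. p j) \<le> real s / 2" and j: "j \<in> J"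
  shows "p j / 2 \<le> (\<Sum>S | S \<subseteq> J \<and> card S \<le> s \<and> j \<in> S. subset_prob J p S)"
proof -
  let ?q = "subset_prob J p"
  let ?all = "{S. S \<subseteq> J \<and> {j} \<subseteq> S}" and ?big = "{S. S \<subseteq> J \<and> \<not> card S \<le> s \<and> j \<in> S}"
  have fin: "finite {S. S \<subseteq> J \<and> Q S}" for Q using J by (auto intro: finite_subset[of _ "Pow J"])
  have q0: "?q S \<ge> 0" if "S \<subseteq> J" for S using subset_prob_nonneg[of J p S] p that by blast
  have all: "(\<Sum>S\<in>?all. ?q S) = p j" using sum_subset_prob_superset[OF J, of "{j}" p] j by simp
  have split: "(\<Sum>S\<in>?all. ?q S) = (\<Sum>S | S \<subseteq> J \<and> card S \<le> s \<and> j \<in> S. ?q S) + (\<Sum>S\<in>?big. ?q S)"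
    by (subst sum.union_disjoint[symmetric]) (auto intro!: sum.cong fin)
  have "real s * (\<Sum>S\<in>?big. ?q S) \<le> (\<Sum>S\<in>?big. ?q S * real (card (S - {j})))"
    unfolding sum_distrib_left
  proof (intro sum_mono)
    fix S assume S: "S \<in> ?big"
    then have "card (S - {j}) = card S - 1" using J finite_subset by (auto simp: card_Diff_singleton)
    then have "real s \<le> real (card (S - {j}))" using S by auto
    then have "?q S * real s \<le> ?q S * real (card (S - {j}))" using q0[of S] S by (intro mult_left_mono) auto
    then show "real s * ?q S \<le> ?q S * real (card (S - {j}))" by (simp only: mult.commute)
  qed
  also have "\<dots> \<le> (\<Sum>S\<in>?all. ?q S * real (card (S - {j})))"
    using fin q0 by (intro sum_mono2) auto
  also have "\<dots> = (\<Sum>S\<in>?all. \<Sum>i\<in>J - {j}. if i \<in> S then ?q S else 0)"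
  proof (intro sum.cong refl)
    fix S assume S: "S \<in> ?all"
    then have "S - {j} = {i \<in> J - {j}. i \<in> S}" by auto
    then have "real (card (S - {j})) = (\<Sum>i\<in>J - {j}. if i \<in> S then 1 else 0)"
      using J by (simp add: sum.inter_filter[symmetric])
    then show "?q S * real (card (S - {j})) = (\<Sum>i\<in>J - {j}. if i \<in> S then ?q S else 0)"
      by (simp add: sum_distrib_left if_distrib cong: if_cong)
  qed
  also have "\<dots> = (\<Sum>i\<in>J - {j}. \<Sum>S\<in>?all. if i \<in> S then ?q S else 0)" by (rule sum.swap)
  also have "\<dots> = (\<Sum>i\<in>J - {j}. p i * p j)"
  proof (intro sum.cong refl)
    fix i assume i: "i \<in> J - {j}"
    have "(\<Sum>S\<in>?all. if i \<in> S then ?q S else 0) = (\<Sum>S | S \<subseteq> J \<and> {i, j} \<subseteq> S. ?q S)"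
      using fin[of "\<lambda>S. {j} \<subseteq> S"] by (subst sum.inter_filter[symmetric]) (auto intro!: sum.cong)
    also have "\<dots> = p i * p j" using sum_subset_prob_superset[OF J, of "{i, j}" p] i j by auto
    finally show "(\<Sum>S\<in>?all. if i \<in> S then ?q S else 0) = p i * p j" .
  qed
  also have "\<dots> \<le> (\<Sum>i\<in>J. p i * p j)" using J p j by (intro sum_mono2) auto
  also have "\<dots> \<le> (real s / 2) * p j"
    unfolding sum_distrib_right[symmetric] using s p[OF j] by (intro mult_right_mono) auto
  finally have "real s * (\<Sum>S\<in>?big. ?q S) \<le> real s * (p j / 2)" by simp
  then have "(\<Sum>S\<in>?big. ?q S) \<le> p j / 2" using s by simp
  then show ?thesis using all split by linarith
qed

lemma ennreal_le_if_square_le: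
  fixes x :: ennreal
  assumes "x\<^sup>2 \<le> ennreal (a\<^sup>2)" "a \<ge> 0"
  shows "x \<le> ennreal a"
proof (cases x)
  case (real r)
  then have "r\<^sup>2 \<le> a\<^sup>2" using assms by (simp add: ennreal_power)
  then show ?thesis using real assms by (auto intro!: ennreal_leI power2_le_imp_le)
next
  case top
  then show ?thesis using assms by (simp add: power2_eq_square ennreal_mult_top top_unique)
qed

lemma (in prob_space) nn_integral_le_if_square_le:
  assumes [measurable]: "f \<in> borel_measurable M" and "(\<integral>\<^sup>+x. (f x)\<^sup>2 \<partial>M) \<le> ennreal (a\<^sup>2)" "a \<ge> 0"
  shows "(\<integral>\<^sup>+x. f x \<partial>M) \<le> ennreal a"
proof (rule ennreal_le_if_square_le)
  have "(\<integral>\<^sup>+x. f x * 1 \<partial>M)\<^sup>2 \<le> (\<integral>\<^sup>+x. (f x)\<^sup>2 \<partial>M) * (\<integral>\<^sup>+x. 1\<^sup>2 \<partial>M)"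
    by (rule Cauchy_Schwarz_nn_integral) auto
  then show "(\<integral>\<^sup>+x. f x \<partial>M)\<^sup>2 \<le> ennreal (a\<^sup>2)" using assms by (simp add: emeasure_space_1)
qed fact

section \<open>Likelihood ratios of shifted product noise and the Bayes argument\<close>

context shiftable_noise
begin

sublocale prod: product_prob_space "\<lambda>_::nat. P" UNIV
  by (rule product_prob_spaceI) (rule prob)

lemma space_P: "space P = UNIV" using sets_eq_imp_space_eq[OF sets_P] by simp

lemma r_meas_P[measurable]: "r h \<in> borel_measurable P"
  using r_meas by (simp add: measurable_cong_sets[OF sets_P refl])

lemma r_component: "j \<in> I \<Longrightarrow> (\<lambda>\<xi>. r c (\<xi> j)) \<in> borel_measurable (Pi\<^sub>M I (\<lambda>_. P))"
  by (rule measurable_compose[OF measurable_component_singleton[of j I "\<lambda>_. P"] r_meas_P])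

lemma integral_r: "(\<integral>\<^sup>+x. r h x \<partial>P) = 1"
  using shift[of "\<lambda>_. 1" h] prob by (simp add: prob_space.emeasure_space_1)

lemma sets_PiM_P: "sets (Pi\<^sub>M I (\<lambda>_::nat. P)) = sets (Pi\<^sub>M I (\<lambda>_. borel))"
  by (intro sets_PiM_cong refl sets_P)

text \<open>Both sides are the product of the shifted marginals, as a check on rectangles shows.
  Coordinates outside S are shifted by 0 and contribute no factor.\<close>

lemma PiM_shift_eq_density:
  fixes I S :: "nat set" and h :: "nat \<Rightarrow> real"
  assumes I: "finite I" and S: "S \<subseteq> I"
  defines "M \<equiv> Pi\<^sub>M I (\<lambda>_. P)"
  defines "h' \<equiv> \<lambda>j. if j \<in> S then h j else 0"
  shows "distr M (Pi\<^sub>M I (\<lambda>_. borel)) (\<lambda>\<xi>. \<lambda>j\<in>I. \<xi> j + h' j) = density M (\<lambda>\<xi>. \<Prod>j\<in>S. r (h j) (\<xi> j))"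
proof -
  have [measurable_cong]: "sets P = sets borel" by (rule sets_P)
  define N where "N = (\<lambda>j. distr P borel (\<lambda>x. x + h' j))"
  have N_prob: "prob_space (N j)" for j unfolding N_def by (rule prob_space.prob_space_distr[OF prob]) measurable
  interpret N: product_prob_space N UNIV by (rule product_prob_spaceI) (rule N_prob)
  have N_sets: "sets (N j) = sets borel" for j by (simp add: N_def)
  have N_emeasure: "emeasure (N j) A = emeasure P ((\<lambda>x. x + h' j) -` A)" if "A \<in> sets borel" for j A
    using that by (simp add: N_def emeasure_distr space_P)
  have fS: "finite S" using I S finite_subset by auto
  have map[measurable]: "(\<lambda>\<xi>. \<lambda>j\<in>I. \<xi> j + h' j) \<in> measurable M (Pi\<^sub>M I (\<lambda>_. borel))"
    unfolding M_def by (intro measurable_restrict) measurable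
  have 1: "distr M (Pi\<^sub>M I (\<lambda>_. borel)) (\<lambda>\<xi>. \<lambda>j\<in>I. \<xi> j + h' j) = Pi\<^sub>M I N"
  proof (rule N.PiM_eqI[OF I])
    show "sets (distr M (Pi\<^sub>M I (\<lambda>_. borel)) (\<lambda>\<xi>. \<lambda>j\<in>I. \<xi> j + h' j)) = sets (Pi\<^sub>M I N)"
      by (simp add: N_sets cong: sets_PiM_cong)
    fix A assume "\<And>i. i \<in> I \<Longrightarrow> A i \<in> sets (N i)"
    then have A: "A i \<in> sets borel" if "i \<in> I" for i using that N_sets by auto
    have A': "(\<lambda>x. x + h' i) -` A i \<in> sets P" if "i \<in> I" for i
      using measurable_sets[of "\<lambda>x. x + h' i" P borel, OF _ A[OF that]] by (simp add: space_P)
    have "emeasure (distr M (Pi\<^sub>M I (\<lambda>_. borel)) (\<lambda>\<xi>. \<lambda>j\<in>I. \<xi> j + h' j)) (Pi\<^sub>E I A)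
        = emeasure M ((\<lambda>\<xi>. \<lambda>j\<in>I. \<xi> j + h' j) -` (Pi\<^sub>E I A) \<inter> space M)"
      using A I by (intro emeasure_distr map sets_PiM_I_finite) auto
    also have "(\<lambda>\<xi>. \<lambda>j\<in>I. \<xi> j + h' j) -` (Pi\<^sub>E I A) \<inter> space M = Pi\<^sub>E I (\<lambda>i. (\<lambda>x. x + h' i) -` A i)"
      by (auto simp: M_def space_PiM space_P PiE_def Pi_def extensional_def)
    also have "emeasure M \<dots> = (\<Prod>i\<in>I. emeasure P ((\<lambda>x. x + h' i) -` A i))"
      unfolding M_def using A' I by (intro prod.emeasure_PiM) auto
    also have "\<dots> = (\<Prod>i\<in>I. emeasure (N i) (A i))" using A N_emeasure by (intro prod.cong) auto
    finally show "emeasure (distr M (Pi\<^sub>M I (\<lambda>_. borel)) (\<lambda>\<xi>. \<lambda>j\<in>I. \<xi> j + h' j)) (Pi\<^sub>E I A) = (\<Prod>i\<in>I. emeasure (N i) (A i))" .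
  qed
  have 2: "density M (\<lambda>\<xi>. \<Prod>j\<in>S. r (h j) (\<xi> j)) = Pi\<^sub>M I N"
  proof (rule N.PiM_eqI[OF I])
    show "sets (density M (\<lambda>\<xi>. \<Prod>j\<in>S. r (h j) (\<xi> j))) = sets (Pi\<^sub>M I N)"
      by (simp add: M_def sets_P N_sets cong: sets_PiM_cong)
    fix A assume "\<And>i. i \<in> I \<Longrightarrow> A i \<in> sets (N i)"
    then have A: "A i \<in> sets borel" if "i \<in> I" for i using that N_sets by auto
    let ?f = "\<lambda>j x. indicator (A j) x * (if j \<in> S then r (h j) x else 1)"
    have fm: "?f j \<in> borel_measurable P" if "j \<in> I" for j using A[OF that] by measurable
    have W: "(\<lambda>\<xi>. \<Prod>j\<in>S. r (h j) (\<xi> j)) \<in> borel_measurable M"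
      unfolding M_def using S by (intro borel_measurable_prod_ennreal) (auto intro!: r_component)
    have "emeasure (density M (\<lambda>\<xi>. \<Prod>j\<in>S. r (h j) (\<xi> j))) (Pi\<^sub>E I A)
       = (\<integral>\<^sup>+\<xi>. (\<Prod>j\<in>S. r (h j) (\<xi> j)) * indicator (Pi\<^sub>E I A) \<xi> \<partial>M)"
      using A I by (intro emeasure_density W) (auto simp: M_def sets_P intro!: sets_PiM_I_finite)
    also have "\<dots> = (\<integral>\<^sup>+\<xi>. (\<Prod>j\<in>I. ?f j (\<xi> j)) \<partial>M)"
    proof (intro nn_integral_cong)
      fix \<xi> assume \<xi>: "\<xi> \<in> space M"
      have "(\<Prod>j\<in>I. ?f j (\<xi> j)) = (\<Prod>j\<in>I. indicator (A j) (\<xi> j)) * (\<Prod>j\<in>I. if j \<in> S then r (h j) (\<xi> j) else 1)"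
        by (rule prod.distrib)
      also have "(\<Prod>j\<in>I. if j \<in> S then r (h j) (\<xi> j) else 1) = (\<Prod>j\<in>S. r (h j) (\<xi> j))"
        using I S by (simp add: prod.If_cases Int_absorb1)
      also have "(\<Prod>j\<in>I. indicator (A j) (\<xi> j)) = (indicator (Pi\<^sub>E I A) \<xi> :: ennreal)"
      proof (cases "\<xi> \<in> Pi\<^sub>E I A")
        case False
        then obtain j where "j \<in> I" "\<xi> j \<notin> A j" using \<xi> by (auto simp: M_def space_PiM PiE_def Pi_def)
        then have "(\<Prod>j\<in>I. indicator (A j) (\<xi> j)) = (0::ennreal)" using I by (intro prod_zero) (auto intro!: bexI[of _ j])
        then show ?thesis using False by simp
      qed (auto simp: PiE_def Pi_def intro!: prod.neutral)
      finally show "(\<Prod>j\<in>S. r (h j) (\<xi> j)) * indicator (Pi\<^sub>E I A) \<xi> = (\<Prod>j\<in>I. ?f j (\<xi> j))"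
        by (simp add: mult.commute)
    qed
    also have "\<dots> = (\<Prod>j\<in>I. \<integral>\<^sup>+x. ?f j x \<partial>P)" unfolding M_def using fm by (intro prod.product_nn_integral_prod I)
    also have "\<dots> = (\<Prod>j\<in>I. emeasure (N j) (A j))"
    proof (intro prod.cong refl)
      fix j assume j: "j \<in> I"
      have *: "(\<integral>\<^sup>+x. indicator (A j) (x + h' j) \<partial>P) = emeasure (N j) (A j)"
      proof -
        have "(\<integral>\<^sup>+x. indicator (A j) (x + h' j) \<partial>P) = (\<integral>\<^sup>+x. indicator ((\<lambda>x. x + h' j) -` A j) x \<partial>P)"
          by (intro nn_integral_cong) (auto simp: indicator_def)
        also have "\<dots> = emeasure P ((\<lambda>x. x + h' j) -` A j)"
          using measurable_sets[of "\<lambda>x. x + h' j" P borel, OF _ A[OF j]]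
          by (intro nn_integral_indicator) (simp add: space_P)
        finally show ?thesis using N_emeasure[OF A[OF j]] by simp
      qed
      show "(\<integral>\<^sup>+x. ?f j x \<partial>P) = emeasure (N j) (A j)"
      proof (cases "j \<in> S")
        case True
        then show ?thesis using shift[of "indicator (A j)" "h j"] A[OF j] * by (simp add: h'_def)
      next
        case False
        then show ?thesis using * by (simp add: h'_def)
      qed
    qed
    finally show "emeasure (density M (\<lambda>\<xi>. \<Prod>j\<in>S. r (h j) (\<xi> j))) (Pi\<^sub>E I A) = (\<Prod>j\<in>I. emeasure (N j) (A j))" .
  qed
  show ?thesis using 1 2 by simp
qed

lemma nn_integral_shift:
  fixes I S :: "nat set" and h :: "nat \<Rightarrow> real"
  assumes I: "finite I" and S: "S \<subseteq> I" and F[measurable]: "F \<in> borel_measurable (Pi\<^sub>M I (\<lambda>_. borel))"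
  shows "(\<integral>\<^sup>+\<xi>. F (\<lambda>j\<in>I. \<xi> j + (if j \<in> S then h j else 0)) \<partial>Pi\<^sub>M I (\<lambda>_. P))
     = (\<integral>\<^sup>+\<xi>. F \<xi> * (\<Prod>j\<in>S. r (h j) (\<xi> j)) \<partial>Pi\<^sub>M I (\<lambda>_. P))"
proof -
  have [measurable_cong]: "sets P = sets borel" by (rule sets_P)
  let ?M = "Pi\<^sub>M I (\<lambda>_. P)"
  have map: "(\<lambda>\<xi>. \<lambda>j\<in>I. \<xi> j + (if j \<in> S then h j else 0)) \<in> measurable ?M (Pi\<^sub>M I (\<lambda>_. borel))"
    by (intro measurable_restrict) measurable
  have W: "(\<lambda>\<xi>. \<Prod>j\<in>S. r (h j) (\<xi> j)) \<in> borel_measurable ?M"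
    using S by (intro borel_measurable_prod_ennreal) (auto intro!: r_component)
  have F': "F \<in> borel_measurable ?M" using F by (simp add: measurable_cong_sets[OF sets_PiM_P refl])
  have "(\<integral>\<^sup>+\<xi>. F (\<lambda>j\<in>I. \<xi> j + (if j \<in> S then h j else 0)) \<partial>?M)
     = (\<integral>\<^sup>+\<xi>. F \<xi> \<partial>distr ?M (Pi\<^sub>M I (\<lambda>_. borel)) (\<lambda>\<xi>. \<lambda>j\<in>I. \<xi> j + (if j \<in> S then h j else 0)))"
    using nn_integral_distr[OF map, of F] F by simp
  also have "\<dots> = (\<integral>\<^sup>+\<xi>. F \<xi> \<partial>density ?M (\<lambda>\<xi>. \<Prod>j\<in>S. r (h j) (\<xi> j)))"
    by (simp add: PiM_shift_eq_density[OF I S])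
  also have "\<dots> = (\<integral>\<^sup>+\<xi>. (\<Prod>j\<in>S. r (h j) (\<xi> j)) * F \<xi> \<partial>?M)" by (rule nn_integral_density[OF W F'])
  finally show ?thesis by (simp add: mult.commute)
qed

text \<open>The likelihood ratio has mean 1, so the terms other than the square of
  \<open>r h\<close> add up to 1 - p^2 \<le> 1.\<close>

lemma nn_integral_mixture_square:
  assumes p: "0 \<le> p" "p \<le> 1" and \<rho>: "(\<integral>\<^sup>+x. (r h x)\<^sup>2 \<partial>P) \<le> ennreal \<rho>" "\<rho> \<ge> 0"
  shows "(\<integral>\<^sup>+x. (ennreal (1 - p) + ennreal p * r h x)\<^sup>2 \<partial>P) \<le> ennreal (1 + p\<^sup>2 * \<rho>)"
proof -
  have "(\<integral>\<^sup>+x. (ennreal (1 - p) + ennreal p * r h x)\<^sup>2 \<partial>P)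
    = (\<integral>\<^sup>+x. ennreal ((1 - p)\<^sup>2) + ennreal (2 * (1 - p) * p) * r h x + ennreal (p\<^sup>2) * (r h x)\<^sup>2 \<partial>P)"
  proof (intro nn_integral_cong)
    fix x
    have "(ennreal (1 - p) + ennreal p * r h x)\<^sup>2
        = (ennreal (1 - p))\<^sup>2 + 2 * ennreal (1 - p) * ennreal p * r h x + (ennreal p)\<^sup>2 * (r h x)\<^sup>2"
      by (simp only: power2_sum power_mult_distrib mult.assoc add.assoc add.commute[of _ "2 * _"])
    moreover have "ennreal (2 * (1 - p) * p) = 2 * ennreal (1 - p) * ennreal p"
      using p ennreal_mult[of "2 * (1 - p)" p] ennreal_mult[of 2 "1 - p"] by simp
    ultimately show "(ennreal (1 - p) + ennreal p * r h x)\<^sup>2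
        = ennreal ((1 - p)\<^sup>2) + ennreal (2 * (1 - p) * p) * r h x + ennreal (p\<^sup>2) * (r h x)\<^sup>2"
      using p by (simp add: ennreal_power)
  qed
  also have "\<dots> = (\<integral>\<^sup>+x. ennreal ((1 - p)\<^sup>2) \<partial>P) + (\<integral>\<^sup>+x. ennreal (2 * (1 - p) * p) * r h x \<partial>P) + (\<integral>\<^sup>+x. ennreal (p\<^sup>2) * (r h x)\<^sup>2 \<partial>P)"
    by (simp add: nn_integral_add)
  also have "\<dots> = ennreal ((1 - p)\<^sup>2) + ennreal (2 * (1 - p) * p) + ennreal (p\<^sup>2) * (\<integral>\<^sup>+x. (r h x)\<^sup>2 \<partial>P)"
    by (simp add: nn_integral_cmult integral_r prob_space.emeasure_space_1[OF prob])
  also have "\<dots> \<le> ennreal ((1 - p)\<^sup>2) + ennreal (2 * (1 - p) * p) + ennreal (p\<^sup>2) * ennreal \<rho>"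
    by (intro add_left_mono mult_left_mono \<rho>) auto
  also have "\<dots> = ennreal ((1 - p)\<^sup>2 + 2 * (1 - p) * p + p\<^sup>2 * \<rho>)"
    using p \<rho> by (simp add: ennreal_mult)
  also have "\<dots> \<le> ennreal (1 + p\<^sup>2 * \<rho>)"
    by (intro ennreal_leI) (simp add: power2_eq_square algebra_simps)
  finally show ?thesis .
qed

text \<open>The prior puts independent signals on the coordinates of \<open>J\<close> and is truncated to sparse
  vectors. Only the expectation of the functional under the prior enters, so no concentration is
  needed.\<close>

lemma sparse_prior_lower_bound:
  fixes d s :: nat and \<sigma> a b :: real and \<eta> p h \<rho> :: "nat \<Rightarrow> real"
  defines "M \<equiv> Pi\<^sub>M {1..d} (\<lambda>_. P)"
  assumes \<sigma>: "\<sigma> > 0" and T: "T \<in> estimators d" and J: "J \<subseteq> {1..d}"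
    and p: "\<And>j. j \<in> J \<Longrightarrow> 0 \<le> p j \<and> p j \<le> 1" and h: "\<And>j. j \<in> J \<Longrightarrow> h j \<ge> 0"
    and s: "s \<ge> 1" "(\<Sum>j\<in>J. p j) \<le> real s / 2"
    and \<rho>: "\<And>j. j \<in> J \<Longrightarrow> (\<integral>\<^sup>+x. (r (sgn (\<eta> j) * h j) x)\<^sup>2 \<partial>P) \<le> ennreal (\<rho> j)" "\<And>j. j \<in> J \<Longrightarrow> \<rho> j \<ge> 0"
    and a: "a \<ge> 0" "\<And>\<theta>. \<theta> \<in> sparse_class d s \<Longrightarrow> risk \<sigma> d \<eta> T \<theta> M \<le> ennreal (a\<^sup>2)"
    and b: "b \<ge> 0" "risk \<sigma> d \<eta> T (\<lambda>j\<in>{1..d}. 0) M \<le> ennreal (b\<^sup>2)"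
  shows "\<sigma> / 2 * (\<Sum>j\<in>J. \<bar>\<eta> j\<bar> * h j * p j) \<le> a + b * sqrt (\<Prod>j\<in>J. 1 + (p j)\<^sup>2 * \<rho> j)"
proof -
  let ?I = "{1..d}"
  interpret M: prob_space M unfolding M_def by (intro prob_space_PiM prob)
  have [measurable_cong]: "sets P = sets borel" by (rule sets_P)
  have fJ: "finite J" using J finite_subset by auto
  \<comment> \<open>Each signal carries the sign of its loading, so that all contributions to the
    functional add up.\<close>
  define k where "k j = sgn (\<eta> j) * h j" for j
  define \<theta> where "\<theta> S = (\<lambda>j\<in>?I. if j \<in> S then \<sigma> * k j else 0)" for S
  define L where "L S = \<sigma> * (\<Sum>j\<in>S. \<bar>\<eta> j\<bar> * h j)" for S
  define q where "q = subset_prob J p"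
  define \<T> where "\<T> = {S. S \<subseteq> J \<and> card S \<le> s}"
  have fT: "finite \<T>" using fJ unfolding \<T>_def by (auto intro: finite_subset[of _ "Pow J"])
  have q0: "q S \<ge> 0" if "S \<subseteq> J" for S unfolding q_def using subset_prob_nonneg[of J p S] p that by blast
  have L0: "L S \<ge> 0" if "S \<subseteq> J" for S unfolding L_def using \<sigma> h that by (auto intro!: mult_nonneg_nonneg sum_nonneg)
  have lin: "lin_functional d \<eta> (\<theta> S) = L S" if S: "S \<subseteq> J" for S
  proof -
    have "lin_functional d \<eta> (\<theta> S) = (\<Sum>j\<in>?I. if j \<in> S then \<eta> j * (\<sigma> * k j) else 0)"
      unfolding lin_functional_def \<theta>_def by (intro sum.cong) auto
    also have "\<dots> = (\<Sum>j\<in>S. \<eta> j * (\<sigma> * k j))" using S J by (simp add: sum.If_cases Int_absorb1)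
    also have "\<dots> = (\<Sum>j\<in>S. \<sigma> * (\<bar>\<eta> j\<bar> * h j))"
      by (intro sum.cong refl) (simp add: k_def abs_sgn mult_ac)
    finally show ?thesis by (simp add: L_def sum_distrib_left)
  qed
  have obs_meas: "observation \<sigma> d \<theta>' \<in> measurable (Pi\<^sub>M ?I (\<lambda>_. borel)) (Pi\<^sub>M ?I (\<lambda>_. borel))" for \<theta>'
    unfolding observation_def[abs_def] by (intro measurable_restrict) measurable
  have T_meas[measurable]: "T \<in> borel_measurable (Pi\<^sub>M ?I (\<lambda>_. borel))" using T by (simp add: estimators_def)
  have To_meas: "(\<lambda>\<xi>. T (observation \<sigma> d \<theta>' \<xi>)) \<in> borel_measurable (Pi\<^sub>M ?I (\<lambda>_. borel))" for \<theta>'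
    using measurable_compose[OF obs_meas T_meas] .
  have To_M: "(\<lambda>\<xi>. T (observation \<sigma> d \<theta>' \<xi>)) \<in> borel_measurable M" for \<theta>'
    using To_meas by (simp add: M_def measurable_cong_sets[OF sets_PiM_P refl])
  have Td_M: "(\<lambda>\<xi>. ennreal \<bar>T (observation \<sigma> d \<theta>' \<xi>) - c\<bar>) \<in> borel_measurable M" for \<theta>' c
    by (intro measurable_compose[OF _ measurable_ennreal] borel_measurable_abs borel_measurable_diff To_M borel_measurable_const)
  define \<theta>0 where "\<theta>0 = (\<lambda>j\<in>?I. 0::real)"
  define T0 where "T0 \<xi> = ennreal \<bar>T (observation \<sigma> d \<theta>0 \<xi>)\<bar>" for \<xi>
  have T0_meas: "T0 \<in> borel_measurable (Pi\<^sub>M ?I (\<lambda>_. borel))" unfolding T0_def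
    by (intro measurable_compose[OF _ measurable_ennreal] borel_measurable_abs To_meas)
  have T0_M[measurable]: "T0 \<in> borel_measurable M" unfolding T0_def using Td_M[of \<theta>0 0] by simp
  have r_M[measurable]: "(\<lambda>\<xi>. r c (\<xi> j)) \<in> borel_measurable M" if "j \<in> ?I" for j c
    unfolding M_def using that by (rule r_component)
  define W where "W S \<xi> = (\<Prod>j\<in>S. r (k j) (\<xi> j))" for S \<xi>
  have W_M[measurable]: "W S \<in> borel_measurable M" if "S \<subseteq> J" for S
    unfolding W_def using that J by (intro borel_measurable_prod_ennreal r_M) auto
  \<comment> \<open>Triangle inequality L \<le> |T - L| + |T| under the signal S. The first term is
    bounded by the risk on sparse vectors, and the second is moved to pure noise by the likelihood
    ratio.\<close>
  have each: "ennreal (L S) \<le> ennreal a + (\<integral>\<^sup>+\<xi>. T0 \<xi> * W S \<xi> \<partial>M)" if S: "S \<in> \<T>" for S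
  proof -
    have SJ: "S \<subseteq> J" using S by (simp add: \<T>_def)
    have "{j \<in> ?I. \<theta> S j \<noteq> 0} \<subseteq> S" by (auto simp: \<theta>_def)
    then have "card {j \<in> ?I. \<theta> S j \<noteq> 0} \<le> card S" using SJ fJ finite_subset by (intro card_mono) auto
    then have "\<theta> S \<in> sparse_class d s" using S by (auto simp: sparse_class_def \<T>_def \<theta>_def)
    then have "risk \<sigma> d \<eta> T (\<theta> S) M \<le> ennreal (a\<^sup>2)" by (rule a)
    then have sq: "(\<integral>\<^sup>+\<xi>. (ennreal \<bar>T (observation \<sigma> d (\<theta> S) \<xi>) - L S\<bar>)\<^sup>2 \<partial>M) \<le> ennreal (a\<^sup>2)"
      by (simp add: risk_def lin[OF SJ] ennreal_power)
    have 1: "(\<integral>\<^sup>+\<xi>. ennreal \<bar>T (observation \<sigma> d (\<theta> S) \<xi>) - L S\<bar> \<partial>M) \<le> ennreal a"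
      by (rule M.nn_integral_le_if_square_le[OF Td_M sq a(1)])
    have obs: "observation \<sigma> d (\<theta> S) \<xi> = observation \<sigma> d \<theta>0 (\<lambda>j\<in>?I. \<xi> j + (if j \<in> S then k j else 0))" for \<xi>
      by (auto simp: observation_def \<theta>_def \<theta>0_def fun_eq_iff distrib_left)
    have 2: "(\<integral>\<^sup>+\<xi>. ennreal \<bar>T (observation \<sigma> d (\<theta> S) \<xi>)\<bar> \<partial>M) = (\<integral>\<^sup>+\<xi>. T0 \<xi> * W S \<xi> \<partial>M)"
      unfolding obs T0_def[symmetric] M_def W_def using SJ J T0_meas by (intro nn_integral_shift) auto
    have "ennreal (L S) = (\<integral>\<^sup>+\<xi>. ennreal (L S) \<partial>M)" by (simp add: M.emeasure_space_1)
    also have "\<dots> \<le> (\<integral>\<^sup>+\<xi>. ennreal \<bar>T (observation \<sigma> d (\<theta> S) \<xi>) - L S\<bar> + ennreal \<bar>T (observation \<sigma> d (\<theta> S) \<xi>)\<bar> \<partial>M)"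
    proof (intro nn_integral_mono)
      fix \<xi>
      let ?t = "T (observation \<sigma> d (\<theta> S) \<xi>)"
      have "ennreal (L S) \<le> ennreal (\<bar>?t - L S\<bar> + \<bar>?t\<bar>)" by (intro ennreal_leI) linarith
      then show "ennreal (L S) \<le> ennreal \<bar>?t - L S\<bar> + ennreal \<bar>?t\<bar>" by simp
    qed
    also have "\<dots> = (\<integral>\<^sup>+\<xi>. ennreal \<bar>T (observation \<sigma> d (\<theta> S) \<xi>) - L S\<bar> \<partial>M) + (\<integral>\<^sup>+\<xi>. ennreal \<bar>T (observation \<sigma> d (\<theta> S) \<xi>)\<bar> \<partial>M)"
      using Td_M[of "\<theta> S" 0] by (intro nn_integral_add Td_M) simp
    also have "\<dots> \<le> ennreal a + (\<integral>\<^sup>+\<xi>. T0 \<xi> * W S \<xi> \<partial>M)" unfolding 2 using 1 by (intro add_right_mono)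
    finally show ?thesis .
  qed
  define Wm where "Wm \<xi> = (\<Prod>j\<in>J. ennreal (1 - p j) + ennreal (p j) * r (k j) (\<xi> j))" for \<xi>
  have Wm_M[measurable]: "Wm \<in> borel_measurable M"
    unfolding Wm_def using J by (intro borel_measurable_prod_ennreal borel_measurable_add borel_measurable_times_ennreal r_M) auto
  have qsum: "(\<Sum>S\<in>\<T>. q S) \<le> 1"
  proof -
    have "(\<Sum>S\<in>\<T>. q S) \<le> (\<Sum>S | S \<subseteq> J \<and> {} \<subseteq> S. q S)"
      using fJ q0 by (intro sum_mono2) (auto simp: \<T>_def intro: finite_subset[of _ "Pow J"])
    also have "\<dots> = 1" unfolding q_def using sum_subset_prob_superset[OF fJ, of "{}" p] by simp
    finally show ?thesis .
  qed
  \<comment> \<open>Adding the non-sparse sets back only increases the sum and restores the product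
    form, so the truncated prior never has to be renormalised.\<close>
  have mix: "(\<Sum>S\<in>\<T>. ennreal (q S) * W S \<xi>) \<le> Wm \<xi>" for \<xi>
  proof -
    have "Wm \<xi> = (\<Sum>S\<in>Pow J. (\<Prod>j\<in>S. ennreal (p j) * r (k j) (\<xi> j)) * (\<Prod>j\<in>J - S. ennreal (1 - p j)))"
      unfolding Wm_def by (subst prod_add[OF fJ, symmetric]) (simp add: add.commute)
    also have "\<dots> = (\<Sum>S\<in>Pow J. ennreal (q S) * W S \<xi>)"
    proof (intro sum.cong refl)
      fix S assume S: "S \<in> Pow J"
      have "ennreal (q S) = (\<Prod>j\<in>S. ennreal (p j)) * (\<Prod>j\<in>J - S. ennreal (1 - p j))"
      proof -
        have pS: "0 \<le> p j \<and> p j \<le> 1" if "j \<in> S" for j using that S p by auto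
        have pJ: "0 \<le> 1 - p j" if "j \<in> J - S" for j using that p by auto
        have "(\<Prod>j\<in>S. ennreal (p j)) = ennreal (\<Prod>j\<in>S. p j)" using pS by (intro prod_ennreal) auto
        moreover have "(\<Prod>j\<in>J - S. ennreal (1 - p j)) = ennreal (\<Prod>j\<in>J - S. 1 - p j)" using pJ by (intro prod_ennreal) auto
        moreover have "0 \<le> (\<Prod>j\<in>S. p j)" using pS by (intro prod_nonneg) auto
        moreover have "0 \<le> (\<Prod>j\<in>J - S. 1 - p j)" using pJ by (intro prod_nonneg) auto
        ultimately show ?thesis unfolding q_def subset_prob_def by (simp add: ennreal_mult)
      qed
      then show "(\<Prod>j\<in>S. ennreal (p j) * r (k j) (\<xi> j)) * (\<Prod>j\<in>J - S. ennreal (1 - p j)) = ennreal (q S) * W S \<xi>"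
        by (simp add: W_def prod.distrib mult_ac)
    qed
    finally show ?thesis unfolding \<T>_def using fJ by (auto intro!: sum_mono2)
  qed
  have "ennreal (\<Sum>S\<in>\<T>. q S * L S) = (\<Sum>S\<in>\<T>. ennreal (q S) * ennreal (L S))"
    using q0 L0 by (subst sum_ennreal[symmetric]) (auto simp: \<T>_def ennreal_mult intro!: sum.cong)
  also have "\<dots> \<le> (\<Sum>S\<in>\<T>. ennreal (q S) * (ennreal a + (\<integral>\<^sup>+\<xi>. T0 \<xi> * W S \<xi> \<partial>M)))"
    using each by (intro sum_mono mult_left_mono) auto
  also have "\<dots> = (\<Sum>S\<in>\<T>. ennreal (q S)) * ennreal a + (\<Sum>S\<in>\<T>. ennreal (q S) * (\<integral>\<^sup>+\<xi>. T0 \<xi> * W S \<xi> \<partial>M))"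
    by (simp add: distrib_left sum.distrib sum_distrib_right)
  also have "(\<Sum>S\<in>\<T>. ennreal (q S) * (\<integral>\<^sup>+\<xi>. T0 \<xi> * W S \<xi> \<partial>M)) = (\<Sum>S\<in>\<T>. \<integral>\<^sup>+\<xi>. ennreal (q S) * (T0 \<xi> * W S \<xi>) \<partial>M)"
    by (intro sum.cong refl nn_integral_cmult[symmetric]) (auto simp: \<T>_def)
  also have "\<dots> = (\<integral>\<^sup>+\<xi>. (\<Sum>S\<in>\<T>. ennreal (q S) * (T0 \<xi> * W S \<xi>)) \<partial>M)"
    by (intro nn_integral_sum[symmetric]) (auto simp: \<T>_def)
  also have "\<dots> = (\<integral>\<^sup>+\<xi>. T0 \<xi> * (\<Sum>S\<in>\<T>. ennreal (q S) * W S \<xi>) \<partial>M)"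
    by (simp add: sum_distrib_left mult.left_commute)
  also have "(\<Sum>S\<in>\<T>. ennreal (q S)) * ennreal a + \<dots> \<le> 1 * ennreal a + (\<integral>\<^sup>+\<xi>. T0 \<xi> * Wm \<xi> \<partial>M)"
  proof (intro add_mono mult_right_mono nn_integral_mono mult_left_mono mix)
    show "(\<Sum>S\<in>\<T>. ennreal (q S)) \<le> 1"
      using qsum q0 by (subst sum_ennreal) (auto simp: \<T>_def)
  qed auto
  \<comment> \<open>Cauchy-Schwarz under pure noise. The functional vanishes at the zero vector, so
    the second moment of \<open>T0\<close> is the risk there, while that of \<open>Wm\<close>
    factorises over coordinates.\<close>
  also have "(\<integral>\<^sup>+\<xi>. T0 \<xi> * Wm \<xi> \<partial>M) \<le> ennreal (b * sqrt (\<Prod>j\<in>J. 1 + (p j)\<^sup>2 * \<rho> j))"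
  proof (rule ennreal_le_if_square_le)
    have Pr: "(\<Prod>j\<in>J. 1 + (p j)\<^sup>2 * \<rho> j) \<ge> 0" using \<rho> by (intro prod_nonneg) (auto intro: add_nonneg_nonneg)
    show "b * sqrt (\<Prod>j\<in>J. 1 + (p j)\<^sup>2 * \<rho> j) \<ge> 0" using b Pr by simp
    have "(\<integral>\<^sup>+\<xi>. (T0 \<xi>)\<^sup>2 \<partial>M) \<le> ennreal (b\<^sup>2)"
      using b(2) by (simp add: T0_def risk_def lin_functional_def \<theta>0_def ennreal_power)
    moreover have "(\<integral>\<^sup>+\<xi>. (Wm \<xi>)\<^sup>2 \<partial>M) \<le> ennreal (\<Prod>j\<in>J. 1 + (p j)\<^sup>2 * \<rho> j)"
    proof -
      let ?g = "\<lambda>j x. if j \<in> J then (ennreal (1 - p j) + ennreal (p j) * r (k j) x)\<^sup>2 else 1"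
      have "(\<integral>\<^sup>+\<xi>. (Wm \<xi>)\<^sup>2 \<partial>M) = (\<integral>\<^sup>+\<xi>. (\<Prod>j\<in>?I. ?g j (\<xi> j)) \<partial>M)"
        using J by (intro nn_integral_cong) (simp add: Wm_def prod_power_distrib prod.If_cases Int_absorb1)
      also have "\<dots> = (\<Prod>j\<in>?I. \<integral>\<^sup>+x. ?g j x \<partial>P)"
        unfolding M_def by (intro prod.product_nn_integral_prod) auto
      also have "\<dots> = (\<Prod>j\<in>?I. if j \<in> J then (\<integral>\<^sup>+x. (ennreal (1 - p j) + ennreal (p j) * r (k j) x)\<^sup>2 \<partial>P) else 1)"
        by (intro prod.cong refl) (auto simp: prob_space.emeasure_space_1[OF prob])
      also have "\<dots> = (\<Prod>j\<in>J. \<integral>\<^sup>+x. (ennreal (1 - p j) + ennreal (p j) * r (k j) x)\<^sup>2 \<partial>P)"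
        using J by (simp add: prod.If_cases Int_absorb1)
      also have "\<dots> \<le> (\<Prod>j\<in>J. ennreal (1 + (p j)\<^sup>2 * \<rho> j))"
        unfolding k_def using p \<rho> by (intro prod_mono_ennreal nn_integral_mixture_square) auto
      also have "\<dots> = ennreal (\<Prod>j\<in>J. 1 + (p j)\<^sup>2 * \<rho> j)"
        using \<rho> by (intro prod_ennreal) (auto intro: add_nonneg_nonneg)
      finally show ?thesis .
    qed
    ultimately have "(\<integral>\<^sup>+\<xi>. (T0 \<xi>)\<^sup>2 \<partial>M) * (\<integral>\<^sup>+\<xi>. (Wm \<xi>)\<^sup>2 \<partial>M) \<le> ennreal (b\<^sup>2) * ennreal (\<Prod>j\<in>J. 1 + (p j)\<^sup>2 * \<rho> j)"
      by (intro mult_mono) auto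
    moreover have "(\<integral>\<^sup>+\<xi>. T0 \<xi> * Wm \<xi> \<partial>M)\<^sup>2 \<le> (\<integral>\<^sup>+\<xi>. (T0 \<xi>)\<^sup>2 \<partial>M) * (\<integral>\<^sup>+\<xi>. (Wm \<xi>)\<^sup>2 \<partial>M)"
      by (rule Cauchy_Schwarz_nn_integral) measurable
    ultimately show "(\<integral>\<^sup>+\<xi>. T0 \<xi> * Wm \<xi> \<partial>M)\<^sup>2 \<le> ennreal ((b * sqrt (\<Prod>j\<in>J. 1 + (p j)\<^sup>2 * \<rho> j))\<^sup>2)"
      using Pr by (simp add: power_mult_distrib ennreal_mult)
  qed
  finally have "ennreal (\<Sum>S\<in>\<T>. q S * L S) \<le> ennreal a + ennreal (b * sqrt (\<Prod>j\<in>J. 1 + (p j)\<^sup>2 * \<rho> j))"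
    by (simp add: add_left_mono)
  moreover have "b * sqrt (\<Prod>j\<in>J. 1 + (p j)\<^sup>2 * \<rho> j) \<ge> 0"
    using b \<rho> by (auto intro!: mult_nonneg_nonneg prod_nonneg add_nonneg_nonneg)
  ultimately have upper: "(\<Sum>S\<in>\<T>. q S * L S) \<le> a + b * sqrt (\<Prod>j\<in>J. 1 + (p j)\<^sup>2 * \<rho> j)"
    using a(1) by (simp add: ennreal_plus[symmetric] ennreal_le_iff del: ennreal_plus)
  \<comment> \<open>Exchange the sums over coordinates and sets; by
    \<open>subset_prob_truncated\<close>, a coordinate keeps at least half of its probability. This
    is the 1/2 in front.\<close>
  have "\<sigma> / 2 * (\<Sum>j\<in>J. \<bar>\<eta> j\<bar> * h j * p j) = (\<Sum>j\<in>J. \<sigma> * (\<bar>\<eta> j\<bar> * h j) * (p j / 2))"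
    by (simp add: sum_distrib_left mult_ac)
  also have "\<dots> \<le> (\<Sum>j\<in>J. \<sigma> * (\<bar>\<eta> j\<bar> * h j) * (\<Sum>S | S \<subseteq> J \<and> card S \<le> s \<and> j \<in> S. q S))"
    unfolding q_def using \<sigma> h s p fJ by (intro sum_mono mult_left_mono subset_prob_truncated) auto
  also have "\<dots> = (\<Sum>j\<in>J. \<Sum>S\<in>\<T>. if j \<in> S then \<sigma> * (\<bar>\<eta> j\<bar> * h j) * q S else 0)"
  proof (intro sum.cong refl)
    fix j
    have "{S. S \<subseteq> J \<and> card S \<le> s \<and> j \<in> S} = {S \<in> \<T>. j \<in> S}" by (auto simp: \<T>_def)
    then show "\<sigma> * (\<bar>\<eta> j\<bar> * h j) * (\<Sum>S | S \<subseteq> J \<and> card S \<le> s \<and> j \<in> S. q S) = (\<Sum>S\<in>\<T>. if j \<in> S then \<sigma> * (\<bar>\<eta> j\<bar> * h j) * q S else 0)"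
      using fT by (simp add: sum_distrib_left sum.inter_filter if_distrib cong: if_cong)
  qed
  also have "\<dots> = (\<Sum>S\<in>\<T>. \<Sum>j\<in>J. if j \<in> S then \<sigma> * (\<bar>\<eta> j\<bar> * h j) * q S else 0)" by (rule sum.swap)
  also have "\<dots> = (\<Sum>S\<in>\<T>. q S * L S)"
  proof (intro sum.cong refl)
    fix S assume "S \<in> \<T>"
    then have "S \<subseteq> J" by (simp add: \<T>_def)
    then show "(\<Sum>j\<in>J. if j \<in> S then \<sigma> * (\<bar>\<eta> j\<bar> * h j) * q S else 0) = q S * L S"
      using fJ by (simp add: sum.If_cases Int_absorb1 L_def sum_distrib_left mult_ac)
  qed
  finally show ?thesis using upper by simp
qed

end

section \<open>The prior adapted to the weights\<close>

lemma product_in_noise_products: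
  "P \<in> noise_laws \<alpha> \<tau> \<Longrightarrow> Pi\<^sub>M {1..d} (\<lambda>_. P) \<in> noise_products \<alpha> \<tau> d"
  unfolding noise_products_def by (intro CollectI exI[of _ "\<lambda>_. P"]) simp

lemma zero_in_sparse_class: "(\<lambda>j\<in>{1..d}. 0) \<in> sparse_class d s"
proof -
  have empty: "{j \<in> {1..d}. (\<lambda>j\<in>{1..d}. 0::real) j \<noteq> 0} = {}" by auto
  show ?thesis unfolding sparse_class_def
  proof (intro CollectI conjI)
    show "card {j \<in> {1..d}. (\<lambda>j\<in>{1..d}. 0::real) j \<noteq> 0} \<le> s" unfolding empty by simp
  qed auto
qed

definition risk_le :: "real \<Rightarrow> real \<Rightarrow> real \<Rightarrow> nat \<Rightarrow> (nat \<Rightarrow> real) \<Rightarrow> ((nat \<Rightarrow> real) \<Rightarrow> real) \<Rightarrow> nat \<Rightarrow> real \<Rightarrow> bool" where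
  "risk_le \<alpha> \<tau> \<sigma> d \<eta> T s R \<longleftrightarrow>
     (\<forall>\<theta>\<in>sparse_class d s. \<forall>M\<in>noise_products \<alpha> \<tau> d. risk \<sigma> d \<eta> T \<theta> M \<le> ennreal R)"

lemma risk_le_mono:
  assumes "risk_le \<alpha> \<tau> \<sigma> d \<eta> T s' R" "s \<le> s'"
  shows "risk_le \<alpha> \<tau> \<sigma> d \<eta> T s R"
proof -
  have "sparse_class d s \<subseteq> sparse_class d s'" using assms(2) by (auto simp: sparse_class_def)
  then show ?thesis using assms(1) unfolding risk_le_def by blast
qed

text \<open>Here t is the intensity of the prior, and a and b bound the root risks at sparsity s and
  1. The left side is the mean shift of the functional; the exponential is the root of the
  chi-square cost. Stated as a predicate so that the constants are fixed before dimension, loadings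
  and estimator.\<close>

definition weighted_bound :: "real \<Rightarrow> real \<Rightarrow> real \<Rightarrow> real \<Rightarrow> bool" where
  "weighted_bound \<alpha> \<tau>0 c B \<longleftrightarrow>
    (\<forall>\<tau> \<sigma> d \<eta> T s J l t a b. \<tau> \<ge> \<tau>0 \<longrightarrow> loading \<alpha> d \<eta> \<longrightarrow> \<sigma> > 0 \<longrightarrow> T \<in> estimators d \<longrightarrow> J \<subseteq> {1..d}
      \<longrightarrow> l \<ge> 0 \<longrightarrow> t \<ge> 0 \<longrightarrow> (\<forall>j\<in>J. t * \<bar>\<eta> j\<bar> * loading.weight \<alpha> \<eta> l j \<le> 1)
      \<longrightarrow> s \<ge> 1 \<longrightarrow> (\<Sum>j\<in>J. t * \<bar>\<eta> j\<bar> * loading.weight \<alpha> \<eta> l j) \<le> real s / 2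
      \<longrightarrow> a \<ge> 0 \<longrightarrow> risk_le \<alpha> \<tau> \<sigma> d \<eta> T s (a\<^sup>2) \<longrightarrow> b \<ge> 0 \<longrightarrow> risk_le \<alpha> \<tau> \<sigma> d \<eta> T 1 (b\<^sup>2)
      \<longrightarrow> c * \<sigma> * (\<Sum>j\<in>J. (\<bar>\<eta> j\<bar> + l) * (t * \<bar>\<eta> j\<bar> * loading.weight \<alpha> \<eta> l j))
          \<le> a + b * exp (B * t\<^sup>2 * loading.V \<alpha> d \<eta> l))"

lemma weighted_boundD:
  assumes "weighted_bound \<alpha> \<tau>0 c B" "\<tau> \<ge> \<tau>0" "loading \<alpha> d \<eta>" "\<sigma> > 0" "T \<in> estimators d" "J \<subseteq> {1..d}" "l \<ge> 0" "t \<ge> 0"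
    "\<forall>j\<in>J. t * \<bar>\<eta> j\<bar> * loading.weight \<alpha> \<eta> l j \<le> 1"
    "s \<ge> 1" "(\<Sum>j\<in>J. t * \<bar>\<eta> j\<bar> * loading.weight \<alpha> \<eta> l j) \<le> real s / 2"
    "a \<ge> 0" "risk_le \<alpha> \<tau> \<sigma> d \<eta> T s (a\<^sup>2)" "b \<ge> 0" "risk_le \<alpha> \<tau> \<sigma> d \<eta> T 1 (b\<^sup>2)"
  shows "c * \<sigma> * (\<Sum>j\<in>J. (\<bar>\<eta> j\<bar> + l) * (t * \<bar>\<eta> j\<bar> * loading.weight \<alpha> \<eta> l j))
          \<le> a + b * exp (B * t\<^sup>2 * loading.V \<alpha> d \<eta> l)"
  using assms(1) unfolding weighted_bound_def
  apply (elim allE)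
  apply (drule mp, rule assms(2), drule mp, rule assms(3), drule mp, rule assms(4), drule mp, rule assms(5))
  apply (drule mp, rule assms(6), drule mp, rule assms(7), drule mp, rule assms(8), drule mp, rule assms(9))
  apply (drule mp, rule assms(10), drule mp, rule assms(11), drule mp, rule assms(12), drule mp, rule assms(13))
  apply (drule mp, rule assms(14), drule mp, rule assms(15))
  apply assumption
  done

text \<open>A signal c (1 + l/|eta_j|) costs at most a constant over \<open>weight l j\<close>.
  Since \<open>p j\<close> contains the weight once, p_j^2 \<rho>_j is a constant times t^2 eta_j^2
  times the weight, and the sum over j is of order t^2 \<open>V l\<close>.\<close>

lemma weighted_lower_bound:
  fixes \<alpha> :: real
  assumes \<alpha>: "\<alpha> > 0"
  shows "\<exists>\<tau>0 c B. \<tau>0 > 0 \<and> c > 0 \<and> B > 0 \<and> weighted_bound \<alpha> \<tau>0 c B"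
proof -
  obtain P r C K \<tau>0 where noise: "shiftable_noise P r \<alpha> C K" and \<tau>0: "\<tau>0 > 0"
    and PP: "\<And>\<tau>. \<tau> \<ge> \<tau>0 \<Longrightarrow> P \<in> noise_laws \<alpha> \<tau>"
    using shiftable_noise_exists[OF \<alpha>] by blast
  interpret shiftable_noise P r \<alpha> C K by (rule noise)
  note C = C_ge_1 and K = K_pos
  \<comment> \<open>Solves K (2c)^\<alpha> = 1. Since 1 + x \<le> 2 max(1, x), the exponent of a
    shift by c (1 + x) is then at most 1 + x^\<alpha>.\<close>
  define c where "c = K powr (- 1 / \<alpha>) / 2"
  have c: "c > 0" using K by (simp add: c_def)
  have c2: "K * (2 * c) powr \<alpha> = 1"
  proof -
    have "(2 * c) powr \<alpha> = (K powr (- 1 / \<alpha>)) powr \<alpha>" by (simp add: c_def)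
    also have "\<dots> = K powr (- 1 / \<alpha> * \<alpha>)" by (rule powr_powr)
    also have "\<dots> = 1 / K" using K \<alpha> by (simp add: powr_minus_divide)
    finally show ?thesis using K by simp
  qed
  have exponent: "K * (c * (1 + x)) powr \<alpha> \<le> 1 + x powr \<alpha>" if x: "x \<ge> 0" for x
  proof -
    have "(c * (1 + x)) powr \<alpha> \<le> (2 * c * max 1 x) powr \<alpha>"
      using c \<alpha> x by (intro powr_mono2) (auto simp: max_def algebra_simps)
    also have "\<dots> = (2 * c) powr \<alpha> * (max 1 x) powr \<alpha>" using c by (simp add: powr_mult)
    also have "\<dots> \<le> (2 * c) powr \<alpha> * (1 + x powr \<alpha>)"
      by (intro mult_left_mono) (auto simp: max_def)
    finally have "K * (c * (1 + x)) powr \<alpha> \<le> K * ((2 * c) powr \<alpha> * (1 + x powr \<alpha>))"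
      using K by simp
    then show ?thesis by (simp add: mult.assoc[symmetric] c2)
  qed
  \<comment> \<open>C e is the constant in \<rho>; the half comes from the square root over the
    product.\<close>
  define B where "B = C * exp 1 / 2"
  have main: "c / 2 * \<sigma> * (\<Sum>j\<in>J. (\<bar>\<eta> j\<bar> + l) * (t * \<bar>\<eta> j\<bar> * loading.weight \<alpha> \<eta> l j))
          \<le> a + b * exp (B * t\<^sup>2 * loading.V \<alpha> d \<eta> l)"
    if tau: "\<tau> \<ge> \<tau>0" and ld: "loading \<alpha> d \<eta>" and \<sigma>: "\<sigma> > 0" and T: "T \<in> estimators d" and J: "J \<subseteq> {1..d}"
      and l: "l \<ge> 0" and t: "t \<ge> 0" and p1: "\<forall>j\<in>J. t * \<bar>\<eta> j\<bar> * loading.weight \<alpha> \<eta> l j \<le> 1"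
      and s: "s \<ge> 1" "(\<Sum>j\<in>J. t * \<bar>\<eta> j\<bar> * loading.weight \<alpha> \<eta> l j) \<le> real s / 2"
      and a: "a \<ge> 0" "risk_le \<alpha> \<tau> \<sigma> d \<eta> T s (a\<^sup>2)"
      and b: "b \<ge> 0" "risk_le \<alpha> \<tau> \<sigma> d \<eta> T 1 (b\<^sup>2)"
    for \<tau> \<sigma> d \<eta> T s J l t a b
  proof -
    interpret L: loading \<alpha> d \<eta> by (rule ld)
    let ?w = "L.weight l"
    define p where "p j = t * \<bar>\<eta> j\<bar> * ?w j" for j
    define h where "h j = c * (1 + l / \<bar>\<eta> j\<bar>)" for j
    define \<rho> where "\<rho> j = C * exp 1 / ?w j" for j
    have w: "?w j > 0" for j by (rule L.weight_pos)
    have nz: "\<bar>\<eta> j\<bar> > 0" if "j \<in> J" for j using that J L.nonzero by auto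
    have M: "Pi\<^sub>M {1..d} (\<lambda>_. P) \<in> noise_products \<alpha> \<tau> d" using PP[OF tau] by (rule product_in_noise_products)
    have bound: "\<sigma> / 2 * (\<Sum>j\<in>J. \<bar>\<eta> j\<bar> * h j * p j) \<le> a + b * sqrt (\<Prod>j\<in>J. 1 + (p j)\<^sup>2 * \<rho> j)"
    proof (rule sparse_prior_lower_bound[OF \<sigma> T J])
      show "0 \<le> p j \<and> p j \<le> 1" if "j \<in> J" for j
        using p1 that t less_imp_le[OF w] by (auto simp: p_def)
      show "h j \<ge> 0" if "j \<in> J" for j using c l by (simp add: h_def)
      show "s \<ge> 1" "(\<Sum>j\<in>J. p j) \<le> real s / 2" using s by (auto simp: p_def)
      show "\<rho> j \<ge> 0" if "j \<in> J" for j using C less_imp_le[OF w] by (simp add: \<rho>_def)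
      show "(\<integral>\<^sup>+x. (r (sgn (\<eta> j) * h j) x)\<^sup>2 \<partial>P) \<le> ennreal (\<rho> j)" if j: "j \<in> J" for j
      proof -
        have "\<bar>sgn (\<eta> j) * h j\<bar> = h j" using nz[OF j] c l by (simp add: abs_mult abs_sgn_eq h_def)
        then have "(\<integral>\<^sup>+x. (r (sgn (\<eta> j) * h j) x)\<^sup>2 \<partial>P) \<le> ennreal (C * exp (K * h j powr \<alpha>))"
          using chi[of "sgn (\<eta> j) * h j"] by simp
        also have "\<dots> \<le> ennreal (C * exp (1 + (l / \<bar>\<eta> j\<bar>) powr \<alpha>))"
          using exponent[of "l / \<bar>\<eta> j\<bar>"] l C by (intro ennreal_leI mult_left_mono) (auto simp: h_def)
        also have "C * exp (1 + (l / \<bar>\<eta> j\<bar>) powr \<alpha>) = \<rho> j"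
          by (simp add: \<rho>_def L.weight_def exp_add exp_minus divide_inverse)
        finally show ?thesis .
      qed
      show "risk \<sigma> d \<eta> T \<theta> (Pi\<^sub>M {1..d} (\<lambda>_. P)) \<le> ennreal (a\<^sup>2)" if "\<theta> \<in> sparse_class d s" for \<theta>
        using a(2) M that unfolding risk_le_def by blast
      show "risk \<sigma> d \<eta> T (\<lambda>j\<in>{1..d}. 0) (Pi\<^sub>M {1..d} (\<lambda>_. P)) \<le> ennreal (b\<^sup>2)"
        using b(2) M zero_in_sparse_class unfolding risk_le_def by blast
    qed (use a b in auto)
    moreover have "sqrt (\<Prod>j\<in>J. 1 + (p j)\<^sup>2 * \<rho> j) \<le> exp (B * t\<^sup>2 * L.V l)"
    proof -
      have "(\<Prod>j\<in>J. 1 + (p j)\<^sup>2 * \<rho> j) \<le> (\<Prod>j\<in>J. exp ((p j)\<^sup>2 * \<rho> j))"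
        using C less_imp_le[OF w] by (intro prod_mono) (auto simp: \<rho>_def exp_ge_add_one_self intro!: add_nonneg_nonneg)
      also have "\<dots> = exp (\<Sum>j\<in>J. (p j)\<^sup>2 * \<rho> j)" using J finite_subset by (intro exp_sum[symmetric]) auto
      also have "(\<Sum>j\<in>J. (p j)\<^sup>2 * \<rho> j) = (\<Sum>j\<in>J. (2 * B * t\<^sup>2) * ((\<eta> j)\<^sup>2 * ?w j))"
      proof (intro sum.cong refl)
        fix j assume "j \<in> J"
        show "(p j)\<^sup>2 * \<rho> j = (2 * B * t\<^sup>2) * ((\<eta> j)\<^sup>2 * ?w j)"
          using w[of j] by (simp add: p_def \<rho>_def B_def power_mult_distrib field_simps power2_eq_square)
      qed
      also have "\<dots> \<le> (\<Sum>j=1..d. (2 * B * t\<^sup>2) * ((\<eta> j)\<^sup>2 * ?w j))"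
        using J C less_imp_le[OF w] by (intro sum_mono2) (auto simp: B_def)
      also have "\<dots> = 2 * (B * t\<^sup>2 * L.V l)" by (simp add: L.V_def sum_distrib_left mult_ac)
      finally have "(\<Prod>j\<in>J. 1 + (p j)\<^sup>2 * \<rho> j) \<le> exp (2 * (B * t\<^sup>2 * L.V l))" by simp
      then have "sqrt (\<Prod>j\<in>J. 1 + (p j)\<^sup>2 * \<rho> j) \<le> sqrt (exp (2 * (B * t\<^sup>2 * L.V l)))" by simp
      also have "\<dots> = exp (B * t\<^sup>2 * L.V l)"
        unfolding exp_double by simp
      finally show ?thesis .
    qed
    then have "b * sqrt (\<Prod>j\<in>J. 1 + (p j)\<^sup>2 * \<rho> j) \<le> b * exp (B * t\<^sup>2 * L.V l)"
      using b(1) by (rule mult_left_mono)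
    moreover have sums: "(\<Sum>j\<in>J. \<bar>\<eta> j\<bar> * h j * p j) = c * (\<Sum>j\<in>J. (\<bar>\<eta> j\<bar> + l) * p j)"
      unfolding sum_distrib_left
    proof (intro sum.cong refl)
      fix j assume "j \<in> J"
      then have "\<bar>\<eta> j\<bar> * h j = c * (\<bar>\<eta> j\<bar> + l)" using nz[of j] by (simp add: h_def field_simps)
      then show "\<bar>\<eta> j\<bar> * h j * p j = c * ((\<bar>\<eta> j\<bar> + l) * p j)" by simp
    qed
    ultimately have "\<sigma> / 2 * (c * (\<Sum>j\<in>J. (\<bar>\<eta> j\<bar> + l) * p j)) \<le> a + b * exp (B * t\<^sup>2 * L.V l)"
      using bound unfolding sums by linarith
    then show ?thesis by (simp add: p_def mult_ac)
  qed
  have "weighted_bound \<alpha> \<tau>0 (c / 2) B"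
    unfolding weighted_bound_def by (intro allI impI) (rule main; assumption)
  moreover have "\<tau>0 > 0 \<and> c / 2 > 0 \<and> B > 0" using \<tau>0 c C by (simp add: B_def)
  ultimately show ?thesis by blast
qed

section \<open>Two intensities: bounded cost and logarithmic cost\<close>

context loading
begin

text \<open>With t = 1 / sqrt V, balance says that at most s/2 signals are expected. A single term
  of V already dominates its own square root contribution, so every probability is at most 1. The
  shift equals sqrt V plus l s/2, half of the nonadaptive rate or more.\<close>

lemma minimax_sum_bound:
  fixes s :: nat
  assumes s: "s \<ge> 1"
  defines "l \<equiv> lo (real s)" and "t \<equiv> 1 / sqrt (V (lo (real s)))"
  shows "\<forall>j\<in>{1..d}. t * \<bar>\<eta> j\<bar> * weight l j \<le> 1"
    and "(\<Sum>j=1..d. t * \<bar>\<eta> j\<bar> * weight l j) \<le> real s / 2"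
    and "(lo (real s) * real s + no (real s)) / 2 \<le> (\<Sum>j=1..d. (\<bar>\<eta> j\<bar> + l) * (t * \<bar>\<eta> j\<bar> * weight l j))"
    and "t\<^sup>2 * V l = 1"
proof -
  have bal: "balanced (real s / 2) l" unfolding l_def using s by (intro balanced_o) auto
  have v: "sqrt (V l) > 0" by (simp add: V_pos)
  have t: "t = 1 / sqrt (V l)" by (simp add: t_def l_def)
  have sumA: "(\<Sum>j=1..d. t * \<bar>\<eta> j\<bar> * weight l j) = t * A l" by (simp add: A_def sum_distrib_left mult.assoc)
  show "(\<Sum>j=1..d. t * \<bar>\<eta> j\<bar> * weight l j) \<le> real s / 2"
    using bal v unfolding sumA by (simp add: t balanced_def divide_simps)
  have sumV: "(\<Sum>j=1..d. \<bar>\<eta> j\<bar> * (t * \<bar>\<eta> j\<bar> * weight l j)) = t * V l"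
    unfolding V_def sum_distrib_left by (intro sum.cong refl) (simp add: power2_eq_square abs_mult[symmetric])
  have tV: "t * V l = sqrt (V l)" using V_pos[of l] by (simp add: t real_div_sqrt)
  show "t\<^sup>2 * V l = 1" using V_pos[of l] by (simp add: t power_divide)
  show "\<forall>j\<in>{1..d}. t * \<bar>\<eta> j\<bar> * weight l j \<le> 1"
  proof
    fix j assume j: "j \<in> {1..d}"
    have "(\<bar>\<eta> j\<bar> * weight l j)\<^sup>2 = (\<eta> j)\<^sup>2 * weight l j * weight l j" by (simp add: power2_eq_square)
    also have "\<dots> \<le> (\<eta> j)\<^sup>2 * weight l j * 1"
      using weight_le_1[of l j] less_imp_le[OF weight_pos[of l j]] by (intro mult_left_mono) auto
    also have "\<dots> \<le> V l"
      unfolding V_def using j less_imp_le[OF weight_pos] by (subst mult_1_right, intro member_le_sum) auto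
    finally have "\<bar>\<eta> j\<bar> * weight l j \<le> sqrt (V l)" by (rule real_le_rsqrt)
    then show "t * \<bar>\<eta> j\<bar> * weight l j \<le> 1" using v by (simp add: t)
  qed
  have lA: "l * (t * A l) = l * (real s / 2)"
  proof (cases "l = 0")
    case False
    then have "A l = real s / 2 * sqrt (V l)" using bal by (auto simp: balanced_def)
    then have "t * A l = real s / 2" using v by (simp add: t)
    then show ?thesis by simp
  qed simp
  have "(\<Sum>j=1..d. (\<bar>\<eta> j\<bar> + l) * (t * \<bar>\<eta> j\<bar> * weight l j)) = t * V l + l * (t * A l)"
    unfolding distrib_right sum.distrib sumV sumA[symmetric] sum_distrib_left[symmetric] ..
  then show "(lo (real s) * real s + no (real s)) / 2 \<le> (\<Sum>j=1..d. (\<bar>\<eta> j\<bar> + l) * (t * \<bar>\<eta> j\<bar> * weight l j))"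
    unfolding lA tV using v by (simp add: l_def no_eq field_simps)
qed

text \<open>The factor sqrt(elog m) in t matches the one in \<open>star_level\<close>, so that t
  \<open>A l\<close> = \<kappa> m/2 and t \<open>V l\<close> = \<kappa> \<open>ns m\<close>, at a
  cost of \<kappa>^2 elog m. Probabilities above 1 are avoided by keeping only \<open>J\<close>; the
  two assumptions in \<open>big\<close> make the discarded part negligible.\<close>

lemma adaptive_sum_bound:
  fixes m :: nat and \<kappa> :: real
  assumes m: "m \<ge> 1" "m < s0" and \<kappa>: "0 < \<kappa>" "\<kappa> \<le> 1"
    and big: "8 * elog (real m) \<le> real m" "24 * elog (real m) * G 1 \<le> G (real m)"
  defines "l \<equiv> ls (real m)" and "t \<equiv> \<kappa> * sqrt (elog (real m)) / sqrt (V (ls (real m)))"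
  defines "J \<equiv> {j \<in> {1..d}. t * \<bar>\<eta> j\<bar> \<le> 1}"
  shows "\<forall>j\<in>J. t * \<bar>\<eta> j\<bar> * weight l j \<le> 1"
    and "(\<Sum>j\<in>J. t * \<bar>\<eta> j\<bar> * weight l j) \<le> real m / 2"
    and "\<kappa> * G (real m) / 5 \<le> (\<Sum>j\<in>J. (\<bar>\<eta> j\<bar> + l) * (t * \<bar>\<eta> j\<bar> * weight l j))"
    and "t\<^sup>2 * V l = \<kappa>\<^sup>2 * elog (real m)"
proof -
  define lg where "lg = elog (real m)"
  have lg: "lg \<ge> 1" unfolding lg_def using m by (intro elog_ge_1) auto
  have sl: "sqrt lg \<ge> 1" "sqrt lg \<le> lg" using lg real_sqrt_le_mono[of lg "lg\<^sup>2"] by (auto simp: self_le_power)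
  have bal: "balanced (star_level (real m)) l" unfolding l_def using m by (intro balanced_star) auto
  have lp: "l > 0" unfolding l_def using m by (intro ls_pos_below)
  have v: "sqrt (V l) > 0" by (simp add: V_pos)
  have t: "t = \<kappa> * sqrt lg / sqrt (V l)" by (simp add: t_def l_def lg_def)
  have tp: "t > 0" using v \<kappa> lg by (simp add: t)
  have w: "weight l j \<ge> 0" for j using weight_pos[of l j] by simp
  show "\<forall>j\<in>J. t * \<bar>\<eta> j\<bar> * weight l j \<le> 1"
    using w weight_le_1 tp by (auto simp: J_def intro!: mult_le_one)
  have VV: "sqrt (V l) * sqrt (V l) = V l" using V_pos[of l] by simp
  have tV: "t * V l = \<kappa> * (sqrt lg * sqrt (V l))" using v VV by (simp add: t field_simps)
  show t2V: "t\<^sup>2 * V l = \<kappa>\<^sup>2 * elog (real m)"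
    using V_pos[of l] lg by (simp add: t power_divide power_mult_distrib lg_def)
  have tA: "t * A l = \<kappa> * (real m / 2)"
  proof -
    have "A l = star_level (real m) * sqrt (V l)" using bal lp by (simp add: balanced_def)
    then have "t * A l = \<kappa> * (sqrt lg * star_level (real m))" using v by (simp add: t)
    also have "sqrt lg * star_level (real m) = real m / 2" unfolding lg_def using m by (intro star_level_mult) auto
    finally show ?thesis .
  qed
  have sumA: "(\<Sum>j=1..d. t * \<bar>\<eta> j\<bar> * weight l j) = t * A l" by (simp add: A_def sum_distrib_left mult.assoc)
  have "(\<Sum>j\<in>J. t * \<bar>\<eta> j\<bar> * weight l j) \<le> (\<Sum>j=1..d. t * \<bar>\<eta> j\<bar> * weight l j)"
    using tp w by (intro sum_mono2) (auto simp: J_def)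
  also have "\<dots> \<le> 1 * (real m / 2)" unfolding sumA tA using \<kappa> by (intro mult_right_mono) auto
  finally show "(\<Sum>j\<in>J. t * \<bar>\<eta> j\<bar> * weight l j) \<le> real m / 2" by simp
  let ?Jc = "{1..d} - J"
  define Q where "Q = (\<Sum>j\<in>?Jc. (\<eta> j)\<^sup>2 * weight l j)"
  have Q0: "Q \<ge> 0" unfolding Q_def using w by (intro sum_nonneg) auto
  have QV: "Q \<le> V l" unfolding Q_def V_def using w by (intro sum_mono2) auto
  have sumV: "(\<Sum>j\<in>U. \<bar>\<eta> j\<bar> * (t * \<bar>\<eta> j\<bar> * weight l j)) = t * (\<Sum>j\<in>U. (\<eta> j)\<^sup>2 * weight l j)" for U
    unfolding sum_distrib_left by (intro sum.cong refl) (simp add: power2_eq_square abs_mult[symmetric])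
  have all: "(\<Sum>j=1..d. (\<bar>\<eta> j\<bar> + l) * (t * \<bar>\<eta> j\<bar> * weight l j)) = t * V l + l * (t * A l)"
    unfolding distrib_right sum.distrib sumV V_def[symmetric] sumA[symmetric] sum_distrib_left[symmetric] ..
  \<comment> \<open>A discarded coordinate has t |eta_j| > 1, so its expected count is at most its
    share of t^2 V. Only a logarithmic number of signals is lost, against m/2.\<close>
  have loss2: "(\<Sum>j\<in>?Jc. t * \<bar>\<eta> j\<bar> * weight l j) \<le> \<kappa> * lg"
  proof -
    have "(\<Sum>j\<in>?Jc. t * \<bar>\<eta> j\<bar> * weight l j) \<le> (\<Sum>j\<in>?Jc. t\<^sup>2 * ((\<eta> j)\<^sup>2 * weight l j))"
    proof (intro sum_mono)
      fix j assume "j \<in> ?Jc"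
      then have "1 \<le> t * \<bar>\<eta> j\<bar>" by (auto simp: J_def)
      then have "(t * \<bar>\<eta> j\<bar> * weight l j) * 1 \<le> (t * \<bar>\<eta> j\<bar> * weight l j) * (t * \<bar>\<eta> j\<bar>)"
        using tp w[of j] by (intro mult_left_mono) auto
      also have "\<dots> = t\<^sup>2 * ((\<eta> j)\<^sup>2 * weight l j)" by (simp add: power2_eq_square mult_ac)
      finally show "t * \<bar>\<eta> j\<bar> * weight l j \<le> t\<^sup>2 * ((\<eta> j)\<^sup>2 * weight l j)" by simp
    qed
    also have "\<dots> = t\<^sup>2 * Q" by (simp add: Q_def sum_distrib_left)
    also have "\<dots> \<le> t\<^sup>2 * V l" using QV by (intro mult_left_mono) auto
    also have "\<dots> = \<kappa> * (\<kappa> * lg)" using t2V by (simp add: lg_def power2_eq_square)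
    also have "\<dots> \<le> \<kappa> * (1 * lg)" using \<kappa> lg by (intro mult_left_mono mult_right_mono) auto
    finally show ?thesis by simp
  qed
  \<comment> \<open>If t \<open>ls 1\<close> \<le> 1, discarded coordinates exceed
    \<open>ls 1\<close> and have weight at least 1/e there, so their energy is at most 4 V at
    \<open>ls 1\<close>. Otherwise sqrt V is at most \<kappa> sqrt(elog m) \<open>ls 1\<close>.
    Either way the rate at sparsity 1, times a logarithm, dominates.\<close>
  have loss1: "t * Q \<le> \<kappa> * (4 * lg * G 1)"
  proof (cases "t * ls 1 \<le> 1")
    case True
    have V1: "sqrt (V (ls 1)) \<le> sqrt (V l)"
      using V_antimono[of l "ls 1"] ls_antimono[of 1 "real m"] m lp by (simp add: l_def)
    have "Q \<le> (\<Sum>j\<in>?Jc. 4 * ((\<eta> j)\<^sup>2 * weight (ls 1) j))"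
      unfolding Q_def
    proof (intro sum_mono)
      fix j assume "j \<in> ?Jc"
      then have "1 < t * \<bar>\<eta> j\<bar>" by (auto simp: J_def)
      then have "t * ls 1 < t * \<bar>\<eta> j\<bar>" using True by linarith
      then have "ls 1 \<le> \<bar>\<eta> j\<bar>" using tp by simp
      then have "exp (-1) \<le> weight (ls 1) j" using ls_nonneg by (intro weight_ge)
      moreover have "exp (1::real) \<le> 4" using exp_le by linarith
      then have "1 / 4 \<le> exp (-1::real)" by (simp add: exp_minus field_simps)
      ultimately have "weight l j \<le> 4 * weight (ls 1) j" using weight_le_1[of l j] by linarith
      then have "(\<eta> j)\<^sup>2 * weight l j \<le> (\<eta> j)\<^sup>2 * (4 * weight (ls 1) j)" by (intro mult_left_mono) auto
      then show "(\<eta> j)\<^sup>2 * weight l j \<le> 4 * ((\<eta> j)\<^sup>2 * weight (ls 1) j)" by (simp add: mult_ac)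
    qed
    also have "\<dots> \<le> (\<Sum>j=1..d. 4 * ((\<eta> j)\<^sup>2 * weight (ls 1) j))"
      by (intro sum_mono2) (auto simp: less_imp_le[OF weight_pos])
    also have "\<dots> = 4 * (sqrt (V (ls 1)) * sqrt (V (ls 1)))"
      using V_pos[of "ls 1"] by (simp add: V_def sum_distrib_left)
    also have "\<dots> \<le> 4 * (sqrt (V l) * sqrt (V (ls 1)))" using V1 V_pos[of "ls 1"] by (intro mult_left_mono mult_right_mono) auto
    finally have "t * Q \<le> t * (4 * (sqrt (V l) * sqrt (V (ls 1))))" using tp by simp
    also have "\<dots> = \<kappa> * (4 * sqrt lg * ns 1)" using v by (simp add: t ns_eq)
    also have "\<dots> \<le> \<kappa> * (4 * lg * G 1)"
      using \<kappa> sl ns_pos[of 1] ls_nonneg[of 1] by (intro mult_left_mono mult_mono) (auto simp: G_def)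
    finally show ?thesis .
  next
    case False
    have "sqrt (V l) \<le> \<kappa> * sqrt lg * ls 1" using False v by (simp add: t field_simps)
    then have "sqrt lg * sqrt (V l) \<le> sqrt lg * (\<kappa> * sqrt lg * ls 1)" using sl by (intro mult_left_mono) auto
    also have "\<dots> = \<kappa> * ((sqrt lg * sqrt lg) * ls 1)" by (simp only: mult_ac)
    also have "\<dots> = \<kappa> * (lg * ls 1)" using lg by simp
    also have "\<dots> \<le> 1 * (4 * lg * G 1)"
      using \<kappa> lg ns_pos[of 1] ls_nonneg[of 1] by (intro mult_mono) (auto simp: G_def intro!: mult_mono mult_nonneg_nonneg)
    finally have "sqrt lg * sqrt (V l) \<le> 4 * lg * G 1" by simp
    then have "t * V l \<le> \<kappa> * (4 * lg * G 1)" unfolding tV using \<kappa> by (intro mult_left_mono) auto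
    moreover have "t * Q \<le> t * V l" using QV tp by simp
    ultimately show ?thesis by linarith
  qed
  have "(\<Sum>j=1..d. (\<bar>\<eta> j\<bar> + l) * (t * \<bar>\<eta> j\<bar> * weight l j))
      = (\<Sum>j\<in>J. (\<bar>\<eta> j\<bar> + l) * (t * \<bar>\<eta> j\<bar> * weight l j)) + (\<Sum>j\<in>?Jc. (\<bar>\<eta> j\<bar> + l) * (t * \<bar>\<eta> j\<bar> * weight l j))"
    by (subst sum.union_disjoint[symmetric]) (auto simp: J_def intro!: sum.cong)
  moreover have "(\<Sum>j\<in>?Jc. (\<bar>\<eta> j\<bar> + l) * (t * \<bar>\<eta> j\<bar> * weight l j)) = t * Q + l * (\<Sum>j\<in>?Jc. t * \<bar>\<eta> j\<bar> * weight l j)"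
    unfolding distrib_right sum.distrib sumV Q_def[symmetric] sum_distrib_left[symmetric] ..
  moreover have "l * (\<Sum>j\<in>?Jc. t * \<bar>\<eta> j\<bar> * weight l j) \<le> \<kappa> * (l * real m) / 8"
  proof -
    have "l * (\<Sum>j\<in>?Jc. t * \<bar>\<eta> j\<bar> * weight l j) \<le> l * (\<kappa> * lg)" using loss2 lp by (intro mult_left_mono) auto
    also have "\<dots> \<le> l * (\<kappa> * (real m / 8))" using big(1) lp \<kappa> by (intro mult_left_mono) (auto simp: lg_def)
    finally show ?thesis by (simp add: mult_ac)
  qed
  moreover have "t * Q \<le> \<kappa> * G (real m) / 6"
  proof -
    have "4 * lg * G 1 \<le> G (real m) / 6" using big(2) by (simp add: lg_def)
    then have "\<kappa> * (4 * lg * G 1) \<le> \<kappa> * (G (real m) / 6)" using \<kappa> by (intro mult_left_mono) auto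
    then show ?thesis using loss1 by simp
  qed
  moreover have "t * V l = \<kappa> * ns (real m)" using tV by (simp add: ns_eq l_def lg_def)
  moreover have "l * (t * A l) = \<kappa> * (l * real m) / 2" by (simp add: tA)
  moreover have "\<kappa> * G (real m) = \<kappa> * (l * real m) + \<kappa> * ns (real m)" by (simp add: G_def l_def algebra_simps)
  moreover have "\<kappa> * ns (real m) \<ge> 0" using \<kappa> ns_pos[of "real m"] m by simp
  moreover have "\<kappa> * (l * real m) \<ge> 0" using \<kappa> lp by simp
  \<comment> \<open>The term in l m keeps the coefficient 1/2 - 1/6 - 1/8 = 5/24, and the term in
    \<open>ns\<close> keeps 5/6; both exceed 1/5.\<close>
  ultimately show "\<kappa> * G (real m) / 5 \<le> (\<Sum>j\<in>J. (\<bar>\<eta> j\<bar> + l) * (t * \<bar>\<eta> j\<bar> * weight l j))"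
    using all by linarith
qed

end

text \<open>The second clause is a constrained risk inequality: a small risk R1 at sparsity 1 forces
  a large risk R at m. The exchange factor exp(B \<kappa>^2 elog m) is a power of m that \<kappa>
  makes as small as desired.\<close>

definition adaptive_lower_bound :: "real \<Rightarrow> real \<Rightarrow> real \<Rightarrow> real \<Rightarrow> bool" where
  "adaptive_lower_bound \<alpha> \<tau>0 c B \<longleftrightarrow>
    (\<forall>\<tau> \<sigma> d \<eta> T. \<tau> \<ge> \<tau>0 \<longrightarrow> loading \<alpha> d \<eta> \<longrightarrow> \<sigma> > 0 \<longrightarrow> T \<in> estimators d \<longrightarrow>
      (\<forall>s R. s \<ge> 1 \<longrightarrow> R \<ge> 0 \<longrightarrow> risk_le \<alpha> \<tau> \<sigma> d \<eta> T s R \<longrightarrow> c * \<sigma>\<^sup>2 * Phi_o \<alpha> d \<eta> (real s) \<le> R) \<and>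
      (\<forall>m \<kappa> R R1. 1 \<le> m \<longrightarrow> m < s_zero \<alpha> d \<eta> \<longrightarrow> 0 < \<kappa> \<longrightarrow> \<kappa> \<le> 1 \<longrightarrow> 8 * elog (real m) \<le> real m
         \<longrightarrow> 24 * elog (real m) * loading.G \<alpha> d \<eta> 1 \<le> loading.G \<alpha> d \<eta> (real m) \<longrightarrow> R \<ge> 0 \<longrightarrow> R1 \<ge> 0
         \<longrightarrow> risk_le \<alpha> \<tau> \<sigma> d \<eta> T m R \<longrightarrow> risk_le \<alpha> \<tau> \<sigma> d \<eta> T 1 R1
         \<longrightarrow> c * \<sigma> * \<kappa> * loading.G \<alpha> d \<eta> (real m) \<le> sqrt R + sqrt R1 * exp (B * \<kappa>\<^sup>2 * elog (real m))))"

lemma risk_lower_bounds: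
  fixes \<alpha> :: real
  assumes \<alpha>: "\<alpha> > 0"
  shows "\<exists>\<tau>0 c B. \<tau>0 > 0 \<and> c > 0 \<and> B > 0 \<and> adaptive_lower_bound \<alpha> \<tau>0 c B"
proof -
  obtain \<tau>0 c B where \<tau>0: "\<tau>0 > 0" and c: "c > 0" and B: "B > 0" and wb: "weighted_bound \<alpha> \<tau>0 c B"
    using weighted_lower_bound[OF \<alpha>] by blast
  note wlb = weighted_boundD[OF wb]
  define c1 where "c1 = (c / (2 * (1 + exp B)))\<^sup>2"
  have c1: "c1 > 0" using c by (auto simp: c1_def add_pos_pos intro!: divide_pos_pos less_imp_neq[symmetric])
  define c2 where "c2 = min c1 (c / 5)"
  have c2: "c2 > 0" "c2 \<le> c1" "c2 \<le> c / 5" using c c1 by (auto simp: c2_def)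
  have nonadaptive: "c2 * \<sigma>\<^sup>2 * Phi_o \<alpha> d \<eta> (real s) \<le> R"
    if "\<tau> \<ge> \<tau>0" "loading \<alpha> d \<eta>" "\<sigma> > 0" "T \<in> estimators d" "s \<ge> 1" "R \<ge> 0" and risk: "risk_le \<alpha> \<tau> \<sigma> d \<eta> T s R"
    for \<tau> \<sigma> d \<eta> T s R
  proof -
    interpret loading \<alpha> d \<eta> by fact
    let ?l = "lo (real s)" and ?t = "1 / sqrt (V (lo (real s)))"
    let ?D = "lo (real s) * real s + no (real s)"
    note b = minimax_sum_bound[OF that(5)]
    have "c * \<sigma> * (?D / 2) \<le> c * \<sigma> * (\<Sum>j=1..d. (\<bar>\<eta> j\<bar> + ?l) * (?t * \<bar>\<eta> j\<bar> * weight ?l j))"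
      using b(3) c that by (intro mult_left_mono) auto
    \<comment> \<open>A risk bound at sparsity s is also one at sparsity 1, so a and b are taken
      equal. Solving for sqrt R produces the factor 1 + exp B in \<open>c1\<close>.\<close>
    also have "\<dots> \<le> sqrt R + sqrt R * exp (B * ?t\<^sup>2 * V ?l)"
    proof (rule wlb[OF that(1-4)])
      show "0 \<le> ?t" using V_pos[of ?l] by simp
      show "{1..d} \<subseteq> {1..d}" "s \<ge> 1" "0 \<le> sqrt R" "0 \<le> ?l" using that lo_nonneg by auto
      show "risk_le \<alpha> \<tau> \<sigma> d \<eta> T s ((sqrt R)\<^sup>2)" "risk_le \<alpha> \<tau> \<sigma> d \<eta> T 1 ((sqrt R)\<^sup>2)"
        using that(6) risk risk_le_mono[OF risk that(5)] by simp_all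
    qed (use that b(1,2) in simp_all)
    also have "B * ?t\<^sup>2 * V ?l = B" using b(4) by (simp add: mult.assoc)
    finally have "c * \<sigma> * ?D / (2 * (1 + exp B)) \<le> sqrt R" by (simp add: field_simps add_pos_pos)
    then have "(c * \<sigma> * ?D / (2 * (1 + exp B)))\<^sup>2 \<le> (sqrt R)\<^sup>2"
      using c that lo_nonneg[of "real s"] no_pos[of "real s"] by (intro power_mono) (auto intro!: divide_nonneg_nonneg mult_nonneg_nonneg add_nonneg_nonneg)
    then have "c1 * (\<sigma>\<^sup>2 * Phi_o \<alpha> d \<eta> (real s)) \<le> R"
      using that by (simp add: c1_def Phi_o_def power_mult_distrib power_divide)
    moreover have "c2 * (\<sigma>\<^sup>2 * Phi_o \<alpha> d \<eta> (real s)) \<le> c1 * (\<sigma>\<^sup>2 * Phi_o \<alpha> d \<eta> (real s))"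
      using c2(2) by (intro mult_right_mono) (auto simp: Phi_o_def)
    ultimately show ?thesis by (simp add: mult.assoc)
  qed
  have adaptive: "c2 * \<sigma> * \<kappa> * loading.G \<alpha> d \<eta> (real m) \<le> sqrt R + sqrt R1 * exp (B * \<kappa>\<^sup>2 * elog (real m))"
    if "\<tau> \<ge> \<tau>0" "loading \<alpha> d \<eta>" "\<sigma> > 0" "T \<in> estimators d" "1 \<le> m" "m < s_zero \<alpha> d \<eta>" "0 < \<kappa>" "\<kappa> \<le> 1"
      "8 * elog (real m) \<le> real m" "24 * elog (real m) * loading.G \<alpha> d \<eta> 1 \<le> loading.G \<alpha> d \<eta> (real m)" "R \<ge> 0" "R1 \<ge> 0"
      "risk_le \<alpha> \<tau> \<sigma> d \<eta> T m R" "risk_le \<alpha> \<tau> \<sigma> d \<eta> T 1 R1"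
    for \<tau> \<sigma> d \<eta> T m \<kappa> R R1
  proof -
    interpret loading \<alpha> d \<eta> by fact
    let ?l = "ls (real m)" and ?t = "\<kappa> * sqrt (elog (real m)) / sqrt (V (ls (real m)))"
    let ?J = "{j \<in> {1..d}. ?t * \<bar>\<eta> j\<bar> \<le> 1}"
    note b = adaptive_sum_bound[OF that(5-10)]
    have "c2 * (\<sigma> * \<kappa> * G (real m)) \<le> c / 5 * (\<sigma> * \<kappa> * G (real m))"
      using c2(3) that G_pos[of "real m"] by (intro mult_right_mono mult_nonneg_nonneg) auto
    also have "\<dots> = c * \<sigma> * (\<kappa> * G (real m) / 5)" by simp
    also have "\<dots> \<le> c * \<sigma> * (\<Sum>j\<in>?J. (\<bar>\<eta> j\<bar> + ?l) * (?t * \<bar>\<eta> j\<bar> * weight ?l j))"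
      using b(3) c that by (intro mult_left_mono) auto
    also have "\<dots> \<le> sqrt R + sqrt R1 * exp (B * ?t\<^sup>2 * V ?l)"
    proof (rule wlb[OF that(1-4)])
      show "0 \<le> ?t" using that V_pos[of ?l] elog_ge_1[of "real m"] by auto
      show "?J \<subseteq> {1..d}" "m \<ge> 1" "0 \<le> sqrt R" "0 \<le> sqrt R1" "0 \<le> ?l" using that ls_nonneg by auto
      show "risk_le \<alpha> \<tau> \<sigma> d \<eta> T m ((sqrt R)\<^sup>2)" "risk_le \<alpha> \<tau> \<sigma> d \<eta> T 1 ((sqrt R1)\<^sup>2)"
        using that(11-14) by simp_all
    qed (fact b(1) b(2))+
    also have "B * ?t\<^sup>2 * V ?l = B * \<kappa>\<^sup>2 * elog (real m)" unfolding mult.assoc b(4) ..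
    finally show ?thesis by (simp add: mult.assoc)
  qed
  have "adaptive_lower_bound \<alpha> \<tau>0 c2 B"
    unfolding adaptive_lower_bound_def
    by (intro allI impI conjI) ((rule nonadaptive; assumption) | (rule adaptive; assumption))+
  then show ?thesis using \<tau>0 c2(1) B by blast
qed

section \<open>Moments of the noise class\<close>

definition tail_const :: real where "tail_const = 2 * exp (3/2) / (1 - exp (- (1/2)))"

lemma tail_const_ge_1: "tail_const \<ge> 1"
proof -
  have "1 - exp (- (1/2)) \<le> (1::real)" "1 - exp (- (1/2)) > (0::real)" by auto
  moreover have "1 \<le> 2 * exp (3/2 :: real)" using exp_ge_add_one_self[of "3/2::real"] by linarith
  ultimately have "1 - exp (- (1/2)) \<le> 2 * exp (3/2 :: real)" by (meson order_trans)
  then show ?thesis using \<open>1 - exp (- (1/2)) > (0::real)\<close> unfolding tail_const_def by (simp add: le_divide_eq_1)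
qed

lemma noise_laws_facts:
  assumes "P \<in> noise_laws \<alpha> \<tau>"
  shows "prob_space P" "sets P = sets borel" "space P = UNIV"
    "has_bochner_integral P (\<lambda>x. x\<^sup>2) 1"
    "distr P borel uminus = P"
    "t \<ge> 0 \<Longrightarrow> measure P {x. t \<le> \<bar>x\<bar>} \<le> 2 * exp (- 2 * (t / \<tau>) powr \<alpha>)"
proof -
  have rd: "real_distribution P" using assms by (simp add: noise_laws_def)
  show "prob_space P" using rd by (rule real_distribution.axioms)
  show s: "sets P = sets borel" using rd by (rule real_distribution.events_eq_borel)
  show "space P = UNIV" using sets_eq_imp_space_eq[OF s] by simp
qed (use assms in \<open>auto simp: noise_laws_def\<close>)

text \<open>Slice by the integer part n of (|x|/\<tau>)^\<alpha>. The tail decays like exp(-2n) and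
  the integrand is at most exp(3/2 (n + 1)), which leaves a geometric series of ratio exp(-1/2) with
  sum \<open>tail_const\<close>.\<close>

lemma noise_exp_moment:
  assumes P: "P \<in> noise_laws \<alpha> \<tau>" and \<alpha>: "\<alpha> > 0" and \<tau>: "\<tau> > 0"
  shows "(\<integral>\<^sup>+x. ennreal (exp (3/2 * (\<bar>x\<bar> / \<tau>) powr \<alpha>)) \<partial>P) \<le> ennreal tail_const"
proof -
  note [simp] = noise_laws_facts(3)[OF P]
  note [measurable_cong] = noise_laws_facts(2)[OF P]
  interpret prob_space P by (rule noise_laws_facts(1)[OF P])
  define Y where "Y x = (\<bar>x\<bar> / \<tau>) powr \<alpha>" for x :: real
  have Y[measurable]: "Y \<in> borel_measurable borel" unfolding Y_def by measurable
  have sets_Y: "{x. real n \<le> Y x} \<in> sets P" for n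
  proof -
    have "{x \<in> space P. real n \<le> Y x} \<in> sets P" by measurable
    then show ?thesis by simp
  qed
  have tail: "emeasure P {x. real n \<le> Y x} \<le> ennreal (2 * exp (- 2 * real n))" for n
  proof -
    define t where "t = \<tau> * real n powr (1 / \<alpha>)"
    have t0: "t \<ge> 0" using \<tau> by (simp add: t_def)
    have tn: "(t / \<tau>) powr \<alpha> = real n" using \<tau> \<alpha> by (simp add: t_def powr_powr)
    have "{x. real n \<le> Y x} \<subseteq> {x. t \<le> \<bar>x\<bar>}"
    proof
      fix x assume "x \<in> {x. real n \<le> Y x}"
      then have "(t / \<tau>) powr \<alpha> \<le> (\<bar>x\<bar> / \<tau>) powr \<alpha>" by (simp add: tn Y_def)
      moreover have "(\<bar>x\<bar> / \<tau>) powr \<alpha> < (t / \<tau>) powr \<alpha>" if "\<not> t / \<tau> \<le> \<bar>x\<bar> / \<tau>"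
        using that \<alpha> \<tau> by (intro powr_less_mono2) auto
      ultimately have "t / \<tau> \<le> \<bar>x\<bar> / \<tau>" by fastforce
      then show "x \<in> {x. t \<le> \<bar>x\<bar>}" using \<tau> by (simp add: divide_le_cancel)
    qed
    then have "emeasure P {x. real n \<le> Y x} \<le> emeasure P {x. t \<le> \<bar>x\<bar>}"
    proof (rule emeasure_mono)
      have "{x \<in> space P. t \<le> \<bar>x\<bar>} \<in> sets P" by measurable
      then show "{x. t \<le> \<bar>x\<bar>} \<in> sets P" by simp
    qed
    also have "\<dots> = ennreal (measure P {x. t \<le> \<bar>x\<bar>})" by (rule emeasure_eq_measure)
    also have "\<dots> \<le> ennreal (2 * exp (- 2 * real n))"
      using noise_laws_facts(6)[OF P t0] by (intro ennreal_leI) (simp add: tn)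
    finally show ?thesis .
  qed
  have "(\<integral>\<^sup>+x. ennreal (exp (3/2 * Y x)) \<partial>P)
      \<le> (\<integral>\<^sup>+x. (\<Sum>n. ennreal (exp (3/2 * (real n + 1))) * indicator {x. real n \<le> Y x} x) \<partial>P)"
  proof (intro nn_integral_mono)
    fix x
    define n where "n = nat \<lfloor>Y x\<rfloor>"
    have Y0: "Y x \<ge> 0" by (simp add: Y_def)
    have n: "real n \<le> Y x" "Y x \<le> real n + 1" unfolding n_def using Y0 by linarith+
    let ?f = "\<lambda>n. ennreal (exp (3/2 * (real n + 1))) * indicator {x. real n \<le> Y x} x"
    have "ennreal (exp (3/2 * Y x)) \<le> ?f n" using n by (simp add: ennreal_leI)
    also have "?f n \<le> (\<Sum>i. ?f i)"
    proof -
      have "sum ?f {n} \<le> (\<Sum>i. ?f i)" by (intro sum_le_suminf) auto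
      moreover have "sum f {n} = f n" for f :: "nat \<Rightarrow> ennreal" by simp
      ultimately show ?thesis by (simp only:)
    qed
    finally show "ennreal (exp (3/2 * Y x)) \<le> (\<Sum>n. ?f n)" .
  qed
  also have "\<dots> = (\<Sum>n. \<integral>\<^sup>+x. ennreal (exp (3/2 * (real n + 1))) * indicator {x. real n \<le> Y x} x \<partial>P)"
    using sets_Y by (intro nn_integral_suminf) auto
  also have "\<dots> \<le> (\<Sum>n. ennreal (2 * exp (3/2) * exp (- (1/2)) ^ n))"
  proof (intro suminf_le)
    fix n
    have "(\<integral>\<^sup>+x. ennreal (exp (3/2 * (real n + 1))) * indicator {x. real n \<le> Y x} x \<partial>P)
        = ennreal (exp (3/2 * (real n + 1))) * emeasure P {x. real n \<le> Y x}"
      using sets_Y by (rule nn_integral_cmult_indicator)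
    also have "\<dots> \<le> ennreal (exp (3/2 * (real n + 1))) * ennreal (2 * exp (- 2 * real n))"
      by (intro mult_left_mono tail) auto
    also have "\<dots> = ennreal (exp (3/2 * (real n + 1)) * (2 * exp (- 2 * real n)))" by (simp add: ennreal_mult)
    also have "exp (3/2 * (real n + 1)) * (2 * exp (- 2 * real n)) = 2 * (exp (3/2 * (real n + 1) + - 2 * real n))"
      unfolding exp_add by (rule mult.left_commute)
    also have "3/2 * (real n + 1) + - 2 * real n = 3/2 + real n * (- (1/2))" by (simp add: algebra_simps)
    also have "2 * exp (3/2 + real n * (- (1/2))) = 2 * exp (3/2) * exp (- (1/2)) ^ n"
      unfolding exp_add exp_of_nat_mult by simp
    finally show "(\<integral>\<^sup>+x. ennreal (exp (3/2 * (real n + 1))) * indicator {x. real n \<le> Y x} x \<partial>P)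
      \<le> ennreal (2 * exp (3/2) * exp (- (1/2)) ^ n)" .
  qed auto
  also have "\<dots> = ennreal tail_const"
  proof -
    have "(\<lambda>n. 2 * exp (3/2) * exp (- (1/2)) ^ n) sums (2 * exp (3/2) * (1 / (1 - exp (- (1/2 :: real)))))"
      by (intro sums_mult geometric_sums) auto
    then show ?thesis unfolding tail_const_def by (subst suminf_ennreal_eq) auto
  qed
  finally show ?thesis by (simp add: Y_def)
qed

text \<open>The exponent 3/2 is spent as 1/2 + 1. The half absorbs polynomial factors of f; on the
  event that (|x|/\<tau>)^\<alpha> is at least y, the unit is exchanged for exp(-y), which becomes
  the weight of a coordinate.\<close>

lemma noise_truncated_moment:
  assumes P: "P \<in> noise_laws \<alpha> \<tau>" and \<alpha>: "\<alpha> > 0" and \<tau>: "\<tau> > 0"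
    and f: "\<And>x. 0 \<le> f x" "\<And>x. y \<le> (\<bar>x\<bar> / \<tau>) powr \<alpha> \<Longrightarrow> f x \<le> C * exp (1/2 * (\<bar>x\<bar> / \<tau>) powr \<alpha>)" and C: "C \<ge> 0"
    and f0: "\<And>x. \<not> y \<le> (\<bar>x\<bar> / \<tau>) powr \<alpha> \<Longrightarrow> f x = 0"
  shows "(\<integral>\<^sup>+x. ennreal (f x) \<partial>P) \<le> ennreal (C * tail_const * exp (- y))"
proof -
  note [measurable_cong] = noise_laws_facts(2)[OF P]
  have "(\<integral>\<^sup>+x. ennreal (f x) \<partial>P) \<le> (\<integral>\<^sup>+x. ennreal (C * exp (- y)) * ennreal (exp (3/2 * (\<bar>x\<bar> / \<tau>) powr \<alpha>)) \<partial>P)"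
  proof (intro nn_integral_mono)
    fix x
    let ?Y = "(\<bar>x\<bar> / \<tau>) powr \<alpha>"
    have "f x \<le> C * exp (- y) * exp (3/2 * ?Y)"
    proof (cases "y \<le> ?Y")
      case True
      have "f x \<le> C * exp (1/2 * ?Y)" using f(2)[OF True] .
      also have "\<dots> \<le> C * exp (- y + 3/2 * ?Y)" using True C by (intro mult_left_mono) auto
      finally show ?thesis unfolding exp_add mult.assoc .
    next
      case False
      then show ?thesis using f0[OF False] C by simp
    qed
    then show "ennreal (f x) \<le> ennreal (C * exp (- y)) * ennreal (exp (3/2 * ?Y))"
      using C by (subst ennreal_mult[symmetric]) (auto intro: ennreal_leI)
  qed
  also have "\<dots> = ennreal (C * exp (- y)) * (\<integral>\<^sup>+x. ennreal (exp (3/2 * (\<bar>x\<bar> / \<tau>) powr \<alpha>)) \<partial>P)"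
    by (rule nn_integral_cmult) measurable
  also have "\<dots> \<le> ennreal (C * exp (- y)) * ennreal tail_const"
    by (intro mult_left_mono noise_exp_moment[OF P \<alpha> \<tau>]) auto
  also have "\<dots> = ennreal (C * tail_const * exp (- y))"
    using C tail_const_ge_1 by (subst ennreal_mult[symmetric]) (auto simp: mult_ac)
  finally show ?thesis .
qed

section \<open>Symmetrisation, and moments of clipped noise\<close>

lemma exp_le_quadratic:
  fixes y :: real
  shows "exp y + exp (- y) \<le> 2 * (1 + y\<^sup>2 * exp \<bar>y\<bar>)"
proof -
  \<comment> \<open>Second-order Taylor bound. Adding it at y and -y cancels the linear terms, which
    is what symmetry of the noise contributes.\<close>
  have one: "exp z \<le> 1 + z + (z\<^sup>2 * exp \<bar>z\<bar>) / 2" for z :: real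
  proof -
    obtain t where t: "\<bar>t\<bar> \<le> \<bar>z\<bar>" "exp z = (\<Sum>m<2. z ^ m / fact m) + exp t / fact 2 * z ^ 2"
      using Maclaurin_exp_le[of z 2] by blast
    have "exp t * z\<^sup>2 \<le> exp \<bar>z\<bar> * z\<^sup>2" using t(1) by (intro mult_right_mono) auto
    then show ?thesis using t(2) by (simp add: numeral_2_eq_2 mult.commute)
  qed
  define Q where "Q = y\<^sup>2 * exp \<bar>y\<bar>"
  have "Q \<ge> 0" by (simp add: Q_def)
  moreover have "exp y \<le> 1 + y + Q / 2" using one[of y] by (simp add: Q_def)
  moreover have "exp (- y) \<le> 1 - y + Q / 2" using one[of "- y"] by (simp add: Q_def)
  ultimately show ?thesis unfolding Q_def[symmetric] by simp
qed

lemma noise_symmetric_exp: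
  assumes P: "P \<in> noise_laws \<alpha> \<tau>" and \<psi>[measurable]: "\<psi> \<in> borel_measurable borel" and odd: "\<And>x. \<psi> (- x) = - \<psi> x"
  shows "(\<integral>\<^sup>+x. ennreal (exp (\<psi> x)) \<partial>P) = (\<integral>\<^sup>+x. ennreal ((exp (\<psi> x) + exp (- \<psi> x)) / 2) \<partial>P)"
proof -
  note [measurable_cong] = noise_laws_facts(2)[OF P]
  have "(\<integral>\<^sup>+x. ennreal (exp (\<psi> x)) \<partial>P) = (\<integral>\<^sup>+x. ennreal (exp (\<psi> x)) \<partial>distr P borel uminus)"
    by (simp add: noise_laws_facts(5)[OF P])
  also have "\<dots> = (\<integral>\<^sup>+x. ennreal (exp (- \<psi> x)) \<partial>P)" by (subst nn_integral_distr) (auto simp: odd)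
  finally have eq: "(\<integral>\<^sup>+x. ennreal (exp (- \<psi> x)) \<partial>P) = (\<integral>\<^sup>+x. ennreal (exp (\<psi> x)) \<partial>P)" by simp
  have "(\<integral>\<^sup>+x. ennreal ((exp (\<psi> x) + exp (- \<psi> x)) / 2) \<partial>P)
      = (\<integral>\<^sup>+x. ennreal (1/2) * (ennreal (exp (\<psi> x)) + ennreal (exp (- \<psi> x))) \<partial>P)"
  proof (intro nn_integral_cong)
    fix x
    have "ennreal (1/2) * ennreal (exp (\<psi> x) + exp (- \<psi> x)) = ennreal (1/2 * (exp (\<psi> x) + exp (- \<psi> x)))"
      by (rule ennreal_mult[symmetric]) auto
    then show "ennreal ((exp (\<psi> x) + exp (- \<psi> x)) / 2) = ennreal (1/2) * (ennreal (exp (\<psi> x)) + ennreal (exp (- \<psi> x)))"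
      by (subst ennreal_plus[symmetric]) (auto simp del: ennreal_plus)
  qed
  also have "\<dots> = ennreal (1/2) * ((\<integral>\<^sup>+x. ennreal (exp (\<psi> x)) \<partial>P) + (\<integral>\<^sup>+x. ennreal (exp (- \<psi> x)) \<partial>P))"
    by (subst nn_integral_cmult) (auto simp: nn_integral_add)
  also have "\<dots> = ennreal (1/2) * (2 * (\<integral>\<^sup>+x. ennreal (exp (\<psi> x)) \<partial>P))" unfolding eq mult_2 ..
  also have "\<dots> = (\<integral>\<^sup>+x. ennreal (exp (\<psi> x)) \<partial>P)"
  proof -
    have "ennreal (1/2) * 2 = 1" using ennreal_mult[of "1/2" 2] by simp
    then show ?thesis by (simp add: mult.assoc[symmetric])
  qed
  finally show ?thesis by simp
qed

text \<open>Contribution of a pure noise coordinate to the difference of the hard thresholding rules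
  at u and v.\<close>

definition clipped :: "real \<Rightarrow> real \<Rightarrow> real \<Rightarrow> real \<Rightarrow> real" where
  "clipped e u v x = (if u < \<bar>e * x\<bar> \<and> \<bar>e * x\<bar> \<le> v then e * x else 0)"

lemma clipped_measurable[measurable]: "clipped e u v \<in> borel_measurable borel"
  unfolding clipped_def by measurable

lemma clipped_uminus: "clipped e u v (- x) = - clipped e u v x" by (simp add: clipped_def)
lemma clipped_uminus': "clipped (- e) u v x = - clipped e u v x" by (simp add: clipped_def)

lemma abs_clipped_le: "\<bar>clipped e u v x\<bar> \<le> \<bar>e * x\<bar>" by (simp add: clipped_def)

lemma square_le_exp_powr:
  fixes \<alpha> \<tau> :: real
  assumes "\<alpha> > 0" "\<tau> > 0"
  shows "\<exists>C\<ge>1. \<forall>x. x\<^sup>2 \<le> C * exp (1/2 * (\<bar>x\<bar> / \<tau>) powr \<alpha>)"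
proof -
  obtain C where C: "C \<ge> 1" "\<And>x. x \<ge> 0 \<Longrightarrow> x ^ 2 * exp (- (1/2) * x powr \<alpha>) \<le> C"
    using power_exp_bounded[of \<alpha> "1/2" 2] assms by auto
  have "x\<^sup>2 \<le> max 1 (\<tau>\<^sup>2 * C) * exp (1/2 * (\<bar>x\<bar> / \<tau>) powr \<alpha>)" for x
  proof -
    let ?u = "\<bar>x\<bar> / \<tau>"
    have "?u\<^sup>2 * exp (- (1/2) * ?u powr \<alpha>) * exp (1/2 * ?u powr \<alpha>) \<le> C * exp (1/2 * ?u powr \<alpha>)"
      using assms by (intro mult_right_mono C(2)) auto
    then have "?u\<^sup>2 \<le> C * exp (1/2 * ?u powr \<alpha>)" by (simp add: mult.assoc exp_add[symmetric])
    then have "\<tau>\<^sup>2 * ?u\<^sup>2 \<le> \<tau>\<^sup>2 * (C * exp (1/2 * ?u powr \<alpha>))" by (intro mult_left_mono) auto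
    also have "\<tau>\<^sup>2 * ?u\<^sup>2 = x\<^sup>2" using assms by (simp add: power_divide)
    also have "\<tau>\<^sup>2 * (C * exp (1/2 * ?u powr \<alpha>)) \<le> max 1 (\<tau>\<^sup>2 * C) * exp (1/2 * ?u powr \<alpha>)"
      unfolding mult.assoc[symmetric] by (intro mult_right_mono) auto
    finally show ?thesis .
  qed
  then show ?thesis by (intro exI[of _ "max 1 (\<tau>\<^sup>2 * C)"]) auto
qed

text \<open>Explains the factor \<tau> in the thresholds: passing \<tau> l in the scale of the class
  means that the exponent of the tail bound reaches exactly the exponent of the weight.\<close>

lemma threshold_iff:
  fixes e \<tau> l \<alpha> x :: real
  assumes "e \<noteq> 0" "\<tau> > 0" "l \<ge> 0" "\<alpha> > 0" "\<tau> * l < \<bar>e * x\<bar>"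
  shows "(l / \<bar>e\<bar>) powr \<alpha> \<le> (\<bar>x\<bar> / \<tau>) powr \<alpha>"
proof -
  have "l / \<bar>e\<bar> \<le> \<bar>x\<bar> / \<tau>" using assms by (simp add: divide_simps abs_mult mult_ac)
  then show ?thesis using assms by (intro powr_mono2) auto
qed

lemma noise_clipped_variance:
  fixes \<alpha> \<tau> :: real
  assumes \<alpha>: "\<alpha> > 0" and \<tau>: "\<tau> > 0"
  shows "\<exists>C\<ge>1. \<forall>P\<in>noise_laws \<alpha> \<tau>. \<forall>e l. e \<noteq> 0 \<longrightarrow> l \<ge> 0 \<longrightarrow>
    (\<integral>\<^sup>+x. ennreal ((if \<tau> * l < \<bar>e * x\<bar> then e * x else 0)\<^sup>2) \<partial>P) \<le> ennreal (C * e\<^sup>2 * exp (- ((l / \<bar>e\<bar>) powr \<alpha>)))"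
proof -
  obtain C where C: "C \<ge> 1" "\<And>x. x\<^sup>2 \<le> C * exp (1/2 * (\<bar>x\<bar> / \<tau>) powr \<alpha>)"
    using square_le_exp_powr[OF \<alpha> \<tau>] by blast
  have "(\<integral>\<^sup>+x. ennreal ((if \<tau> * l < \<bar>e * x\<bar> then e * x else 0)\<^sup>2) \<partial>P) \<le> ennreal ((C * tail_const) * e\<^sup>2 * exp (- ((l / \<bar>e\<bar>) powr \<alpha>)))"
    if P: "P \<in> noise_laws \<alpha> \<tau>" and e: "e \<noteq> 0" and l: "l \<ge> 0" for P e l
  proof -
    have "(\<integral>\<^sup>+x. ennreal ((if \<tau> * l < \<bar>e * x\<bar> then e * x else 0)\<^sup>2) \<partial>P) \<le> ennreal ((e\<^sup>2 * C) * tail_const * exp (- ((l / \<bar>e\<bar>) powr \<alpha>)))"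
    proof (rule noise_truncated_moment[OF P \<alpha> \<tau>])
      fix x
      have "e\<^sup>2 * x\<^sup>2 \<le> e\<^sup>2 * (C * exp (1/2 * (\<bar>x\<bar> / \<tau>) powr \<alpha>))" by (intro mult_left_mono C) auto
      then show "(if \<tau> * l < \<bar>e * x\<bar> then e * x else 0)\<^sup>2 \<le> (e\<^sup>2 * C) * exp (1/2 * (\<bar>x\<bar> / \<tau>) powr \<alpha>)"
        using C(1) by (auto simp: power_mult_distrib mult.assoc)
      show "(if \<tau> * l < \<bar>e * x\<bar> then e * x else 0)\<^sup>2 = 0" if "\<not> (l / \<bar>e\<bar>) powr \<alpha> \<le> (\<bar>x\<bar> / \<tau>) powr \<alpha>"
        using threshold_iff[OF e \<tau> l \<alpha>, of x] that by auto
    qed (use C in auto)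
    then show ?thesis by (simp add: mult_ac)
  qed
  moreover have "C * tail_const \<ge> 1" using C(1) tail_const_ge_1 mult_mono[of 1 C 1 tail_const] by simp
  ultimately show ?thesis by blast
qed

text \<open>For \<open>\<alpha> < 2\<close> the summands are bounded (Bernstein); for \<open>\<alpha> \<ge> 2\<close> the noise is subgaussian, and
  the upper truncation is not used.\<close>

lemma noise_clipped_mgf:
  fixes \<alpha> \<tau> :: real
  assumes \<alpha>: "\<alpha> > 0" and \<tau>: "\<tau> > 0"
  shows "\<exists>C\<ge>1. \<forall>P\<in>noise_laws \<alpha> \<tau>. \<forall>e l l' a. e \<noteq> 0 \<longrightarrow> l' \<ge> 0 \<longrightarrow> a \<ge> 0 \<longrightarrow>
    (if \<alpha> < 2 then a * \<tau> * l \<le> 1 else a * \<tau> * l' \<le> 1) \<longrightarrow>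
    (\<integral>\<^sup>+x. ennreal (exp (a * clipped e (\<tau> * l') (\<tau> * l) x)) \<partial>P)
      \<le> ennreal (exp (C * a\<^sup>2 * (e\<^sup>2 * exp (- ((l' / \<bar>e\<bar>) powr \<alpha>)))))"
proof -
  obtain C where C: "C \<ge> 1" "\<And>x. x\<^sup>2 \<le> C * exp (1/2 * (\<bar>x\<bar> / \<tau>) powr \<alpha>)"
    using square_le_exp_powr[OF \<alpha> \<tau>] by blast
  obtain C4 :: real where C4: "C4 \<ge> 1" "\<And>u::real. u \<ge> 0 \<Longrightarrow> u\<^sup>2 * exp (- (1/4) * u powr 2) \<le> C4"
    using power_exp_bounded[of 2 "1/4" 2] by (meson zero_less_divide_1_iff zero_less_numeral)
  \<comment> \<open>One entry for each regime: for \<alpha> < 2 the exponent is at most 1 and costs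
    a factor e; for \<alpha> \<ge> 2 the factor exp(|x|/\<tau>) is absorbed as in
    \<open>quad\<close>.\<close>
  define D where "D = max (C * exp 1) (\<tau>\<^sup>2 * (C4 * exp (3/2)))"
  have D: "D \<ge> 1" "C * exp 1 \<le> D" "\<tau>\<^sup>2 * (C4 * exp (3/2)) \<le> D"
    using C(1) mult_mono[of 1 C 1 "exp 1 :: real"] exp_ge_add_one_self[of "1::real"] by (auto simp: D_def)
  define E where "E = D * tail_const"
  have E: "E \<ge> 1" using D(1) tail_const_ge_1 mult_mono[of 1 D 1 tail_const] by (simp add: E_def)
  \<comment> \<open>The second summand serves the steep slopes below; its factor 3 bounds e.\<close>
  define C' where "C' = E + 3 * (\<tau>\<^sup>2 * (1 + ln tail_const))"
  have lnE: "ln tail_const \<ge> 0" using tail_const_ge_1 by simp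
  have C': "C' \<ge> 1" "E \<le> C'" "3 * (\<tau>\<^sup>2 * (1 + ln tail_const)) \<le> C'" proof -
    have "0 \<le> \<tau>\<^sup>2 * (1 + ln tail_const)" using lnE by (intro mult_nonneg_nonneg) auto
    then show "C' \<ge> 1" "E \<le> C'" "3 * (\<tau>\<^sup>2 * (1 + ln tail_const)) \<le> C'" unfolding C'_def using E by linarith+
  qed
  have quad: "x\<^sup>2 * exp (\<bar>x\<bar> / \<tau>) \<le> D * exp (1/2 * (\<bar>x\<bar> / \<tau>) powr \<alpha>)" if a2: "\<alpha> \<ge> 2" for x
  proof -
    define u where "u = \<bar>x\<bar> / \<tau>"
    have u: "u \<ge> 0" "x\<^sup>2 = \<tau>\<^sup>2 * u\<^sup>2" using \<tau> by (auto simp: u_def power_divide)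
    have pu: "u powr 2 = u\<^sup>2" using u(1) by simp
    have 1: "u \<le> 1 + u\<^sup>2 / 4" using zero_le_power2[of "u / 2 - 1"] by (simp add: power2_eq_square algebra_simps)
    have 2: "u\<^sup>2 \<le> 1 + u powr \<alpha>"
    proof (cases "u \<le> 1")
      case True
      then have "u\<^sup>2 \<le> 1" using u(1) by (intro power_le_one) auto
      then show ?thesis using powr_ge_zero[of u \<alpha>] by linarith
    next
      case False
      then have "u powr 2 \<le> u powr \<alpha>" using a2 by (intro powr_mono) auto
      then show ?thesis using pu by simp
    qed
    have "u\<^sup>2 * exp u = (u\<^sup>2 * exp (- (1/4) * u powr 2)) * exp (u + 1/4 * u powr 2)"
      unfolding mult.assoc exp_add[symmetric] by simp
    also have "\<dots> \<le> C4 * exp (3/2 + 1/2 * u powr \<alpha>)"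
      using C4 u(1) 1 2 by (intro mult_mono C4) (auto simp: pu)
    finally have "u\<^sup>2 * exp u \<le> (C4 * exp (3/2)) * exp (1/2 * u powr \<alpha>)" unfolding exp_add by (simp only: mult.assoc)
    then have "\<tau>\<^sup>2 * (u\<^sup>2 * exp u) \<le> \<tau>\<^sup>2 * ((C4 * exp (3/2)) * exp (1/2 * u powr \<alpha>))" by (intro mult_left_mono) auto
    also have "\<dots> \<le> D * exp (1/2 * u powr \<alpha>)"
      unfolding mult.assoc[symmetric, of "\<tau>\<^sup>2"] using D by (intro mult_right_mono) auto
    finally show ?thesis by (simp only: u(2) mult.assoc u_def[symmetric])
  qed
  have main: "(\<integral>\<^sup>+x. ennreal (exp (a * clipped e (\<tau> * l') (\<tau> * l) x)) \<partial>P)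
      \<le> ennreal (exp (C' * a\<^sup>2 * (e\<^sup>2 * exp (- ((l' / \<bar>e\<bar>) powr \<alpha>)))))"
    if P: "P \<in> noise_laws \<alpha> \<tau>" and e: "e \<noteq> 0" and l': "l' \<ge> 0" and a: "a \<ge> 0"
      and cond: "if \<alpha> < 2 then a * \<tau> * l \<le> 1 else a * \<tau> * l' \<le> 1" for P e l l' a
  proof -
    note [measurable_cong] = noise_laws_facts(2)[OF P]
    interpret prob_space P by (rule noise_laws_facts(1)[OF P])
    define y where "y = (l' / \<bar>e\<bar>) powr \<alpha>"
    define \<psi> where "\<psi> x = a * clipped e (\<tau> * l') (\<tau> * l) x" for x
    have \<psi>m[measurable]: "\<psi> \<in> borel_measurable borel" unfolding \<psi>_def by measurable
    have sym: "(\<integral>\<^sup>+x. ennreal (exp (\<psi> x)) \<partial>P) = (\<integral>\<^sup>+x. ennreal ((exp (\<psi> x) + exp (- \<psi> x)) / 2) \<partial>P)"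
      by (rule noise_symmetric_exp[OF P \<psi>m]) (simp add: \<psi>_def clipped_uminus)
    have zero: "\<psi> x = 0" if "\<not> y \<le> (\<bar>x\<bar> / \<tau>) powr \<alpha>" for x
    proof -
      have "\<not> \<tau> * l' < \<bar>e * x\<bar>" using threshold_iff[OF e \<tau> l' \<alpha>, of x] that by (auto simp: y_def)
      then show ?thesis by (simp add: \<psi>_def clipped_def)
    qed
    have psi2: "(\<psi> x)\<^sup>2 \<le> a\<^sup>2 * e\<^sup>2 * x\<^sup>2" for x
    proof -
      have "\<bar>\<psi> x\<bar> \<le> \<bar>a * (e * x)\<bar>" using a abs_clipped_le[of e "\<tau> * l'" "\<tau> * l" x] by (simp add: \<psi>_def abs_mult mult_left_mono)
      then have "(\<psi> x)\<^sup>2 \<le> (a * (e * x))\<^sup>2" by (simp only: abs_le_square_iff)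
      then show ?thesis by (simp add: power_mult_distrib mult.assoc)
    qed
    show ?thesis
    \<comment> \<open>Quadratic regime: \<psi> is bounded, or its slope is at most 1/\<tau>, so the
      second-order expansion with the truncated moment suffices.\<close>
    proof (cases "\<alpha> < 2 \<or> a * \<tau> * \<bar>e\<bar> \<le> 1")
      case True
      have small: "(\<psi> x)\<^sup>2 * exp \<bar>\<psi> x\<bar> \<le> a\<^sup>2 * e\<^sup>2 * D * exp (1/2 * (\<bar>x\<bar> / \<tau>) powr \<alpha>)" for x
      proof (cases "\<alpha> < 2")
        case a2: True
        have "\<bar>\<psi> x\<bar> \<le> 1"
        proof (cases "\<tau> * l' < \<bar>e * x\<bar> \<and> \<bar>e * x\<bar> \<le> \<tau> * l")
          case True
          then have "a * \<bar>e * x\<bar> \<le> a * (\<tau> * l)" using a by (intro mult_left_mono) auto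
          also have "\<dots> \<le> 1" using cond a2 by (simp add: mult.assoc)
          finally show ?thesis using True a by (simp add: \<psi>_def clipped_def abs_mult)
        qed (auto simp: \<psi>_def clipped_def)
        then have "(\<psi> x)\<^sup>2 * exp \<bar>\<psi> x\<bar> \<le> (a\<^sup>2 * e\<^sup>2 * x\<^sup>2) * exp 1" by (intro mult_mono psi2) auto
        also have "\<dots> \<le> (a\<^sup>2 * e\<^sup>2 * (C * exp (1/2 * (\<bar>x\<bar> / \<tau>) powr \<alpha>))) * exp 1"
          by (intro mult_right_mono mult_left_mono C) auto
        also have "\<dots> = a\<^sup>2 * e\<^sup>2 * ((C * exp 1) * exp (1/2 * (\<bar>x\<bar> / \<tau>) powr \<alpha>))" by (simp only: mult_ac)
        also have "\<dots> \<le> a\<^sup>2 * e\<^sup>2 * (D * exp (1/2 * (\<bar>x\<bar> / \<tau>) powr \<alpha>))"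
          by (intro mult_left_mono mult_right_mono D) auto
        finally show ?thesis by (simp only: mult.assoc)
      next
        case a2: False
        then have ae: "a * \<bar>e\<bar> \<le> 1 / \<tau>" using True \<tau> by (auto simp: field_simps)
        have "\<bar>\<psi> x\<bar> \<le> a * \<bar>e\<bar> * \<bar>x\<bar>" using a abs_clipped_le[of e "\<tau> * l'" "\<tau> * l" x] by (simp add: \<psi>_def abs_mult mult_left_mono mult.assoc)
        also have "\<dots> \<le> 1 / \<tau> * \<bar>x\<bar>" using ae by (intro mult_right_mono) auto
        finally have "(\<psi> x)\<^sup>2 * exp \<bar>\<psi> x\<bar> \<le> (a\<^sup>2 * e\<^sup>2 * x\<^sup>2) * exp (\<bar>x\<bar> / \<tau>)" by (intro mult_mono psi2) auto
        also have "\<dots> = a\<^sup>2 * e\<^sup>2 * (x\<^sup>2 * exp (\<bar>x\<bar> / \<tau>))" by (simp only: mult.assoc)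
        also have "\<dots> \<le> a\<^sup>2 * e\<^sup>2 * (D * exp (1/2 * (\<bar>x\<bar> / \<tau>) powr \<alpha>))"
          using a2 by (intro mult_left_mono quad) auto
        finally show ?thesis by (simp only: mult.assoc)
      qed
      have "(\<integral>\<^sup>+x. ennreal ((exp (\<psi> x) + exp (- \<psi> x)) / 2) \<partial>P) \<le> (\<integral>\<^sup>+x. 1 + ennreal ((\<psi> x)\<^sup>2 * exp \<bar>\<psi> x\<bar>) \<partial>P)"
      proof (intro nn_integral_mono)
        fix x
        have "ennreal ((exp (\<psi> x) + exp (- \<psi> x)) / 2) \<le> ennreal (1 + (\<psi> x)\<^sup>2 * exp \<bar>\<psi> x\<bar>)"
          using exp_le_quadratic[of "\<psi> x"] by (intro ennreal_leI) simp
        also have "\<dots> = 1 + ennreal ((\<psi> x)\<^sup>2 * exp \<bar>\<psi> x\<bar>)" by (subst ennreal_plus) auto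
        finally show "ennreal ((exp (\<psi> x) + exp (- \<psi> x)) / 2) \<le> 1 + ennreal ((\<psi> x)\<^sup>2 * exp \<bar>\<psi> x\<bar>)" .
      qed
      also have "\<dots> = 1 + (\<integral>\<^sup>+x. ennreal ((\<psi> x)\<^sup>2 * exp \<bar>\<psi> x\<bar>) \<partial>P)"
        by (subst nn_integral_add) (auto simp: emeasure_space_1)
      also have "\<dots> \<le> 1 + ennreal ((a\<^sup>2 * e\<^sup>2 * D) * tail_const * exp (- y))"
        using small zero D(1) by (intro add_left_mono noise_truncated_moment[OF P \<alpha> \<tau>]) auto
      also have "\<dots> = ennreal (1 + E * a\<^sup>2 * (e\<^sup>2 * exp (- y)))"
        using D(1) tail_const_ge_1 by (subst ennreal_plus) (auto simp: E_def mult_ac)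
      also have "\<dots> \<le> ennreal (exp (C' * a\<^sup>2 * (e\<^sup>2 * exp (- y))))"
      proof (intro ennreal_leI)
        have "E * (a\<^sup>2 * (e\<^sup>2 * exp (- y))) \<le> C' * (a\<^sup>2 * (e\<^sup>2 * exp (- y)))"
          using C' E by (intro mult_right_mono) auto
        then show "1 + E * a\<^sup>2 * (e\<^sup>2 * exp (- y)) \<le> exp (C' * a\<^sup>2 * (e\<^sup>2 * exp (- y)))"
          using exp_ge_add_one_self[of "C' * a\<^sup>2 * (e\<^sup>2 * exp (- y))"] unfolding mult.assoc by linarith
      qed
      finally show ?thesis unfolding sym[symmetric] by (simp add: \<psi>_def y_def)
    next
      case False
      define b where "b = a * \<bar>e\<bar> * \<tau>"
      have b: "b > 1" using False by (simp add: b_def mult_ac)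
      have a2: "\<alpha> \<ge> 2" using False by simp
      have "a * \<tau> * l' \<le> 1" using cond a2 by simp
      then have "a * \<tau> * l' < a * \<tau> * \<bar>e\<bar>" using b by (simp add: b_def mult_ac)
      \<comment> \<open>A steep slope together with a \<tau> l' \<le> 1 forces l' below |e|. The
        weight is then at least 1/e, so a bound of order b^2 without the weight is enough.\<close>
      then have le: "l' \<le> \<bar>e\<bar>" using a \<tau> mult_left_mono[of "\<bar>e\<bar>" l' "a * \<tau>"] by fastforce
      have y1: "y \<le> 1"
      proof -
        have "y \<le> 1 powr \<alpha>" unfolding y_def using le l' \<alpha> e by (intro powr_mono2) (auto simp: divide_le_eq_1)
        then show ?thesis by simp
      qed
      have "(\<integral>\<^sup>+x. ennreal (exp (\<psi> x)) \<partial>P) \<le> (\<integral>\<^sup>+x. ennreal (exp (b\<^sup>2 / 2 + 1/2)) * ennreal (exp (3/2 * (\<bar>x\<bar> / \<tau>) powr \<alpha>)) \<partial>P)"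
      proof (intro nn_integral_mono)
        fix x
        define u where "u = \<bar>x\<bar> / \<tau>"
        have u0: "u \<ge> 0" using \<tau> by (simp add: u_def)
        have "\<psi> x \<le> a * (\<bar>e\<bar> * \<bar>x\<bar>)"
          using a abs_clipped_le[of e "\<tau> * l'" "\<tau> * l" x] by (auto simp: \<psi>_def abs_mult intro!: mult_left_mono)
        also have "\<dots> = b * u" using \<tau> by (simp add: b_def u_def)
        also have "\<dots> \<le> (b\<^sup>2 + u\<^sup>2) / 2" using sum_squares_bound[of b u] by simp
        \<comment> \<open>After halving, the coefficient 3 gives exactly the exponent 3/2 available
          in \<open>noise_exp_moment\<close>.\<close>
        also have "u\<^sup>2 \<le> 1 + 3 * u powr \<alpha>"
        proof (cases "u \<le> 1")
          case True
          then have "u\<^sup>2 \<le> 1" using u0 by (intro power_le_one) auto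
          then show ?thesis using powr_ge_zero[of u \<alpha>] by linarith
        next
          case False
          then have "u powr 2 \<le> u powr \<alpha>" using a2 by (intro powr_mono) auto
          moreover have "u powr 2 = u\<^sup>2" using u0 by simp
          ultimately show ?thesis using powr_ge_zero[of u \<alpha>] by linarith
        qed
        finally have "\<psi> x \<le> (b\<^sup>2 / 2 + 1/2) + 3/2 * u powr \<alpha>" by (simp add: field_simps)
        then have "exp (\<psi> x) \<le> exp (b\<^sup>2 / 2 + 1/2) * exp (3/2 * u powr \<alpha>)" unfolding exp_add[symmetric] by simp
        then show "ennreal (exp (\<psi> x)) \<le> ennreal (exp (b\<^sup>2 / 2 + 1/2)) * ennreal (exp (3/2 * (\<bar>x\<bar> / \<tau>) powr \<alpha>))"
          by (subst ennreal_mult[symmetric]) (auto simp: u_def intro: ennreal_leI)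
      qed
      also have "\<dots> = ennreal (exp (b\<^sup>2 / 2 + 1/2)) * (\<integral>\<^sup>+x. ennreal (exp (3/2 * (\<bar>x\<bar> / \<tau>) powr \<alpha>)) \<partial>P)"
        by (rule nn_integral_cmult) measurable
      also have "\<dots> \<le> ennreal (exp (b\<^sup>2 / 2 + 1/2)) * ennreal tail_const"
        by (intro mult_left_mono noise_exp_moment[OF P \<alpha> \<tau>]) auto
      also have "\<dots> = ennreal (exp (b\<^sup>2 / 2 + 1/2 + ln tail_const))"
        using tail_const_ge_1 by (subst ennreal_mult[symmetric]) (auto simp: exp_add)
      also have "\<dots> \<le> ennreal (exp (C' * a\<^sup>2 * (e\<^sup>2 * exp (- y))))"
      proof (intro ennreal_leI, subst exp_le_cancel_iff)
        have b2: "1 \<le> b\<^sup>2" using b by (simp add: one_le_power)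
        have "b\<^sup>2 / 2 + 1/2 + ln tail_const \<le> b\<^sup>2 * (1 + ln tail_const)"
          using b2 mult_right_mono[OF b2 lnE] by (simp add: algebra_simps)
        also have "\<dots> = (a\<^sup>2 * e\<^sup>2) * (\<tau>\<^sup>2 * (1 + ln tail_const))" by (simp add: b_def power_mult_distrib mult_ac)
        also have "\<dots> \<le> (a\<^sup>2 * e\<^sup>2) * (C' * exp (- y))"
        proof (intro mult_left_mono)
          have "exp (1::real) \<le> 3" using exp_le by simp
          then have "1/3 \<le> exp (- 1 :: real)" by (simp add: exp_minus field_simps)
          also have "\<dots> \<le> exp (- y)" using y1 by simp
          finally have "C' * (1/3) \<le> C' * exp (- y)" using C'(1) by (intro mult_left_mono) auto
          then show "\<tau>\<^sup>2 * (1 + ln tail_const) \<le> C' * exp (- y)" using C'(3) by linarith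
        qed auto
        finally show "b\<^sup>2 / 2 + 1/2 + ln tail_const \<le> C' * a\<^sup>2 * (e\<^sup>2 * exp (- y))"
          by (simp only: mult_ac)
      qed
      finally show ?thesis by (simp add: \<psi>_def y_def)
    qed
  qed
  show ?thesis
  proof (intro exI[of _ C'] conjI ballI allI impI)
    show "C' \<ge> 1" by (rule C'(1))
  qed (rule main; assumption)
qed

section \<open>Thresholding estimators and data-driven selection\<close>

text \<open>Induction over coordinates: integrating out the new coordinate first removes the cross
  term, its mean being 0, and adds its second moment.\<close>

lemma nn_integral_square_sum_PiM:
  fixes P :: "nat \<Rightarrow> real measure" and U :: "nat \<Rightarrow> real \<Rightarrow> real" and v :: "nat \<Rightarrow> real"
  assumes P: "\<And>j. prob_space (P j)" "\<And>j. sets (P j) = sets borel" and I: "finite I"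
    and U: "\<And>j. j \<in> I \<Longrightarrow> U j \<in> borel_measurable borel"
    and int: "\<And>j. j \<in> I \<Longrightarrow> integrable (P j) (\<lambda>x. (U j x)\<^sup>2)"
    and mean: "\<And>j. j \<in> I \<Longrightarrow> (\<integral>x. U j x \<partial>P j) = 0"
    and v: "\<And>j. j \<in> I \<Longrightarrow> (\<integral>x. (U j x)\<^sup>2 \<partial>P j) \<le> v j"
  shows "(\<integral>\<^sup>+\<xi>. ennreal ((\<Sum>j\<in>I. U j (\<xi> j))\<^sup>2) \<partial>Pi\<^sub>M I P) \<le> ennreal (\<Sum>j\<in>I. v j)"
  using I U int mean v
proof (induction I)
  case empty
  then show ?case by simp
next
  case (insert i I)
  interpret PP: product_prob_space P UNIV by (rule product_prob_spaceI) (rule P)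
  note [measurable_cong] = P(2)
  interpret PI: prob_space "Pi\<^sub>M I P" by (intro prob_space_PiM P)
  interpret Pi: prob_space "P i" by (rule P)
  have Um: "U j \<in> borel_measurable borel" if "j \<in> insert i I" for j using that insert.prems by auto
  have Um': "(\<lambda>\<xi>. U j (\<xi> j)) \<in> borel_measurable (Pi\<^sub>M J P)" if "j \<in> J" "j \<in> insert i I" for j J
    by (rule measurable_compose[OF measurable_component_singleton[OF that(1)]])
       (use Um[OF that(2)] in \<open>simp add: measurable_cong_sets[OF P(2) refl]\<close>)
  define v0 where "v0 j = (\<integral>x. (U j x)\<^sup>2 \<partial>P j)" for j
  have v0: "v0 i \<ge> 0" by (simp add: v0_def)
  have int1: "integrable (P i) (U i)"
  proof (rule Bochner_Integration.integrable_bound)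
    show "integrable (P i) (\<lambda>x. 1 + (U i x)\<^sup>2)" using insert.prems by simp
    show "AE x in P i. norm (U i x) \<le> norm (1 + (U i x)\<^sup>2)"
    proof (intro AE_I2)
      fix x
      have "\<bar>U i x\<bar> \<le> 1 + (U i x)\<^sup>2"
        using zero_le_power2[of "\<bar>U i x\<bar> - 1"] zero_le_power2[of "U i x"] by (simp add: power2_eq_square algebra_simps del: zero_le_power2)
      then show "norm (U i x) \<le> norm (1 + (U i x)\<^sup>2)" by simp
    qed
  qed (use Um[of i] in \<open>simp add: measurable_cong_sets[OF P(2) refl]\<close>)
  have inner: "(\<integral>\<^sup>+x. ennreal ((z + U i x)\<^sup>2) \<partial>P i) = ennreal (z\<^sup>2 + v0 i)" for z
  proof -
    have intz: "integrable (P i) (\<lambda>x. (z + U i x)\<^sup>2)"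
      unfolding power2_sum using int1 insert.prems by simp
    have "(\<integral>x. (z + U i x)\<^sup>2 \<partial>P i) = z\<^sup>2 + v0 i"
      unfolding power2_sum using int1 insert.prems by (simp add: v0_def prob_space.prob_space[OF P(1)])
    then show ?thesis using intz by (subst nn_integral_eq_integral) auto
  qed
  have "(\<integral>\<^sup>+\<xi>. ennreal ((\<Sum>j\<in>insert i I. U j (\<xi> j))\<^sup>2) \<partial>Pi\<^sub>M (insert i I) P)
      = (\<integral>\<^sup>+\<xi>. (\<integral>\<^sup>+y. ennreal ((\<Sum>j\<in>insert i I. U j ((\<xi>(i := y)) j))\<^sup>2) \<partial>P i) \<partial>Pi\<^sub>M I P)"
  proof (rule PP.product_nn_integral_insert[OF insert.hyps(1,2)])
    show "(\<lambda>\<xi>. ennreal ((\<Sum>j\<in>insert i I. U j (\<xi> j))\<^sup>2)) \<in> borel_measurable (Pi\<^sub>M (insert i I) P)"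
      by (intro measurable_compose[OF _ measurable_ennreal] borel_measurable_power borel_measurable_sum Um') auto
  qed
  also have "\<dots> = (\<integral>\<^sup>+\<xi>. (\<integral>\<^sup>+y. ennreal (((\<Sum>j\<in>I. U j (\<xi> j)) + U i y)\<^sup>2) \<partial>P i) \<partial>Pi\<^sub>M I P)"
  proof (intro nn_integral_cong)
    fix \<xi> y
    have "(\<Sum>j\<in>insert i I. U j ((\<xi>(i := y)) j)) = U i y + (\<Sum>j\<in>I. U j ((\<xi>(i := y)) j))"
      using insert.hyps by (subst sum.insert) auto
    also have "(\<Sum>j\<in>I. U j ((\<xi>(i := y)) j)) = (\<Sum>j\<in>I. U j (\<xi> j))"
      using insert.hyps by (intro sum.cong) auto
    finally show "ennreal ((\<Sum>j\<in>insert i I. U j ((\<xi>(i := y)) j))\<^sup>2) = ennreal (((\<Sum>j\<in>I. U j (\<xi> j)) + U i y)\<^sup>2)"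
      by (simp add: add.commute)
  qed
  also have "\<dots> = (\<integral>\<^sup>+\<xi>. ennreal ((\<Sum>j\<in>I. U j (\<xi> j))\<^sup>2) + ennreal (v0 i) \<partial>Pi\<^sub>M I P)"
    unfolding inner using v0 by simp
  also have "\<dots> = (\<integral>\<^sup>+\<xi>. ennreal ((\<Sum>j\<in>I. U j (\<xi> j))\<^sup>2) \<partial>Pi\<^sub>M I P) + ennreal (v0 i)"
    by (subst nn_integral_add)
      (auto simp: PI.emeasure_space_1 intro!: measurable_compose[OF _ measurable_ennreal] borel_measurable_power borel_measurable_sum Um')
  also have "\<dots> \<le> ennreal (\<Sum>j\<in>I. v j) + ennreal (v i)"
    using insert by (intro add_mono insert.IH ennreal_leI) (auto simp: v0_def)
  also have "\<dots> = ennreal (\<Sum>j\<in>insert i I. v j)"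
  proof -
    have vn: "0 \<le> v j" if "j \<in> insert i I" for j
      using order_trans[OF _ insert.prems(4)[OF that]] by simp
    have "0 \<le> sum v I" "0 \<le> v i" using vn by (auto intro: sum_nonneg)
    then show ?thesis using insert.hyps by (simp add: add.commute)
  qed
  finally show ?case .
qed

lemma nn_integral_exp_sum_PiM:
  fixes P :: "nat \<Rightarrow> real measure" and U :: "nat \<Rightarrow> real \<Rightarrow> real"
  assumes P: "\<And>j. prob_space (P j)" "\<And>j. sets (P j) = sets borel" and I: "finite I"
    and U: "\<And>j. j \<in> I \<Longrightarrow> U j \<in> borel_measurable borel"
    and m: "\<And>j. j \<in> I \<Longrightarrow> (\<integral>\<^sup>+x. ennreal (exp (U j x)) \<partial>P j) \<le> ennreal (exp (g j))"
  shows "(\<integral>\<^sup>+\<xi>. ennreal (exp (\<Sum>j\<in>I. U j (\<xi> j))) \<partial>Pi\<^sub>M I P) \<le> ennreal (exp (\<Sum>j\<in>I. g j))"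
proof -
  interpret PP: product_prob_space P UNIV by (rule product_prob_spaceI) (rule P)
  have Um: "(\<lambda>x. ennreal (exp (U j x))) \<in> borel_measurable (P j)" if "j \<in> I" for j
    using U[OF that] by (simp add: measurable_cong_sets[OF P(2) refl])
  have "(\<integral>\<^sup>+\<xi>. ennreal (exp (\<Sum>j\<in>I. U j (\<xi> j))) \<partial>Pi\<^sub>M I P) = (\<integral>\<^sup>+\<xi>. (\<Prod>j\<in>I. ennreal (exp (U j (\<xi> j)))) \<partial>Pi\<^sub>M I P)"
    by (simp add: exp_sum[OF I] prod_ennreal)
  also have "\<dots> = (\<Prod>j\<in>I. \<integral>\<^sup>+x. ennreal (exp (U j x)) \<partial>P j)"
    using Um by (intro PP.product_nn_integral_prod I)
  also have "\<dots> \<le> (\<Prod>j\<in>I. ennreal (exp (g j)))" by (intro prod_mono_ennreal m)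
  also have "\<dots> = ennreal (exp (\<Sum>j\<in>I. g j))" by (simp add: exp_sum[OF I] prod_ennreal)
  finally show ?thesis .
qed

definition threshold_est :: "nat \<Rightarrow> (nat \<Rightarrow> real) \<Rightarrow> real \<Rightarrow> (nat \<Rightarrow> real) \<Rightarrow> real" where
  "threshold_est d \<eta> u y = (\<Sum>j=1..d. if u < \<bar>\<eta> j * y j\<bar> then \<eta> j * y j else 0)"

lemma threshold_est_measurable: "threshold_est d \<eta> u \<in> borel_measurable (Pi\<^sub>M {1..d} (\<lambda>_. borel))"
  unfolding threshold_est_def[abs_def] by measurable

definition support :: "nat \<Rightarrow> (nat \<Rightarrow> real) \<Rightarrow> nat set" where
  "support d \<theta> = {j \<in> {1..d}. \<theta> j \<noteq> 0}"

text \<open>Off the support the observation is pure noise, and what passes the threshold is exactly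
  \<sigma> times the truncated noise. On the support, thresholding changes \<eta> y by at most
  \<sigma> u, and the full noise remains.\<close>

lemma threshold_est_error:
  assumes \<sigma>: "\<sigma> > 0" and u: "u \<ge> 0"
  shows "\<bar>threshold_est d \<eta> (\<sigma> * u) (observation \<sigma> d \<theta> \<xi>) - lin_functional d \<eta> \<theta>\<bar>
    \<le> real (card (support d \<theta>)) * (\<sigma> * u)
      + \<sigma> * \<bar>\<Sum>j=1..d. (if j \<in> support d \<theta> then \<eta> j * \<xi> j else if u < \<bar>\<eta> j * \<xi> j\<bar> then \<eta> j * \<xi> j else 0)\<bar>"
proof -
  let ?y = "\<lambda>j. \<theta> j + \<sigma> * \<xi> j"
  let ?U = "\<lambda>j. if j \<in> support d \<theta> then \<eta> j * \<xi> j else if u < \<bar>\<eta> j * \<xi> j\<bar> then \<eta> j * \<xi> j else 0"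
  define R where "R j = (if \<sigma> * u < \<bar>\<eta> j * ?y j\<bar> then \<eta> j * ?y j else 0) - \<eta> j * \<theta> j - \<sigma> * ?U j" for j
  have R: "\<bar>R j\<bar> \<le> (if j \<in> support d \<theta> then \<sigma> * u else 0)" if j: "j \<in> {1..d}" for j
  proof (cases "j \<in> support d \<theta>")
    case True
    then show ?thesis using \<sigma> u by (auto simp: R_def algebra_simps abs_le_iff not_less)
  next
    case False
    then have "\<theta> j = 0" using j by (simp add: support_def)
    then have "R j = 0" using False \<sigma> by (simp add: R_def abs_mult mult.left_commute[of "\<bar>\<eta> j\<bar>"])
    then show ?thesis using False by simp
  qed
  have "threshold_est d \<eta> (\<sigma> * u) (observation \<sigma> d \<theta> \<xi>) - lin_functional d \<eta> \<theta> = (\<Sum>j=1..d. R j) + \<sigma> * (\<Sum>j=1..d. ?U j)"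
    unfolding threshold_est_def lin_functional_def observation_def sum_distrib_left sum_subtractf[symmetric] sum.distrib[symmetric]
    by (intro sum.cong refl) (simp add: R_def)
  moreover have "\<bar>\<Sum>j=1..d. R j\<bar> \<le> (\<Sum>j=1..d. if j \<in> support d \<theta> then \<sigma> * u else 0)"
    using R by (intro order_trans[OF sum_abs] sum_mono)
  moreover have "(\<Sum>j=1..d. if j \<in> support d \<theta> then \<sigma> * u else 0) = real (card (support d \<theta>)) * (\<sigma> * u)"
    by (simp add: sum.inter_filter[symmetric] support_def)
  moreover have "\<bar>(\<Sum>j=1..d. R j) + \<sigma> * (\<Sum>j=1..d. ?U j)\<bar> \<le> \<bar>\<Sum>j=1..d. R j\<bar> + \<sigma> * \<bar>\<Sum>j=1..d. ?U j\<bar>"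
    using abs_triangle_ineq[of "\<Sum>j=1..d. R j" "\<sigma> * (\<Sum>j=1..d. ?U j)"] \<sigma> by (simp only: abs_mult abs_of_pos)
  ultimately show ?thesis by linarith
qed

text \<open>On the support two hard thresholding rules differ by at most the larger threshold; off
  the support they differ by noise clipped between the two.\<close>

lemma threshold_est_diff:
  assumes \<sigma>: "\<sigma> > 0" and u: "0 \<le> u" "u \<le> v"
  shows "\<bar>threshold_est d \<eta> (\<sigma> * v) (observation \<sigma> d \<theta> \<xi>) - threshold_est d \<eta> (\<sigma> * u) (observation \<sigma> d \<theta> \<xi>)\<bar>
    \<le> real (card (support d \<theta>)) * (\<sigma> * v)
      + \<sigma> * \<bar>\<Sum>j=1..d. (if j \<in> support d \<theta> then 0 else clipped (\<eta> j) u v (\<xi> j))\<bar>"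
proof -
  let ?y = "\<lambda>j. \<theta> j + \<sigma> * \<xi> j"
  let ?U = "\<lambda>j. if j \<in> support d \<theta> then 0 else clipped (\<eta> j) u v (\<xi> j)"
  define R where "R j = (if \<sigma> * u < \<bar>\<eta> j * ?y j\<bar> then \<eta> j * ?y j else 0) - (if \<sigma> * v < \<bar>\<eta> j * ?y j\<bar> then \<eta> j * ?y j else 0) - \<sigma> * ?U j" for j
  have R: "\<bar>R j\<bar> \<le> (if j \<in> support d \<theta> then \<sigma> * v else 0)" if j: "j \<in> {1..d}" for j
  proof (cases "j \<in> support d \<theta>")
    case True
    have "\<sigma> * u \<le> \<sigma> * v" "0 \<le> \<sigma> * u" using u \<sigma> by auto
    then show ?thesis using True by (auto simp: R_def)
  next
    case False
    then have t0: "\<theta> j = 0" using j by (simp add: support_def)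
    have *: "\<bar>\<eta> j * (\<sigma> * \<xi> j)\<bar> = \<sigma> * \<bar>\<eta> j * \<xi> j\<bar>" using \<sigma> by (simp add: abs_mult)
    have "R j = 0"
    proof -
      have "u \<le> v" by fact
      then show ?thesis using False \<sigma> t0 by (auto simp: R_def * clipped_def)
    qed
    then show ?thesis using False by simp
  qed
  have "threshold_est d \<eta> (\<sigma> * u) (observation \<sigma> d \<theta> \<xi>) - threshold_est d \<eta> (\<sigma> * v) (observation \<sigma> d \<theta> \<xi>) = (\<Sum>j=1..d. R j) + \<sigma> * (\<Sum>j=1..d. ?U j)"
    unfolding threshold_est_def observation_def sum_distrib_left sum_subtractf[symmetric] sum.distrib[symmetric]
    by (intro sum.cong refl) (simp add: R_def)
  moreover have "\<bar>\<Sum>j=1..d. R j\<bar> \<le> (\<Sum>j=1..d. if j \<in> support d \<theta> then \<sigma> * v else 0)"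
    using R by (intro order_trans[OF sum_abs] sum_mono)
  moreover have "(\<Sum>j=1..d. if j \<in> support d \<theta> then \<sigma> * v else 0) = real (card (support d \<theta>)) * (\<sigma> * v)"
    by (simp add: sum.inter_filter[symmetric] support_def)
  moreover have "\<bar>(\<Sum>j=1..d. R j) + \<sigma> * (\<Sum>j=1..d. ?U j)\<bar> \<le> \<bar>\<Sum>j=1..d. R j\<bar> + \<sigma> * \<bar>\<Sum>j=1..d. ?U j\<bar>"
    using abs_triangle_ineq[of "\<Sum>j=1..d. R j" "\<sigma> * (\<Sum>j=1..d. ?U j)"] \<sigma> by (simp only: abs_mult abs_of_pos)
  ultimately show ?thesis by linarith
qed

section \<open>Goldenshluger-Lepski selection\<close>

definition lepski_excess :: "nat \<Rightarrow> (nat \<Rightarrow> 'a \<Rightarrow> real) \<Rightarrow> (nat \<Rightarrow> real) \<Rightarrow> nat \<Rightarrow> 'a \<Rightarrow> real" where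
  "lepski_excess n F w u y = Max ((\<lambda>v. max 0 (\<bar>F u y - F v y\<bar> - w v)) ` {u..n})"

text \<open>\<open>LEAST\<close> breaks ties among the minimisers, so that the index is a function
  of the data with values in a countable set, which is how measurability is obtained.\<close>

definition lepski_index :: "nat \<Rightarrow> (nat \<Rightarrow> 'a \<Rightarrow> real) \<Rightarrow> (nat \<Rightarrow> real) \<Rightarrow> 'a \<Rightarrow> nat" where
  "lepski_index n F w y = (LEAST u. u \<in> {1..n} \<and> (\<forall>v\<in>{1..n}. lepski_excess n F w u y + w u \<le> lepski_excess n F w v y + w v))"

lemma lepski_index:
  assumes "n \<ge> 1"
  shows "lepski_index n F w y \<in> {1..n}"
    and "v \<in> {1..n} \<Longrightarrow> lepski_excess n F w (lepski_index n F w y) y + w (lepski_index n F w y) \<le> lepski_excess n F w v y + w v"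
proof -
  let ?c = "\<lambda>u. lepski_excess n F w u y + w u"
  have "\<exists>u\<in>{1..n}. \<forall>v\<in>{1..n}. ?c u \<le> ?c v"
  proof -
    have ne: "?c ` {1..n} \<noteq> {}" using assms by auto
    then have "Min (?c ` {1..n}) \<in> ?c ` {1..n}" by (intro Min_in) auto
    then obtain u where u: "Min (?c ` {1..n}) = ?c u" "u \<in> {1..n}" by (rule imageE)
    have "?c u \<le> ?c v" if "v \<in> {1..n}" for v
      unfolding u(1)[symmetric] using that by (intro Min_le) auto
    then show ?thesis using u(2) by blast
  qed
  then have "\<exists>u. u \<in> {1..n} \<and> (\<forall>v\<in>{1..n}. ?c u \<le> ?c v)" by blast
  then have *: "lepski_index n F w y \<in> {1..n} \<and> (\<forall>v\<in>{1..n}. ?c (lepski_index n F w y) \<le> ?c v)"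
    unfolding lepski_index_def by (rule LeastI_ex)
  show "lepski_index n F w y \<in> {1..n}" using * by blast
  show "v \<in> {1..n} \<Longrightarrow> ?c (lepski_index n F w y) \<le> ?c v" using * by blast
qed

lemma lepski_excess_ge:
  assumes "u \<le> v" "v \<le> n"
  shows "\<bar>F u y - F v y\<bar> \<le> lepski_excess n F w u y + w v" and "0 \<le> lepski_excess n F w u y"
proof -
  have "max 0 (\<bar>F u y - F v y\<bar> - w v) \<le> lepski_excess n F w u y"
    unfolding lepski_excess_def using assms by (intro Max_ge) auto
  then show "\<bar>F u y - F v y\<bar> \<le> lepski_excess n F w u y + w v" "0 \<le> lepski_excess n F w u y" by auto
qed

text \<open>Compare the selected level with s: the excess of the smaller of the two, plus the
  penalty of the larger, bounds the difference of the estimators. Minimality of excess plus penalty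
  converts the terms of the selected level into those of s.\<close>

lemma lepski_oracle:
  assumes s: "s \<in> {1..n}" and w: "\<And>v. v \<in> {1..n} \<Longrightarrow> 0 \<le> w v"
  shows "\<bar>F (lepski_index n F w y) y - L\<bar> \<le> \<bar>F s y - L\<bar> + 2 * lepski_excess n F w s y + 2 * w s"
proof -
  define u where "u = lepski_index n F w y"
  have n: "n \<ge> 1" using s by auto
  have u: "u \<in> {1..n}" "lepski_excess n F w u y + w u \<le> lepski_excess n F w s y + w s"
    unfolding u_def by (rule lepski_index(1)[OF n], rule lepski_index(2)[OF n s])
  have "\<bar>F u y - F s y\<bar> \<le> 2 * lepski_excess n F w s y + 2 * w s"
  proof (cases "u \<le> s")
    case True
    then have "\<bar>F u y - F s y\<bar> \<le> lepski_excess n F w u y + w s" using s by (intro lepski_excess_ge) auto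
    then show ?thesis using u(2) w[OF u(1)] w[OF s] lepski_excess_ge(2)[of s s n F w y] s by auto
  next
    case False
    then have "\<bar>F s y - F u y\<bar> \<le> lepski_excess n F w s y + w u" using u by (intro lepski_excess_ge) auto
    then show ?thesis using u(2) w[OF s] lepski_excess_ge(2)[of u u n F w y] u(1)
      by (auto simp: abs_minus_commute)
  qed
  then show ?thesis unfolding u_def[symmetric] by linarith
qed

lemma lepski_measurable:
  assumes F: "\<And>u. F u \<in> borel_measurable M"
  shows "lepski_excess n F w u \<in> borel_measurable M"
    and "n \<ge> 1 \<Longrightarrow> (\<lambda>y. F (lepski_index n F w y) y) \<in> borel_measurable M"
proof -
  note F[measurable]
  have ex: "lepski_excess n F w u \<in> borel_measurable M" for u
  proof (cases "u \<le> n")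
    case True
    then show ?thesis unfolding lepski_excess_def[abs_def] by (intro borel_measurable_Max) auto
  next
    case False
    \<comment> \<open>Beyond n the excess is the constant \<open>Max {}\<close>.\<close>
    then have "{u..n} = {}" by auto
    then show ?thesis unfolding lepski_excess_def[abs_def] by simp
  qed
  then show "lepski_excess n F w u \<in> borel_measurable M" .
  note ex[measurable]
  assume n: "n \<ge> 1"
  have idx: "lepski_index n F w \<in> measurable M (count_space UNIV)"
    unfolding lepski_index_def[abs_def] by measurable
  show "(\<lambda>y. F (lepski_index n F w y) y) \<in> borel_measurable M"
    by (rule measurable_compose_countable[OF F idx])
qed

lemma lepski_excess_square:
  assumes "u \<le> n"
  shows "(lepski_excess n F w u y)\<^sup>2 \<le> (\<Sum>v=u..n. (max 0 (\<bar>F u y - F v y\<bar> - w v))\<^sup>2)"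
proof -
  let ?g = "\<lambda>v. max 0 (\<bar>F u y - F v y\<bar> - w v)"
  have "lepski_excess n F w u y \<in> ?g ` {u..n}" unfolding lepski_excess_def using assms by (intro Max_in) auto
  then obtain v where v: "v \<in> {u..n}" "lepski_excess n F w u y = ?g v" by auto
  have "(?g v)\<^sup>2 \<le> (\<Sum>v=u..n. (?g v)\<^sup>2)" using v(1) by (intro member_le_sum) auto
  then show ?thesis using v(2) by simp
qed

text \<open>Converts an exponential moment into a second moment of the excess, using y^2 / 2 \<le>
  exp y for y \<ge> 0.\<close>

lemma positive_part_square_le_exp:
  fixes x a :: real
  assumes "a > 0"
  shows "(max 0 x)\<^sup>2 \<le> 2 / a\<^sup>2 * exp (a * x)"
proof (cases "x \<le> 0")
  case False
  then have ax: "a * x \<ge> 0" using assms by simp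
  have "(a * x)\<^sup>2 / 2 \<le> exp (a * x)" using exp_lower_Taylor_quadratic[OF ax] ax by simp
  then have "a\<^sup>2 * x\<^sup>2 \<le> 2 * exp (a * x)" by (simp add: power_mult_distrib)
  then show ?thesis using False assms by (simp add: field_simps max_def)
qed (simp add: max_def)

lemma sum_inverse_squares_le: "n \<ge> 1 \<Longrightarrow> (\<Sum>v=1..n. 1 / (real v)\<^sup>2) \<le> 2 - 1 / real n"
proof (induction n rule: nat_induct_at_least)
  case (Suc n)
  have "1 / (real (Suc n))\<^sup>2 \<le> 1 / (real n * real (Suc n))"
    using Suc.hyps by (intro divide_left_mono) (auto simp: power2_eq_square intro!: mult_mono)
  also have "\<dots> = 1 / real n - 1 / real (Suc n)" using Suc.hyps by (simp add: field_simps)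
  finally show ?case using Suc by simp
qed simp

lemma noise_odd_mean:
  assumes P: "P \<in> noise_laws \<alpha> \<tau>" and \<psi>: "\<psi> \<in> borel_measurable borel" and odd: "\<And>x. \<psi> (- x) = - \<psi> x"
  shows "(\<integral>x. \<psi> x \<partial>P) = (0::real)"
proof -
  note [measurable_cong] = noise_laws_facts(2)[OF P]
  have "(\<integral>x. \<psi> x \<partial>P) = (\<integral>x. \<psi> x \<partial>distr P borel uminus)" by (simp add: noise_laws_facts(5)[OF P])
  also have "\<dots> = (\<integral>x. \<psi> (- x) \<partial>P)" using \<psi> by (subst integral_distr) auto
  finally show ?thesis by (simp add: odd)
qed

lemma integrable_if_nn_integral_le:
  fixes f :: "'a \<Rightarrow> real"
  assumes f: "f \<in> borel_measurable M" "\<And>x. 0 \<le> f x" and le: "(\<integral>\<^sup>+x. ennreal (f x) \<partial>M) \<le> ennreal c" and c: "c \<ge> 0"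
  shows "integrable M f" and "(\<integral>x. f x \<partial>M) \<le> c"
proof -
  show int: "integrable M f"
    using f le by (intro integrableI_nonneg) (auto intro: le_less_trans)
  have "ennreal (\<integral>x. f x \<partial>M) = (\<integral>\<^sup>+x. ennreal (f x) \<partial>M)"
    using int f by (subst nn_integral_eq_integral) auto
  then have "ennreal (\<integral>x. f x \<partial>M) \<le> ennreal c" using le by simp
  then show "(\<integral>x. f x \<partial>M) \<le> c" using c by (simp add: ennreal_le_iff)
qed

lemma observation_measurable:
  assumes "\<And>j. sets (P j) = sets borel"
  shows "observation \<sigma> d \<theta> \<in> measurable (Pi\<^sub>M {1..d} P) (Pi\<^sub>M {1..d} (\<lambda>_. borel))"
proof -
  note [measurable_cong] = assms
  show ?thesis unfolding observation_def[abs_def] by (intro measurable_restrict) measurable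
qed

lemma component_measurable:
  assumes f: "f \<in> borel_measurable borel" and j: "j \<in> I" and P: "sets (P j) = sets borel"
  shows "(\<lambda>\<xi>. f (\<xi> j)) \<in> borel_measurable (Pi\<^sub>M I P)"
proof (rule measurable_compose[OF measurable_component_singleton[OF j]])
  show "f \<in> borel_measurable (P j)" using f by (simp add: measurable_cong_sets[OF P refl])
qed

lemma (in prob_space) nn_integral_affine:
  "f \<in> borel_measurable M \<Longrightarrow> (\<integral>\<^sup>+x. ennreal a + ennreal b * f x \<partial>M) = ennreal a + ennreal b * (\<integral>\<^sup>+x. f x \<partial>M)"
  by (simp add: nn_integral_add nn_integral_cmult emeasure_space_1)

lemma noise_products_cases:
  assumes "M \<in> noise_products \<alpha> \<tau> d" "d \<ge> 1"
  obtains P where "M = Pi\<^sub>M {1..d} P" "\<And>j. P j \<in> noise_laws \<alpha> \<tau>"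
proof -
  obtain Q where Q: "M = Pi\<^sub>M {1..d} Q" "\<forall>j\<in>{1..d}. Q j \<in> noise_laws \<alpha> \<tau>"
    using assms(1) unfolding noise_products_def by blast
  \<comment> \<open>Outside {1..d} a law of the class is inserted, so that every index carries a
    noise law, as the product space lemmas require.\<close>
  define P where "P j = (if j \<in> {1..d} then Q j else Q 1)" for j
  have "Pi\<^sub>M {1..d} Q = Pi\<^sub>M {1..d} P" by (intro PiM_cong) (auto simp: P_def)
  moreover have "P j \<in> noise_laws \<alpha> \<tau>" for j using Q(2) assms(2) by (auto simp: P_def)
  ultimately show ?thesis using that Q(1) by blast
qed

lemma square_sum3_le: "(x + 2 * y + 2 * z)\<^sup>2 \<le> 3 * x\<^sup>2 + 12 * y\<^sup>2 + 12 * z\<^sup>2" for x y z :: real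
proof -
  have "0 \<le> (x - 2 * y)\<^sup>2 + (x - 2 * z)\<^sup>2 + (2 * y - 2 * z)\<^sup>2" by simp
  then show ?thesis by (simp add: power2_eq_square algebra_simps)
qed

section \<open>Risk and deviations of the thresholding estimators\<close>

context loading
begin

definition om :: "nat \<Rightarrow> real" where "om u = sqrt (Phi_adp \<alpha> d \<eta> (real u))"

text \<open>\<open>om\<close> dominates each quantity that enters the analysis of the estimators.
  The bound on \<open>ls 1 * elog u\<close> is where the second branch of \<open>Phi_adp\<close>
  acts: it limits the truncation level in Bernstein's inequality.\<close>

lemma om_facts:
  assumes u: "u \<ge> 1" "u \<le> s0"
  shows "om u > 0" "(om u)\<^sup>2 = Phi_adp \<alpha> d \<eta> (real u)" "real u * ls (real u) \<le> om u" "ls (real u) \<le> om u"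
    "elog (real u) * V (ls (real u)) \<le> (om u)\<^sup>2" "V (ls (real u)) \<le> (om u)\<^sup>2"
    "\<alpha> < 2 \<Longrightarrow> ls 1 * elog (real u) \<le> om u" "G (real u) \<le> 2 * om u"
proof -
  have u1: "real u \<ge> 1" "real u \<le> real s0" using u by auto
  have pos: "Phi_adp \<alpha> d \<eta> (real u) > 0" using u1 by (intro Phi_adp_pos)
  show "om u > 0" using pos by (simp add: om_def)
  show om2: "(om u)\<^sup>2 = Phi_adp \<alpha> d \<eta> (real u)" using pos by (simp add: om_def)
  have star: "(real u * ls (real u))\<^sup>2 + (ns (real u))\<^sup>2 \<le> (om u)\<^sup>2"
    using Phi_adp_ge_star[of "real u"] u1 by (simp add: om2 Phi_star_eq)
  have "(real u * ls (real u))\<^sup>2 \<le> (om u)\<^sup>2" using star zero_le_power2[of "ns (real u)"] by linarith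
  then show ul: "real u * ls (real u) \<le> om u" using \<open>om u > 0\<close> by (rule power2_le_imp_le[OF _ less_imp_le])
  have "1 * ls (real u) \<le> real u * ls (real u)" using u1 ls_nonneg by (intro mult_right_mono) auto
  then show "ls (real u) \<le> om u" using ul by simp
  have el: "elog (real u) \<ge> 1" using u1 by (intro elog_ge_1)
  have "(ns (real u))\<^sup>2 = elog (real u) * V (ls (real u))" using el V_pos[of "ls (real u)"] by (simp add: ns_eq power_mult_distrib)
  then show lV: "elog (real u) * V (ls (real u)) \<le> (om u)\<^sup>2" using star zero_le_power2[of "real u * ls (real u)"] by linarith
  have "1 * V (ls (real u)) \<le> elog (real u) * V (ls (real u))" using el V_pos[of "ls (real u)"] by (intro mult_right_mono) auto
  then show "V (ls (real u)) \<le> (om u)\<^sup>2" using lV by simp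
  show "ls 1 * elog (real u) \<le> om u" if "\<alpha> < 2"
  proof -
    have "(ls 1)\<^sup>2 \<le> Phi_star \<alpha> d \<eta> 1" using s_zero_bounds by (simp add: Phi_star_eq)
    then have "(ls 1 * elog (real u))\<^sup>2 \<le> Phi_star \<alpha> d \<eta> 1 * (elog (real u))\<^sup>2"
      unfolding power_mult_distrib by (intro mult_right_mono) auto
    also have "\<dots> \<le> (om u)\<^sup>2" using that u1 by (simp add: om2 Phi_adp_eq)
    finally show ?thesis using \<open>om u > 0\<close> by (rule power2_le_imp_le[OF _ less_imp_le])
  qed
  have "(G (real u))\<^sup>2 \<le> 2 * (om u)\<^sup>2"
    using G_le_Phi_star[of "real u"] Phi_adp_ge_star[of "real u"] u1 by (simp add: om2)
  also have "\<dots> \<le> (2 * om u)\<^sup>2" by (simp add: power_mult_distrib)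
  finally show "G (real u) \<le> 2 * om u" by (rule power2_le_imp_le) (use \<open>om u > 0\<close> in simp)
qed

text \<open>Noise on the support is not thresholded, and its variance has to be charged to the rate:
  a loading of size at most l costs l^2, and a larger one has weight at least 1/4 at l.\<close>

lemma support_energy:
  assumes l: "l \<ge> 0" and S: "S \<subseteq> {1..d}"
  shows "(\<Sum>j\<in>S. (\<eta> j)\<^sup>2) \<le> real (card S) * l\<^sup>2 + 4 * V l"
proof -
  have "(\<Sum>j\<in>S. (\<eta> j)\<^sup>2) \<le> (\<Sum>j\<in>S. l\<^sup>2 + 4 * ((\<eta> j)\<^sup>2 * weight l j))"
  proof (intro sum_mono)
    fix j assume "j \<in> S"
    have w: "(\<eta> j)\<^sup>2 * weight l j \<ge> 0" using weight_pos[of l j] by simp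
    show "(\<eta> j)\<^sup>2 \<le> l\<^sup>2 + 4 * ((\<eta> j)\<^sup>2 * weight l j)"
    proof (cases "\<bar>\<eta> j\<bar> \<le> l")
      case True
      then have "\<bar>\<eta> j\<bar>\<^sup>2 \<le> l\<^sup>2" by (intro power_mono) auto
      then show ?thesis using w by simp
    next
      case False
      then have "exp (-1) \<le> weight l j" using l by (intro weight_ge) auto
      moreover have "exp (1::real) \<le> 4" using exp_le by linarith
      then have "1 / 4 \<le> exp (-1::real)" by (simp add: exp_minus field_simps)
      ultimately have "1 \<le> 4 * weight l j" by linarith
      then have "(\<eta> j)\<^sup>2 * 1 \<le> (\<eta> j)\<^sup>2 * (4 * weight l j)" by (intro mult_left_mono) auto
      moreover have "(\<eta> j)\<^sup>2 * (4 * weight l j) = 4 * ((\<eta> j)\<^sup>2 * weight l j)" by (rule mult.left_commute)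
      moreover have "0 \<le> l\<^sup>2" by simp
      ultimately show ?thesis by linarith
    qed
  qed
  also have "\<dots> = real (card S) * l\<^sup>2 + 4 * (\<Sum>j\<in>S. (\<eta> j)\<^sup>2 * weight l j)"
    by (simp add: sum.distrib sum_distrib_left)
  also have "(\<Sum>j\<in>S. (\<eta> j)\<^sup>2 * weight l j) \<le> V l"
    unfolding V_def using S by (intro sum_mono2) (auto simp: less_imp_le[OF weight_pos])
  finally show ?thesis by simp
qed

end

definition variance_const :: "real \<Rightarrow> real \<Rightarrow> real \<Rightarrow> bool" where
  "variance_const \<alpha> \<tau> C \<longleftrightarrow> C \<ge> 1 \<and> (\<forall>P\<in>noise_laws \<alpha> \<tau>. \<forall>e l. e \<noteq> 0 \<longrightarrow> l \<ge> 0 \<longrightarrow>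
    (\<integral>\<^sup>+x. ennreal ((if \<tau> * l < \<bar>e * x\<bar> then e * x else 0)\<^sup>2) \<partial>P) \<le> ennreal (C * e\<^sup>2 * exp (- ((l / \<bar>e\<bar>) powr \<alpha>))))"

definition mgf_const :: "real \<Rightarrow> real \<Rightarrow> real \<Rightarrow> bool" where
  "mgf_const \<alpha> \<tau> C \<longleftrightarrow> C \<ge> 1 \<and> (\<forall>P\<in>noise_laws \<alpha> \<tau>. \<forall>e l l' a. e \<noteq> 0 \<longrightarrow> l' \<ge> 0 \<longrightarrow> a \<ge> 0 \<longrightarrow>
    (if \<alpha> < 2 then a * \<tau> * l \<le> 1 else a * \<tau> * l' \<le> 1) \<longrightarrow>
    (\<integral>\<^sup>+x. ennreal (exp (a * clipped e (\<tau> * l') (\<tau> * l) x)) \<partial>P)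
      \<le> ennreal (exp (C * a\<^sup>2 * (e\<^sup>2 * exp (- ((l' / \<bar>e\<bar>) powr \<alpha>))))))"

context loading
begin

text \<open>The sparsity assumption is multiplied by \<open>ls u\<close> so that it also covers u =
  s0 when the threshold is 0 and the support exceeds u. In the constant, the bias gives \<tau>^2,
  the support 1 + 4 and the thresholded noise Cv; the factors 2 split the square.\<close>

lemma threshold_risk:
  fixes u :: nat and P :: "nat \<Rightarrow> real measure"
  assumes Cv: "variance_const \<alpha> \<tau> Cv" and \<tau>: "\<tau> > 0" and \<sigma>: "\<sigma> > 0" and P: "\<And>j. P j \<in> noise_laws \<alpha> \<tau>"
    and u: "u \<ge> 1" "u \<le> s0" and k: "real (card (support d \<theta>)) * ls (real u) \<le> real u * ls (real u)"
  shows "(\<integral>\<^sup>+\<xi>. ennreal ((threshold_est d \<eta> (\<sigma> * (\<tau> * ls (real u))) (observation \<sigma> d \<theta> \<xi>) - lin_functional d \<eta> \<theta>)\<^sup>2) \<partial>Pi\<^sub>M {1..d} P)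
    \<le> ennreal ((2 * \<tau>\<^sup>2 + 2 * (5 + Cv)) * \<sigma>\<^sup>2 * (om u)\<^sup>2)"
proof -
  let ?l = "ls (real u)" and ?S = "support d \<theta>"
  let ?U = "\<lambda>j x. if j \<in> ?S then \<eta> j * x else if \<tau> * ?l < \<bar>\<eta> j * x\<bar> then \<eta> j * x else 0"
  let ?v = "\<lambda>j. if j \<in> ?S then (\<eta> j)\<^sup>2 else Cv * ((\<eta> j)\<^sup>2 * weight ?l j)"
  let ?M = "Pi\<^sub>M {1..d} P"
  interpret M: prob_space ?M using noise_laws_facts(1)[OF P] by (intro prob_space_PiM)
  have Cv1: "Cv \<ge> 1" using Cv by (simp add: variance_const_def)
  have l0: "?l \<ge> 0" by (rule ls_nonneg)
  note omu = om_facts[OF u]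
  have Um: "?U j \<in> borel_measurable borel" for j by measurable
  have Um': "?U j \<in> borel_measurable (P j)" for j
    using Um[of j] by (simp only: measurable_cong_sets[OF noise_laws_facts(2)[OF P] refl])
  have vn: "?v j \<ge> 0" for j using Cv1 weight_pos[of ?l j] by simp
  have second: "(\<integral>\<^sup>+x. ennreal ((?U j x)\<^sup>2) \<partial>P j) \<le> ennreal (?v j)" if j: "j \<in> {1..d}" for j
  proof (cases "j \<in> ?S")
    case True
    have hb: "has_bochner_integral (P j) (\<lambda>x. (\<eta> j)\<^sup>2 * x\<^sup>2) ((\<eta> j)\<^sup>2 * 1)"
      by (rule has_bochner_integral_mult_right[OF noise_laws_facts(4)[OF P]])
    have "(\<integral>\<^sup>+x. ennreal ((\<eta> j)\<^sup>2 * x\<^sup>2) \<partial>P j) = ennreal ((\<eta> j)\<^sup>2 * 1)"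
      using hb by (subst nn_integral_eq_integral) (auto simp: has_bochner_integral_iff)
    then show ?thesis using True by (simp add: power_mult_distrib)
  next
    case False
    have "(\<integral>\<^sup>+x. ennreal ((if \<tau> * ?l < \<bar>\<eta> j * x\<bar> then \<eta> j * x else 0)\<^sup>2) \<partial>P j) \<le> ennreal (Cv * (\<eta> j)\<^sup>2 * exp (- ((?l / \<bar>\<eta> j\<bar>) powr \<alpha>)))"
      using Cv P[of j] nonzero[OF j] l0 unfolding variance_const_def by blast
    then show ?thesis using False by (simp add: weight_def mult.assoc)
  qed
  have Z: "(\<integral>\<^sup>+\<xi>. ennreal ((\<Sum>j=1..d. ?U j (\<xi> j))\<^sup>2) \<partial>?M) \<le> ennreal (\<Sum>j=1..d. ?v j)"
  proof (rule nn_integral_square_sum_PiM)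
    show "prob_space (P j)" "sets (P j) = sets borel" for j using noise_laws_facts(1,2)[OF P] by auto
    show "?U j \<in> borel_measurable borel" for j by (rule Um)
    fix j assume j: "j \<in> {1..d}"
    have sq: "(\<lambda>x. (?U j x)\<^sup>2) \<in> borel_measurable (P j)" using Um' by (rule borel_measurable_power)
    show "integrable (P j) (\<lambda>x. (?U j x)\<^sup>2)"
      by (rule integrable_if_nn_integral_le(1)[OF sq _ second[OF j] vn]) simp
    show "(\<integral>x. (?U j x)\<^sup>2 \<partial>P j) \<le> ?v j"
      by (rule integrable_if_nn_integral_le(2)[OF sq _ second[OF j] vn]) simp
    show "(\<integral>x. ?U j x \<partial>P j) = 0"
      by (rule noise_odd_mean[OF P Um]) simp
  qed simp
  have sumv: "(\<Sum>j=1..d. ?v j) \<le> (5 + Cv) * (om u)\<^sup>2"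
  proof -
    have S: "?S \<subseteq> {1..d}" by (auto simp: support_def)
    have "(\<Sum>j=1..d. ?v j) \<le> (\<Sum>j=1..d. (if j \<in> ?S then (\<eta> j)\<^sup>2 else 0) + Cv * ((\<eta> j)\<^sup>2 * weight ?l j))"
      using Cv1 weight_pos[of ?l] by (intro sum_mono) (auto simp: less_imp_le)
    also have "\<dots> = (\<Sum>j\<in>?S. (\<eta> j)\<^sup>2) + Cv * V ?l"
      using S by (simp add: sum.distrib sum.If_cases Int_absorb1 V_def sum_distrib_left)
    also have "\<dots> \<le> real (card ?S) * ?l\<^sup>2 + 4 * V ?l + Cv * V ?l" using support_energy[OF l0 S] by simp
    also have "real (card ?S) * ?l\<^sup>2 \<le> (om u)\<^sup>2"
    proof -
      have "real (card ?S) * ?l\<^sup>2 = (real (card ?S) * ?l) * ?l" by (simp add: power2_eq_square)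
      also have "\<dots> \<le> (real u * ?l) * ?l" by (rule mult_right_mono[OF k l0])
      also have "\<dots> \<le> om u * om u" using omu l0 u by (intro mult_mono) auto
      finally show ?thesis by (simp add: power2_eq_square)
    qed
    also have "(om u)\<^sup>2 + 4 * V ?l + Cv * V ?l \<le> (om u)\<^sup>2 + 4 * (om u)\<^sup>2 + Cv * (om u)\<^sup>2"
      using omu(6) Cv1 by (intro add_mono mult_left_mono) auto
    finally show ?thesis by (simp add: algebra_simps)
  qed
  have point: "(threshold_est d \<eta> (\<sigma> * (\<tau> * ?l)) (observation \<sigma> d \<theta> \<xi>) - lin_functional d \<eta> \<theta>)\<^sup>2
      \<le> 2 * \<tau>\<^sup>2 * \<sigma>\<^sup>2 * (om u)\<^sup>2 + 2 * \<sigma>\<^sup>2 * (\<Sum>j=1..d. ?U j (\<xi> j))\<^sup>2" for \<xi>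
  proof -
    let ?Z = "\<Sum>j=1..d. ?U j (\<xi> j)"
    have "\<bar>threshold_est d \<eta> (\<sigma> * (\<tau> * ?l)) (observation \<sigma> d \<theta> \<xi>) - lin_functional d \<eta> \<theta>\<bar>
      \<le> real (card ?S) * (\<sigma> * (\<tau> * ?l)) + \<sigma> * \<bar>?Z\<bar>"
      using \<tau> l0 by (intro threshold_est_error[OF \<sigma>]) auto
    also have "real (card ?S) * (\<sigma> * (\<tau> * ?l)) \<le> \<sigma> * \<tau> * om u"
    proof -
      have "real (card ?S) * (\<sigma> * (\<tau> * ?l)) = \<sigma> * \<tau> * (real (card ?S) * ?l)" by (simp add: mult_ac)
      also have "\<dots> \<le> \<sigma> * \<tau> * om u" using k omu(3) \<sigma> \<tau> by (intro mult_left_mono) auto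
      finally show ?thesis .
    qed
    finally have "\<bar>threshold_est d \<eta> (\<sigma> * (\<tau> * ?l)) (observation \<sigma> d \<theta> \<xi>) - lin_functional d \<eta> \<theta>\<bar>
      \<le> \<bar>\<sigma> * \<tau> * om u + \<sigma> * \<bar>?Z\<bar>\<bar>" by linarith
    then have "(threshold_est d \<eta> (\<sigma> * (\<tau> * ?l)) (observation \<sigma> d \<theta> \<xi>) - lin_functional d \<eta> \<theta>)\<^sup>2 \<le> (\<sigma> * \<tau> * om u + \<sigma> * \<bar>?Z\<bar>)\<^sup>2"
      by (simp only: abs_le_square_iff)
    also have "\<dots> \<le> 2 * (\<sigma> * \<tau> * om u)\<^sup>2 + 2 * (\<sigma> * \<bar>?Z\<bar>)\<^sup>2"
      using sum_squares_bound[of "\<sigma> * \<tau> * om u" "\<sigma> * \<bar>?Z\<bar>"] unfolding power2_sum by linarith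
    finally show ?thesis by (simp add: power_mult_distrib mult_ac)
  qed
  have Zm: "(\<lambda>\<xi>. ennreal ((\<Sum>j=1..d. ?U j (\<xi> j))\<^sup>2)) \<in> borel_measurable ?M"
    by (intro measurable_compose[OF _ measurable_ennreal] borel_measurable_power borel_measurable_sum
        component_measurable[OF Um] noise_laws_facts(2)[OF P])
  have "(\<integral>\<^sup>+\<xi>. ennreal ((threshold_est d \<eta> (\<sigma> * (\<tau> * ?l)) (observation \<sigma> d \<theta> \<xi>) - lin_functional d \<eta> \<theta>)\<^sup>2) \<partial>?M)
     \<le> (\<integral>\<^sup>+\<xi>. ennreal (2 * \<tau>\<^sup>2 * \<sigma>\<^sup>2 * (om u)\<^sup>2) + ennreal (2 * \<sigma>\<^sup>2) * ennreal ((\<Sum>j=1..d. ?U j (\<xi> j))\<^sup>2) \<partial>?M)"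
  proof (intro nn_integral_mono)
    fix \<xi>
    show "ennreal ((threshold_est d \<eta> (\<sigma> * (\<tau> * ?l)) (observation \<sigma> d \<theta> \<xi>) - lin_functional d \<eta> \<theta>)\<^sup>2)
      \<le> ennreal (2 * \<tau>\<^sup>2 * \<sigma>\<^sup>2 * (om u)\<^sup>2) + ennreal (2 * \<sigma>\<^sup>2) * ennreal ((\<Sum>j=1..d. ?U j (\<xi> j))\<^sup>2)"
      using ennreal_leI[OF point[of \<xi>]] by (simp add: ennreal_mult)
  qed
  also have "\<dots> = ennreal (2 * \<tau>\<^sup>2 * \<sigma>\<^sup>2 * (om u)\<^sup>2) + ennreal (2 * \<sigma>\<^sup>2) * (\<integral>\<^sup>+\<xi>. ennreal ((\<Sum>j=1..d. ?U j (\<xi> j))\<^sup>2) \<partial>?M)"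
    by (rule M.nn_integral_affine[OF Zm])
  also have "\<dots> \<le> ennreal (2 * \<tau>\<^sup>2 * \<sigma>\<^sup>2 * (om u)\<^sup>2) + ennreal (2 * \<sigma>\<^sup>2) * ennreal ((5 + Cv) * (om u)\<^sup>2)"
    using Z sumv by (intro add_left_mono mult_left_mono) (auto intro: order_trans[OF _ ennreal_leI])
  also have "\<dots> = ennreal (2 * \<tau>\<^sup>2 * \<sigma>\<^sup>2 * (om u)\<^sup>2 + 2 * \<sigma>\<^sup>2 * ((5 + Cv) * (om u)\<^sup>2))"
    using Cv1 by (simp add: ennreal_mult)
  also have "2 * \<tau>\<^sup>2 * \<sigma>\<^sup>2 * (om u)\<^sup>2 + 2 * \<sigma>\<^sup>2 * ((5 + Cv) * (om u)\<^sup>2) = (2 * \<tau>\<^sup>2 + 2 * (5 + Cv)) * \<sigma>\<^sup>2 * (om u)\<^sup>2"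
    by (simp add: algebra_simps)
  finally show ?thesis .
qed

text \<open>Exponential Markov inequality at a slope proportional to elog v. Beyond the penalty a
  factor v^(-4) remains. Two powers pay for the quadratic growth of the rate from u to v, and the
  other two make the bounds summable over v.\<close>

lemma threshold_deviation:
  fixes u v :: nat and P :: "nat \<Rightarrow> real measure"
  assumes Cm: "mgf_const \<alpha> \<tau> Cm" and \<tau>: "\<tau> > 0" and \<sigma>: "\<sigma> > 0" and P: "\<And>j. P j \<in> noise_laws \<alpha> \<tau>"
    and u: "u \<ge> 1" "u \<le> v" "v \<le> s0" and k: "real (card (support d \<theta>)) * ls (real u) \<le> real u * ls (real u)"
  defines "K \<equiv> 8 * Ko * \<tau> + (Cm / \<tau> + 4 * \<tau>)"
  shows "(\<integral>\<^sup>+\<xi>. ennreal ((max 0 (\<bar>threshold_est d \<eta> (\<sigma> * (\<tau> * ls (real u))) (observation \<sigma> d \<theta> \<xi>)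
        - threshold_est d \<eta> (\<sigma> * (\<tau> * ls (real v))) (observation \<sigma> d \<theta> \<xi>)\<bar> - \<sigma> * K * om v))\<^sup>2) \<partial>Pi\<^sub>M {1..d} P)
    \<le> ennreal (32 * \<sigma>\<^sup>2 * \<tau>\<^sup>2 * (om u)\<^sup>2 * (1 / (real v)\<^sup>2))"
proof -
  let ?l = "ls (real u)" and ?l' = "ls (real v)" and ?S = "support d \<theta>" and ?M = "Pi\<^sub>M {1..d} P"
  \<comment> \<open>Multiplied by a \<open>om v\<close>, the first summand cancels the exponential
    moment, and the second leaves exp(-4 elog v).\<close>
  define K2 where "K2 = Cm / \<tau> + 4 * \<tau>"
  have Cm1: "Cm \<ge> 1" using Cm by (simp add: mgf_const_def)
  have v: "v \<ge> 1" "v \<le> s0" using u by auto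
  have u': "u \<le> s0" using u by simp
  note omv = om_facts[OF v] and omu = om_facts[OF u(1) u']
  have ll: "?l' \<le> ?l" using u by (intro ls_antimono) auto
  have l0: "?l \<ge> 0" "?l' \<ge> 0" by (rule ls_nonneg)+
  have lg: "elog (real v) \<ge> 1" using v by (intro elog_ge_1) auto
  \<comment> \<open>This slope is admissible in \<open>mgf_const\<close>: for \<alpha> < 2 because
    \<open>om v\<close> dominates \<open>ls 1 * elog v\<close>, for \<alpha> \<ge> 2 because it
    dominates v \<open>ls v\<close> and elog v \<le> v.\<close>
  define a where "a = elog (real v) / (\<tau> * om v)"
  have a: "a > 0" using lg \<tau> omv(1) by (simp add: a_def)
  have a\<tau>: "a * \<tau> * x = elog (real v) * x / om v" for x using \<tau> omv(1) by (simp add: a_def)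
  have cond: "if \<alpha> < 2 then a * \<tau> * ?l \<le> 1 else a * \<tau> * ?l' \<le> 1"
  proof (cases "\<alpha> < 2")
    case True
    have "elog (real v) * ?l \<le> elog (real v) * ls 1" using lg ls_antimono[of 1 "real u"] u by (intro mult_left_mono) auto
    also have "\<dots> \<le> om v" using omv(7)[OF True] by (simp add: mult.commute)
    finally show ?thesis using True omv(1) by (simp add: a\<tau> divide_le_eq_1)
  next
    case False
    have "elog (real v) * ?l' \<le> real v * ?l'" using elog_le[of "real v"] v l0 by (intro mult_right_mono) auto
    also have "\<dots> \<le> om v" by (rule omv(3))
    finally show ?thesis using False omv(1) by (simp add: a\<tau> divide_le_eq_1)
  qed
  let ?U = "\<lambda>j x. if j \<in> ?S then 0 else clipped (\<eta> j) (\<tau> * ?l') (\<tau> * ?l) x"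
  have Um: "?U j \<in> borel_measurable borel" for j by measurable
  have mgf: "(\<integral>\<^sup>+\<xi>. ennreal (exp (\<Sum>j=1..d. e * a * ?U j (\<xi> j))) \<partial>?M) \<le> ennreal (exp (Cm / \<tau>\<^sup>2 * elog (real v)))"
    if e: "e = 1 \<or> e = -1" for e :: real
  proof -
    have "(\<integral>\<^sup>+\<xi>. ennreal (exp (\<Sum>j=1..d. e * a * ?U j (\<xi> j))) \<partial>?M) \<le> ennreal (exp (\<Sum>j=1..d. Cm * a\<^sup>2 * ((\<eta> j)\<^sup>2 * weight ?l' j)))"
    proof (rule nn_integral_exp_sum_PiM)
      show "prob_space (P j)" "sets (P j) = sets borel" for j using noise_laws_facts(1,2)[OF P] by auto
      show "(\<lambda>x. e * a * ?U j x) \<in> borel_measurable borel" for j using Um[of j] by (intro borel_measurable_times) auto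
      fix j assume j: "j \<in> {1..d}"
      show "(\<integral>\<^sup>+x. ennreal (exp (e * a * ?U j x)) \<partial>P j) \<le> ennreal (exp (Cm * a\<^sup>2 * ((\<eta> j)\<^sup>2 * weight ?l' j)))"
      proof (cases "j \<in> ?S")
        case True
        have "0 \<le> Cm * a\<^sup>2 * ((\<eta> j)\<^sup>2 * weight ?l' j)" using Cm1 weight_pos[of ?l' j] by simp
        then show ?thesis using True prob_space.emeasure_space_1[OF noise_laws_facts(1)[OF P]] by simp
      next
        case False
        have "e * \<eta> j \<noteq> 0" using nonzero[OF j] e by auto
        then have "(\<integral>\<^sup>+x. ennreal (exp (a * clipped (e * \<eta> j) (\<tau> * ?l') (\<tau> * ?l) x)) \<partial>P j)
            \<le> ennreal (exp (Cm * a\<^sup>2 * ((e * \<eta> j)\<^sup>2 * exp (- ((?l' / \<bar>e * \<eta> j\<bar>) powr \<alpha>)))))"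
          using Cm P[of j] l0 a cond unfolding mgf_const_def by (meson less_imp_le)
        moreover have "clipped (e * \<eta> j) (\<tau> * ?l') (\<tau> * ?l) x = e * clipped (\<eta> j) (\<tau> * ?l') (\<tau> * ?l) x" for x
          using e by (auto simp: clipped_uminus')
        moreover have "(e * \<eta> j)\<^sup>2 = (\<eta> j)\<^sup>2" "\<bar>e * \<eta> j\<bar> = \<bar>\<eta> j\<bar>" using e by (auto simp: power_mult_distrib)
        ultimately show ?thesis using False by (simp add: weight_def mult_ac)
      qed
    qed simp
    also have "(\<Sum>j=1..d. Cm * a\<^sup>2 * ((\<eta> j)\<^sup>2 * weight ?l' j)) = Cm * (a\<^sup>2 * V ?l')"
      by (simp add: V_def sum_distrib_left mult.assoc)
    also have "ennreal (exp (Cm * (a\<^sup>2 * V ?l'))) \<le> ennreal (exp (Cm / \<tau>\<^sup>2 * elog (real v)))"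
    proof (intro ennreal_leI, subst exp_le_cancel_iff)
      have "a\<^sup>2 * V ?l' = elog (real v) * (elog (real v) * V ?l') / (\<tau>\<^sup>2 * (om v)\<^sup>2)"
        by (simp add: a_def power2_eq_square mult_ac)
      also have "\<dots> \<le> elog (real v) * (om v)\<^sup>2 / (\<tau>\<^sup>2 * (om v)\<^sup>2)"
        using omv(5) lg by (intro divide_right_mono mult_left_mono) auto
      also have "\<dots> = elog (real v) / \<tau>\<^sup>2" using omv(1) by simp
      finally have "Cm * (a\<^sup>2 * V ?l') \<le> Cm * (elog (real v) / \<tau>\<^sup>2)" using Cm1 by (intro mult_left_mono) auto
      then show "Cm * (a\<^sup>2 * V ?l') \<le> Cm / \<tau>\<^sup>2 * elog (real v)" by simp
    qed
    finally show ?thesis .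
  qed
  define Z where "Z \<xi> = (\<Sum>j=1..d. ?U j (\<xi> j))" for \<xi>
  have Zm: "Z \<in> borel_measurable ?M"
    unfolding Z_def by (intro borel_measurable_sum component_measurable[OF Um] noise_laws_facts(2)[OF P])
  have mgfZ: "(\<integral>\<^sup>+\<xi>. ennreal (exp (e * a * Z \<xi>)) \<partial>?M) \<le> ennreal (exp (Cm / \<tau>\<^sup>2 * elog (real v)))"
    if e: "e = 1 \<or> e = -1" for e :: real
    using mgf[OF e] by (simp only: Z_def sum_distrib_left)
  define c where "c = 2 * \<sigma>\<^sup>2 / a\<^sup>2 * exp (- (a * K2 * om v))"
  have c0: "c \<ge> 0" by (simp add: c_def)
  have point: "(max 0 (\<bar>threshold_est d \<eta> (\<sigma> * (\<tau> * ?l)) (observation \<sigma> d \<theta> \<xi>)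
        - threshold_est d \<eta> (\<sigma> * (\<tau> * ?l')) (observation \<sigma> d \<theta> \<xi>)\<bar> - \<sigma> * K * om v))\<^sup>2
      \<le> c * (exp (1 * a * Z \<xi>) + exp (- 1 * a * Z \<xi>))" for \<xi>
  proof -
    let ?D = "\<bar>threshold_est d \<eta> (\<sigma> * (\<tau> * ?l)) (observation \<sigma> d \<theta> \<xi>) - threshold_est d \<eta> (\<sigma> * (\<tau> * ?l')) (observation \<sigma> d \<theta> \<xi>)\<bar>"
    have "?D \<le> real (card ?S) * (\<sigma> * (\<tau> * ?l)) + \<sigma> * \<bar>Z \<xi>\<bar>"
      unfolding Z_def using \<tau> l0 ll by (intro threshold_est_diff[OF \<sigma>]) auto
    also have "real (card ?S) * (\<sigma> * (\<tau> * ?l)) = \<sigma> * \<tau> * (real (card ?S) * ?l)" by (simp add: mult_ac)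
    also have "\<sigma> * \<tau> * (real (card ?S) * ?l) \<le> \<sigma> * \<tau> * (8 * Ko * om v)"
    proof (intro mult_left_mono)
      have "real (card ?S) * ?l \<le> real u * ?l" by (rule k)
      also have "\<dots> \<le> 4 * Ko * G (real v)" using u by (intro ls_le_G) auto
      also have "\<dots> \<le> 4 * Ko * (2 * om v)" using omv(8) Ko_ge_1 by (intro mult_left_mono) auto
      finally show "real (card ?S) * ?l \<le> 8 * Ko * om v" by simp
    qed (use \<sigma> \<tau> in auto)
    finally have "?D - \<sigma> * K * om v \<le> \<sigma> * (\<bar>Z \<xi>\<bar> - K2 * om v)" by (simp add: K_def K2_def algebra_simps)
    then have "max 0 (?D - \<sigma> * K * om v) \<le> \<sigma> * max 0 (\<bar>Z \<xi>\<bar> - K2 * om v)"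
    proof -
      have "\<sigma> * (\<bar>Z \<xi>\<bar> - K2 * om v) \<le> \<sigma> * max 0 (\<bar>Z \<xi>\<bar> - K2 * om v)" using \<sigma> by (intro mult_left_mono) auto
      moreover have "0 \<le> \<sigma> * max 0 (\<bar>Z \<xi>\<bar> - K2 * om v)" using \<sigma> by simp
      ultimately show ?thesis using \<open>?D - \<sigma> * K * om v \<le> \<sigma> * (\<bar>Z \<xi>\<bar> - K2 * om v)\<close> by linarith
    qed
    then have "(max 0 (?D - \<sigma> * K * om v))\<^sup>2 \<le> (\<sigma> * max 0 (\<bar>Z \<xi>\<bar> - K2 * om v))\<^sup>2" by (intro power_mono) auto
    also have "\<dots> = \<sigma>\<^sup>2 * (max 0 (\<bar>Z \<xi>\<bar> - K2 * om v))\<^sup>2" by (rule power_mult_distrib)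
    also have "\<dots> \<le> \<sigma>\<^sup>2 * (2 / a\<^sup>2 * exp (a * (\<bar>Z \<xi>\<bar> - K2 * om v)))"
      by (intro mult_left_mono positive_part_square_le_exp a) auto
    also have "exp (a * (\<bar>Z \<xi>\<bar> - K2 * om v)) = exp (- (a * K2 * om v)) * exp (a * \<bar>Z \<xi>\<bar>)"
      unfolding exp_add[symmetric] by (simp add: algebra_simps)
    also have "exp (a * \<bar>Z \<xi>\<bar>) \<le> exp (1 * a * Z \<xi>) + exp (- 1 * a * Z \<xi>)"
      by (cases "Z \<xi> \<ge> 0") (auto simp: add_increasing add_increasing2)
    finally have "(max 0 (?D - \<sigma> * K * om v))\<^sup>2
        \<le> \<sigma>\<^sup>2 * (2 / a\<^sup>2 * (exp (- (a * K2 * om v)) * (exp (1 * a * Z \<xi>) + exp (- 1 * a * Z \<xi>))))"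
      by (simp add: mult_left_mono divide_right_mono)
    then show ?thesis by (simp add: c_def mult_ac)
  qed
  have em: "(\<lambda>\<xi>. ennreal (exp (e * a * Z \<xi>))) \<in> borel_measurable ?M" for e
    using Zm by (intro measurable_compose[OF _ measurable_ennreal] borel_measurable_exp borel_measurable_times) auto
  have "(\<integral>\<^sup>+\<xi>. ennreal ((max 0 (\<bar>threshold_est d \<eta> (\<sigma> * (\<tau> * ?l)) (observation \<sigma> d \<theta> \<xi>)
        - threshold_est d \<eta> (\<sigma> * (\<tau> * ?l')) (observation \<sigma> d \<theta> \<xi>)\<bar> - \<sigma> * K * om v))\<^sup>2) \<partial>?M)
      \<le> (\<integral>\<^sup>+\<xi>. ennreal c * (ennreal (exp (1 * a * Z \<xi>)) + ennreal (exp (- 1 * a * Z \<xi>))) \<partial>?M)"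
  proof (intro nn_integral_mono)
    fix \<xi>
    have "ennreal c * (ennreal (exp (1 * a * Z \<xi>)) + ennreal (exp (- 1 * a * Z \<xi>))) = ennreal (c * (exp (1 * a * Z \<xi>) + exp (- 1 * a * Z \<xi>)))"
      using c0 by (subst ennreal_mult) auto
    then show "ennreal ((max 0 (\<bar>threshold_est d \<eta> (\<sigma> * (\<tau> * ?l)) (observation \<sigma> d \<theta> \<xi>)
        - threshold_est d \<eta> (\<sigma> * (\<tau> * ?l')) (observation \<sigma> d \<theta> \<xi>)\<bar> - \<sigma> * K * om v))\<^sup>2)
       \<le> ennreal c * (ennreal (exp (1 * a * Z \<xi>)) + ennreal (exp (- 1 * a * Z \<xi>)))"
      using ennreal_leI[OF point[of \<xi>]] by simp
  qed
  also have "\<dots> = ennreal c * ((\<integral>\<^sup>+\<xi>. ennreal (exp (1 * a * Z \<xi>)) \<partial>?M) + (\<integral>\<^sup>+\<xi>. ennreal (exp (- 1 * a * Z \<xi>)) \<partial>?M))"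
    using em[of 1] em[of "-1"] by (subst nn_integral_cmult) (auto simp: nn_integral_add)
  also have "\<dots> \<le> ennreal c * (ennreal (exp (Cm / \<tau>\<^sup>2 * elog (real v))) + ennreal (exp (Cm / \<tau>\<^sup>2 * elog (real v))))"
    by (intro mult_left_mono add_mono mgfZ) auto
  also have "\<dots> = ennreal (c * (2 * exp (Cm / \<tau>\<^sup>2 * elog (real v))))"
    using c0 by (subst ennreal_plus[symmetric]) (auto simp: ennreal_mult simp del: ennreal_plus)
  also have "\<dots> \<le> ennreal (32 * \<sigma>\<^sup>2 * \<tau>\<^sup>2 * (om u)\<^sup>2 * (1 / (real v)\<^sup>2))"
  proof (intro ennreal_leI)
    have aK: "a * K2 * om v = (Cm / \<tau>\<^sup>2 + 4) * elog (real v)"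
      using omv(1) \<tau> by (simp add: a_def K2_def field_simps power2_eq_square)
    have "c * (2 * exp (Cm / \<tau>\<^sup>2 * elog (real v))) = 4 * \<sigma>\<^sup>2 / a\<^sup>2 * (exp (- (a * K2 * om v)) * exp (Cm / \<tau>\<^sup>2 * elog (real v)))"
      by (simp add: c_def)
    also have "exp (- (a * K2 * om v)) * exp (Cm / \<tau>\<^sup>2 * elog (real v)) = exp (- (4 * elog (real v)))"
      unfolding exp_add[symmetric] aK by (simp add: algebra_simps)
    also have "4 * \<sigma>\<^sup>2 / a\<^sup>2 * exp (- (4 * elog (real v))) \<le> 4 * \<sigma>\<^sup>2 * \<tau>\<^sup>2 * (om v)\<^sup>2 * (1 / (real v) ^ 4)"
    proof (intro mult_mono)
      have "1 / a \<le> \<tau> * om v" using lg \<tau> omv(1) by (simp add: a_def field_simps)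
      then have "(1 / a)\<^sup>2 \<le> (\<tau> * om v)\<^sup>2" using a by (intro power_mono) auto
      then have "4 * \<sigma>\<^sup>2 * (1 / a)\<^sup>2 \<le> 4 * \<sigma>\<^sup>2 * (\<tau> * om v)\<^sup>2" by (intro mult_left_mono) auto
      then show "4 * \<sigma>\<^sup>2 / a\<^sup>2 \<le> 4 * \<sigma>\<^sup>2 * \<tau>\<^sup>2 * (om v)\<^sup>2" by (simp add: power_divide power_mult_distrib)
      have "ln (real v) * 4 \<le> 4 * elog (real v)" using v by (simp add: elog_eq)
      then have "exp (- (4 * elog (real v))) \<le> exp (- (ln (real v) * 4))" by simp
      also have "\<dots> = 1 / (real v) ^ 4"
        using v by (simp add: exp_minus divide_inverse mult.commute[of _ 4] exp_of_nat_mult[of 4, simplified])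
      finally show "exp (- (4 * elog (real v))) \<le> 1 / (real v) ^ 4" .
    qed auto
    also have "\<dots> \<le> 4 * \<sigma>\<^sup>2 * \<tau>\<^sup>2 * (8 * (real v)\<^sup>2 * (om u)\<^sup>2) * (1 / (real v) ^ 4)"
    proof (intro mult_right_mono mult_left_mono)
      have "(om v)\<^sup>2 \<le> 8 * (real v / real u)\<^sup>2 * (om u)\<^sup>2"
        unfolding omv(2) omu(2) using u by (intro Phi_adp_growth) auto
      also have "\<dots> \<le> 8 * (real v)\<^sup>2 * (om u)\<^sup>2"
      proof (intro mult_right_mono mult_left_mono power_mono)
        show "real v / real u \<le> real v" using u(1) by (simp add: divide_le_eq mult_le_cancel_left1)
      qed auto
      finally show "(om v)\<^sup>2 \<le> 8 * (real v)\<^sup>2 * (om u)\<^sup>2" .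
    qed auto
    also have "\<dots> = 32 * \<sigma>\<^sup>2 * \<tau>\<^sup>2 * (om u)\<^sup>2 * (1 / (real v)\<^sup>2)"
      using v by (simp add: field_simps power2_eq_square power4_eq_xxxx)
    finally show "c * (2 * exp (Cm / \<tau>\<^sup>2 * elog (real v))) \<le> 32 * \<sigma>\<^sup>2 * \<tau>\<^sup>2 * (om u)\<^sup>2 * (1 / (real v)\<^sup>2)" .
  qed
  finally show ?thesis .
qed

end

section \<open>The adaptive rate\<close>

context loading
begin

lemma lepski_upper_bound:
  assumes Cv: "variance_const \<alpha> \<tau> Cv" and Cm: "mgf_const \<alpha> \<tau> Cm" and \<tau>: "\<tau> > 0" and \<sigma>: "\<sigma> > 0"
  defines "C \<equiv> 3 * (2 * \<tau>\<^sup>2 + 2 * (5 + Cv)) + 768 * \<tau>\<^sup>2 + 12 * (8 * Ko * \<tau> + (Cm / \<tau> + 4 * \<tau>))\<^sup>2"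
  shows "\<exists>T\<in>estimators d. \<forall>s\<in>{1..d}. risk_le \<alpha> \<tau> \<sigma> d \<eta> T s (C * (\<sigma>\<^sup>2 * Phi_adp \<alpha> d \<eta> (real s)))"
proof -
  \<comment> \<open>Levels above s0 are left out: the rate is constant from s0 on, so s0 stands for
    all of them.\<close>
  define n where "n = min d s0"
  define K where "K = 8 * Ko * \<tau> + (Cm / \<tau> + 4 * \<tau>)"
  define F where "F u = threshold_est d \<eta> (\<sigma> * (\<tau> * ls (real u)))" for u :: nat
  define w where "w v = \<sigma> * K * om v" for v
  define T where "T y = F (lepski_index n F w y) y" for y
  have Cv1: "Cv \<ge> 1" and Cm1: "Cm \<ge> 1" using Cv Cm by (auto simp: variance_const_def mgf_const_def)
  have n: "n \<ge> 1" "n \<le> d" "n \<le> s0" using d_pos s_zero_bounds by (auto simp: n_def)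
  have K0: "K \<ge> 0" using Ko_ge_1 \<tau> Cm1 by (simp add: K_def)
  have w0: "0 \<le> w v" if "v \<in> {1..n}" for v
    using K0 \<sigma> om_facts(1)[of v] that n by (auto simp: w_def intro!: mult_nonneg_nonneg less_imp_le)
  have Fm: "F u \<in> borel_measurable (Pi\<^sub>M {1..d} (\<lambda>_. borel))" for u
    unfolding F_def by (rule threshold_est_measurable)
  have T: "T \<in> estimators d"
    unfolding T_def[abs_def] estimators_def by (rule lepski_measurable(2)[OF Fm n(1)])
  have "risk \<sigma> d \<eta> T \<theta> M \<le> ennreal (C * (\<sigma>\<^sup>2 * Phi_adp \<alpha> d \<eta> (real s)))"
    if s: "s \<in> {1..d}" and \<theta>: "\<theta> \<in> sparse_class d s" and M: "M \<in> noise_products \<alpha> \<tau> d" for s \<theta> M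
  proof -
    obtain P where MP: "M = Pi\<^sub>M {1..d} P" and P: "\<And>j. P j \<in> noise_laws \<alpha> \<tau>"
      using noise_products_cases[OF M d_pos] by blast
    define u where "u = min s n"
    have u: "u \<ge> 1" "u \<le> n" "u \<le> s0" using s n by (auto simp: u_def)
    have uin: "u \<in> {1..n}" using u by simp
    have card: "card (support d \<theta>) \<le> s" using \<theta> by (simp add: sparse_class_def support_def)
    have k: "real (card (support d \<theta>)) * ls (real u) \<le> real u * ls (real u)"
    proof (cases "s \<le> n")
      case True
      then show ?thesis using card ls_nonneg[of "real u"] by (intro mult_right_mono) (auto simp: u_def)
    next
      case False
      \<comment> \<open>Here the threshold is 0, so the bias bound vanishes however large the
        support is.\<close>
      then have "s0 \<le> d" "u = s0" using s by (auto simp: n_def u_def)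
      then show ?thesis using ls_s_zero by simp
    qed
    have om_s: "(om u)\<^sup>2 = Phi_adp \<alpha> d \<eta> (real s)"
    proof (cases "s \<le> n")
      case True
      then show ?thesis using om_facts(2)[OF u(1,3)] by (simp add: u_def)
    next
      case False
      then have "u = s0" "s0 \<le> s" using s by (auto simp: n_def u_def)
      then show ?thesis using om_facts(2)[OF u(1,3)] Phi_adp_saturates[of "real s"] by simp
    qed
    interpret M: prob_space M unfolding MP using noise_laws_facts(1)[OF P] by (intro prob_space_PiM)
    let ?o = "observation \<sigma> d \<theta>" and ?L = "lin_functional d \<eta> \<theta>"
    have om_: "?o \<in> measurable M (Pi\<^sub>M {1..d} (\<lambda>_. borel))"
      unfolding MP by (rule observation_measurable[OF noise_laws_facts(2)[OF P]])
    have FM: "(\<lambda>\<xi>. F v (?o \<xi>)) \<in> borel_measurable M" for v by (rule measurable_compose[OF om_ Fm])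
    define X where "X \<xi> = ennreal ((F u (?o \<xi>) - ?L)\<^sup>2)" for \<xi>
    define g where "g v \<xi> = ennreal ((max 0 (\<bar>F u (?o \<xi>) - F v (?o \<xi>)\<bar> - w v))\<^sup>2)" for v \<xi>
    have Xm: "X \<in> borel_measurable M" unfolding X_def[abs_def]
      by (intro measurable_compose[OF _ measurable_ennreal] borel_measurable_power borel_measurable_diff FM borel_measurable_const)
    have gm: "g v \<in> borel_measurable M" for v unfolding g_def[abs_def]
      by (intro measurable_compose[OF _ measurable_ennreal] borel_measurable_power borel_measurable_diff
          borel_measurable_max borel_measurable_abs FM borel_measurable_const)
    have intX: "(\<integral>\<^sup>+\<xi>. X \<xi> \<partial>M) \<le> ennreal ((2 * \<tau>\<^sup>2 + 2 * (5 + Cv)) * \<sigma>\<^sup>2 * (om u)\<^sup>2)"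
      unfolding X_def F_def MP by (rule threshold_risk[OF Cv \<tau> \<sigma> P u(1,3) k])
    have intg: "(\<integral>\<^sup>+\<xi>. g v \<xi> \<partial>M) \<le> ennreal (32 * \<sigma>\<^sup>2 * \<tau>\<^sup>2 * (om u)\<^sup>2 * (1 / (real v)\<^sup>2))" if "v \<in> {u..n}" for v
      unfolding g_def F_def MP w_def K_def using that n by (intro threshold_deviation[OF Cm \<tau> \<sigma> P u(1) _ _ k]) auto
    have point: "ennreal ((T (?o \<xi>) - ?L)\<^sup>2) \<le> ennreal (12 * (w u)\<^sup>2) + ennreal 1 * (3 * X \<xi> + 12 * (\<Sum>v=u..n. g v \<xi>))" for \<xi>
    proof -
      let ?B = "lepski_excess n F w u (?o \<xi>)"
      have "\<bar>T (?o \<xi>) - ?L\<bar> \<le> \<bar>\<bar>F u (?o \<xi>) - ?L\<bar> + 2 * ?B + 2 * w u\<bar>"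
        using lepski_oracle[where F = F and w = w and y = "?o \<xi>" and L = ?L, OF uin w0] unfolding T_def by linarith
      then have "(T (?o \<xi>) - ?L)\<^sup>2 \<le> (\<bar>F u (?o \<xi>) - ?L\<bar> + 2 * ?B + 2 * w u)\<^sup>2" by (simp only: abs_le_square_iff)
      also have "\<dots> \<le> 3 * \<bar>F u (?o \<xi>) - ?L\<bar>\<^sup>2 + 12 * ?B\<^sup>2 + 12 * (w u)\<^sup>2" by (rule square_sum3_le)
      also have "?B\<^sup>2 \<le> (\<Sum>v=u..n. (max 0 (\<bar>F u (?o \<xi>) - F v (?o \<xi>)\<bar> - w v))\<^sup>2)"
        by (rule lepski_excess_square[OF u(2)])
      finally have "(T (?o \<xi>) - ?L)\<^sup>2 \<le> 12 * (w u)\<^sup>2 + (3 * (F u (?o \<xi>) - ?L)\<^sup>2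
          + 12 * (\<Sum>v=u..n. (max 0 (\<bar>F u (?o \<xi>) - F v (?o \<xi>)\<bar> - w v))\<^sup>2))" by simp
      then have "ennreal ((T (?o \<xi>) - ?L)\<^sup>2) \<le> ennreal (12 * (w u)\<^sup>2 + (3 * (F u (?o \<xi>) - ?L)\<^sup>2
          + 12 * (\<Sum>v=u..n. (max 0 (\<bar>F u (?o \<xi>) - F v (?o \<xi>)\<bar> - w v))\<^sup>2)))" by (rule ennreal_leI)
      also have "\<dots> = ennreal (12 * (w u)\<^sup>2) + ennreal 1 * (3 * X \<xi> + 12 * (\<Sum>v=u..n. g v \<xi>))"
        by (simp add: X_def g_def ennreal_mult sum_nonneg)
      finally show ?thesis .
    qed
    have "risk \<sigma> d \<eta> T \<theta> M \<le> (\<integral>\<^sup>+\<xi>. ennreal (12 * (w u)\<^sup>2) + ennreal 1 * (3 * X \<xi> + 12 * (\<Sum>v=u..n. g v \<xi>)) \<partial>M)"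
      unfolding risk_def by (intro nn_integral_mono point)
    also have "\<dots> = ennreal (12 * (w u)\<^sup>2) + ennreal 1 * (\<integral>\<^sup>+\<xi>. 3 * X \<xi> + 12 * (\<Sum>v=u..n. g v \<xi>) \<partial>M)"
      by (intro M.nn_integral_affine borel_measurable_add borel_measurable_times_ennreal borel_measurable_sum Xm gm borel_measurable_const)
    also have "(\<integral>\<^sup>+\<xi>. 3 * X \<xi> + 12 * (\<Sum>v=u..n. g v \<xi>) \<partial>M) = 3 * (\<integral>\<^sup>+\<xi>. X \<xi> \<partial>M) + 12 * (\<Sum>v=u..n. \<integral>\<^sup>+\<xi>. g v \<xi> \<partial>M)"
      using Xm gm by (simp add: nn_integral_add nn_integral_cmult nn_integral_sum)
    also have "ennreal (12 * (w u)\<^sup>2) + ennreal 1 * (3 * (\<integral>\<^sup>+\<xi>. X \<xi> \<partial>M) + 12 * (\<Sum>v=u..n. \<integral>\<^sup>+\<xi>. g v \<xi> \<partial>M))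
      \<le> ennreal (12 * (w u)\<^sup>2) + ennreal 1 * (3 * ennreal ((2 * \<tau>\<^sup>2 + 2 * (5 + Cv)) * \<sigma>\<^sup>2 * (om u)\<^sup>2)
          + 12 * (\<Sum>v=u..n. ennreal (32 * \<sigma>\<^sup>2 * \<tau>\<^sup>2 * (om u)\<^sup>2 * (1 / (real v)\<^sup>2))))"
      by (intro add_left_mono mult_left_mono add_mono sum_mono intX intg) auto
    also have "\<dots> = ennreal (12 * (w u)\<^sup>2 + (3 * ((2 * \<tau>\<^sup>2 + 2 * (5 + Cv)) * \<sigma>\<^sup>2 * (om u)\<^sup>2)
          + 12 * (\<Sum>v=u..n. 32 * \<sigma>\<^sup>2 * \<tau>\<^sup>2 * (om u)\<^sup>2 * (1 / (real v)\<^sup>2))))"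
      using Cv1 by (simp add: ennreal_mult sum_nonneg)
    also have "\<dots> \<le> ennreal (C * (\<sigma>\<^sup>2 * (om u)\<^sup>2))"
    proof (intro ennreal_leI)
      \<comment> \<open>The deviations from all larger levels add up to at most twice their common
        factor; 768 = 12 * 32 * 2.\<close>
      have "(\<Sum>v=u..n. 1 / (real v)\<^sup>2) \<le> (\<Sum>v=1..n. 1 / (real v)\<^sup>2)"
        using u by (intro sum_mono2) auto
      also have "\<dots> \<le> 2 - 1 / real n" by (rule sum_inverse_squares_le[OF n(1)])
      also have "\<dots> \<le> 2" by simp
      finally have "(32 * \<sigma>\<^sup>2 * \<tau>\<^sup>2 * (om u)\<^sup>2) * (\<Sum>v=u..n. 1 / (real v)\<^sup>2) \<le> (32 * \<sigma>\<^sup>2 * \<tau>\<^sup>2 * (om u)\<^sup>2) * 2"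
        by (intro mult_left_mono) auto
      then have "(\<Sum>v=u..n. 32 * \<sigma>\<^sup>2 * \<tau>\<^sup>2 * (om u)\<^sup>2 * (1 / (real v)\<^sup>2)) \<le> 64 * (\<sigma>\<^sup>2 * \<tau>\<^sup>2 * (om u)\<^sup>2)"
        by (simp add: sum_distrib_left)
      moreover have "C * (\<sigma>\<^sup>2 * (om u)\<^sup>2) = 12 * (w u)\<^sup>2 + (3 * ((2 * \<tau>\<^sup>2 + 2 * (5 + Cv)) * \<sigma>\<^sup>2 * (om u)\<^sup>2)
          + 12 * (64 * (\<sigma>\<^sup>2 * \<tau>\<^sup>2 * (om u)\<^sup>2)))"
      proof -
        have "C = 3 * (2 * \<tau>\<^sup>2 + 2 * (5 + Cv)) + 768 * \<tau>\<^sup>2 + 12 * K\<^sup>2" by (simp only: C_def K_def)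
        then show ?thesis by (simp add: w_def power_mult_distrib algebra_simps)
      qed
      ultimately show "12 * (w u)\<^sup>2 + (3 * ((2 * \<tau>\<^sup>2 + 2 * (5 + Cv)) * \<sigma>\<^sup>2 * (om u)\<^sup>2)
          + 12 * (\<Sum>v=u..n. 32 * \<sigma>\<^sup>2 * \<tau>\<^sup>2 * (om u)\<^sup>2 * (1 / (real v)\<^sup>2))) \<le> C * (\<sigma>\<^sup>2 * (om u)\<^sup>2)"
        by linarith
    qed
    finally show ?thesis by (simp only: om_s)
  qed
  then show ?thesis using T unfolding risk_le_def by blast
qed

end

section \<open>The price of beating the rate\<close>

lemma adaptive_lower_boundD:
  assumes "adaptive_lower_bound \<alpha> \<tau>0 c B" "\<tau> \<ge> \<tau>0" "loading \<alpha> d \<eta>" "\<sigma> > 0" "T \<in> estimators d"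
  shows "s \<ge> 1 \<Longrightarrow> R \<ge> 0 \<Longrightarrow> risk_le \<alpha> \<tau> \<sigma> d \<eta> T s R \<Longrightarrow> c * \<sigma>\<^sup>2 * Phi_o \<alpha> d \<eta> (real s) \<le> R"
    and "1 \<le> m \<Longrightarrow> m < s_zero \<alpha> d \<eta> \<Longrightarrow> 0 < \<kappa> \<Longrightarrow> \<kappa> \<le> 1 \<Longrightarrow> 8 * elog (real m) \<le> real m
         \<Longrightarrow> 24 * elog (real m) * loading.G \<alpha> d \<eta> 1 \<le> loading.G \<alpha> d \<eta> (real m) \<Longrightarrow> R \<ge> 0 \<Longrightarrow> R1 \<ge> 0
         \<Longrightarrow> risk_le \<alpha> \<tau> \<sigma> d \<eta> T m R \<Longrightarrow> risk_le \<alpha> \<tau> \<sigma> d \<eta> T 1 R1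
         \<Longrightarrow> c * \<sigma> * \<kappa> * loading.G \<alpha> d \<eta> (real m) \<le> sqrt R + sqrt R1 * exp (B * \<kappa>\<^sup>2 * elog (real m))"
proof -
  note H = assms(1)[unfolded adaptive_lower_bound_def, THEN spec, THEN spec, THEN spec, THEN spec, THEN spec,
      THEN mp, THEN mp, THEN mp, THEN mp, OF assms(2-5)]
  show "s \<ge> 1 \<Longrightarrow> R \<ge> 0 \<Longrightarrow> risk_le \<alpha> \<tau> \<sigma> d \<eta> T s R \<Longrightarrow> c * \<sigma>\<^sup>2 * Phi_o \<alpha> d \<eta> (real s) \<le> R"
    using H[THEN conjunct1] by simp
  show "1 \<le> m \<Longrightarrow> m < s_zero \<alpha> d \<eta> \<Longrightarrow> 0 < \<kappa> \<Longrightarrow> \<kappa> \<le> 1 \<Longrightarrow> 8 * elog (real m) \<le> real m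
         \<Longrightarrow> 24 * elog (real m) * loading.G \<alpha> d \<eta> 1 \<le> loading.G \<alpha> d \<eta> (real m) \<Longrightarrow> R \<ge> 0 \<Longrightarrow> R1 \<ge> 0
         \<Longrightarrow> risk_le \<alpha> \<tau> \<sigma> d \<eta> T m R \<Longrightarrow> risk_le \<alpha> \<tau> \<sigma> d \<eta> T 1 R1
         \<Longrightarrow> c * \<sigma> * \<kappa> * loading.G \<alpha> d \<eta> (real m) \<le> sqrt R + sqrt R1 * exp (B * \<kappa>\<^sup>2 * elog (real m))"
    using H[THEN conjunct2, THEN spec, THEN spec, THEN spec, THEN spec, of m \<kappa> R R1] by simp
qed

context loading
begin

lemma Phi_o_1: "Phi_o \<alpha> d \<eta> 1 = (G 1)\<^sup>2"
  by (simp add: Phi_o_def G_def ls_1 ns_1)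

lemma Phi_star_1_le: "Phi_star \<alpha> d \<eta> 1 \<le> Phi_o \<alpha> d \<eta> 1"
  unfolding Phi_o_1 using s_zero_bounds by (intro Phi_star_le_G) auto

lemma Phi_o_pos: "s \<ge> 1 \<Longrightarrow> Phi_o \<alpha> d \<eta> s > 0"
  using no_pos[of s] lo_nonneg[of s] by (simp add: Phi_o_def add_nonneg_pos less_imp_neq[symmetric])

text \<open>An estimator improving on the rate at s1 by the factor r is compared with itself at
  sparsity 1. Its loss there is at least of order m^(\<gamma>/2), while r is at least of order 1 /
  log^2. The thresholds in \<open>small\<close> exclude s1 \<le> s_cut and let the risk at s1 be
  absorbed.\<close>

lemma adaptivity_cost:
  fixes s_cut s1 :: nat and \<psi>' :: "nat \<Rightarrow> real"
  assumes LB: "adaptive_lower_bound \<alpha> \<tau>0 cL B" "\<tau> \<ge> \<tau>0" "\<sigma> > 0" "T \<in> estimators d" and cL: "cL > 0" and B: "B > 0"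
    and c1: "c1 > 0" and c': "c' > 0" and C': "C' > 0" and \<kappa>: "0 < \<kappa>" "\<kappa> \<le> 1" "2 * B * \<kappa>\<^sup>2 \<le> \<gamma> / 2" and \<gamma>: "\<gamma> > 0"
    and s_cut: "s_cut \<in> {1..d}"
    and below: "\<And>s::nat. 1 \<le> s \<Longrightarrow> s \<le> s_cut \<Longrightarrow> Phi_adp \<alpha> d \<eta> (real s) / Phi_o \<alpha> d \<eta> (real s) \<le> c1"
    and above: "\<And>s::nat. s_cut \<le> s \<Longrightarrow> s \<le> d \<Longrightarrow> c' * (real (min s s0)) powr \<gamma> \<le> Phi_adp \<alpha> d \<eta> (real s) / Phi_o \<alpha> d \<eta> 1"
    and \<psi>': "\<And>s. s \<in> {1..d} \<Longrightarrow> \<psi>' s > 0"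
    and risk: "\<And>s. s \<in> {1..d} \<Longrightarrow> risk_le \<alpha> \<tau> \<sigma> d \<eta> T s (2 * C' * \<psi>' s)"
    and s1: "s1 \<in> {1..d}" and r: "r = \<psi>' s1 / (\<sigma>\<^sup>2 * Phi_adp \<alpha> d \<eta> (real s1))"
    and small: "r < cL / (2 * c1 * C')" "r \<le> cL\<^sup>2 * \<kappa>\<^sup>2 / (256 * C')"
    and large: "\<And>x. x \<ge> real s_cut \<Longrightarrow> 8 * elog x \<le> x \<and> 576 * (elog x)\<^sup>2 \<le> c' / 32 * x powr \<gamma>"
  defines "c5 \<equiv> ((cL * \<kappa> / 2)\<^sup>2 * exp (- \<gamma> / 2) * c' / (64 * C')) * (cL / (1600 * C' * Ko\<^sup>2))"
  shows "\<exists>m\<ge>s_cut. c5 * (real m powr (\<gamma> / 2) / (elog (real m))\<^sup>2) \<le> \<psi>' 1 / (\<sigma>\<^sup>2 * Phi_adp \<alpha> d \<eta> (real 1)) * r"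
proof -
  let ?\<Phi> = "\<lambda>s::nat. Phi_adp \<alpha> d \<eta> (real s)" and ?\<Phi>o = "\<lambda>s::nat. Phi_o \<alpha> d \<eta> (real s)"
  note lower = adaptive_lower_boundD[OF LB(1,2) loading_axioms LB(3,4)]
  have \<sigma>: "\<sigma> > 0" by fact
  have \<Phi>pos: "?\<Phi> s > 0" if "s \<ge> 1" for s using that by (intro Phi_adp_pos) auto
  have \<Phi>opos: "?\<Phi>o s > 0" if "s \<ge> 1" for s using that by (intro Phi_o_pos) auto
  have rs1: "\<psi>' s1 = r * (\<sigma>\<^sup>2 * ?\<Phi> s1)" using r \<Phi>pos[of s1] s1 \<sigma> by simp
  have r0: "r > 0" unfolding r using \<psi>'[OF s1] \<Phi>pos[of s1] s1 \<sigma> by simp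
  have nonadaptive: "cL * ?\<Phi>o s \<le> 2 * C' * r * ?\<Phi> s1" if "1 \<le> s" "s \<le> s1" for s
  proof -
    have "cL * \<sigma>\<^sup>2 * ?\<Phi>o s \<le> 2 * C' * \<psi>' s1"
      using \<psi>'[OF s1] C' risk_le_mono[OF risk[OF s1] that(2)] that by (intro lower(1)) auto
    then have "\<sigma>\<^sup>2 * (cL * ?\<Phi>o s) \<le> \<sigma>\<^sup>2 * (2 * C' * r * ?\<Phi> s1)" by (simp add: rs1 mult_ac)
    then show ?thesis using \<sigma> by simp
  qed
  \<comment> \<open>Where the adaptive and nonadaptive rates agree up to c1, the nonadaptive lower
    bound keeps r away from 0. This pushes both s1 and s0 above s_cut.\<close>
  have not_comparable: "\<not> ?\<Phi> s1 \<le> c1 * ?\<Phi>o s" if "1 \<le> s" "s \<le> s1" for s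
  proof
    assume "?\<Phi> s1 \<le> c1 * ?\<Phi>o s"
    then have "cL * ?\<Phi> s1 \<le> c1 * (cL * ?\<Phi>o s)" using cL by (simp add: mult.left_commute)
    also have "\<dots> \<le> c1 * (2 * C' * r * ?\<Phi> s1)" using nonadaptive[OF that] c1 by (intro mult_left_mono) auto
    finally have "cL * ?\<Phi> s1 \<le> (2 * c1 * C' * r) * ?\<Phi> s1" by (simp add: mult_ac)
    then have "cL \<le> 2 * c1 * C' * r" using \<Phi>pos[of s1] s1 by simp
    then show False using small(1) c1 C' by (simp add: pos_less_divide_eq mult_ac)
  qed
  have s1_gt: "s_cut < s1"
  proof (rule ccontr)
    assume "\<not> s_cut < s1"
    then have "?\<Phi> s1 / ?\<Phi>o s1 \<le> c1" using s1 by (intro below) auto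
    then show False using not_comparable[of s1] s1 \<Phi>opos[of s1] by (simp add: pos_divide_le_eq)
  qed
  have s0_gt: "s_cut < s0"
  proof (rule ccontr)
    assume n: "\<not> s_cut < s0"
    have "?\<Phi> s_cut / ?\<Phi>o s_cut \<le> c1" using s_cut by (intro below) auto
    moreover have "?\<Phi> s1 = ?\<Phi> s_cut"
      using Phi_adp_saturates[of "real s1"] Phi_adp_saturates[of "real s_cut"] n s1_gt by simp
    ultimately show False using not_comparable[of s_cut] s_cut s1_gt \<Phi>opos[of s_cut] by (simp add: pos_divide_le_eq)
  qed
  \<comment> \<open>The constrained risk inequality needs a positive threshold, hence m < s0. When
    s1 lies beyond, s0/m \<le> 2 and the rate at m is smaller by a factor of at most 8 * 4 =
    32.\<close>
  define m where "m = min s1 (s0 - 1)"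
  have m: "m \<ge> s_cut" "m \<ge> 1" "m < s0" "m \<le> s1" "m \<le> s0" using s1_gt s0_gt s_cut by (auto simp: m_def)
  define x where "x = real m"
  have x: "x \<ge> 1" "x \<ge> real s_cut" "x \<le> real s0" using m by (auto simp: x_def)
  have xe: "elog x \<ge> 1" using x by (intro elog_ge_1)
  have \<Phi>s1: "?\<Phi> s1 \<le> 32 * ?\<Phi> m"
  proof (cases "s1 \<le> s0 - 1")
    case True
    then show ?thesis using \<Phi>pos[of m] m by (simp add: m_def)
  next
    case False
    then have ms: "real m = real s0 - 1" "s0 \<le> s1" using s0_gt s_cut by (auto simp: m_def)
    have "?\<Phi> s1 = Phi_adp \<alpha> d \<eta> (real s0)" using ms by (intro Phi_adp_saturates) auto
    also have "\<dots> \<le> 8 * (real s0 / real m)\<^sup>2 * ?\<Phi> m" using m by (intro Phi_adp_growth) auto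
    also have "\<dots> \<le> 8 * 2\<^sup>2 * ?\<Phi> m"
    proof (intro mult_right_mono mult_left_mono power_mono)
      show "real s0 / real m \<le> 2" using m ms by (simp add: divide_le_eq)
    qed (use \<Phi>pos[of m] m in auto)
    finally show ?thesis by simp
  qed
  have D: "c' / 32 * x powr \<gamma> * Phi_o \<alpha> d \<eta> 1 \<le> ?\<Phi> m"
  proof -
    have "c' * x powr \<gamma> \<le> c' * (real (min s1 s0)) powr \<gamma>"
      using c' m \<gamma> by (intro mult_left_mono powr_mono2) (auto simp: x_def)
    also have "\<dots> \<le> ?\<Phi> s1 / Phi_o \<alpha> d \<eta> 1" using s1_gt s1 by (intro above) auto
    finally have "c' * x powr \<gamma> * Phi_o \<alpha> d \<eta> 1 \<le> ?\<Phi> s1" using Phi_o_pos[of 1] by (simp add: pos_le_divide_eq)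
    then show ?thesis using \<Phi>s1 by simp
  qed
  have lg: "8 * elog x \<le> x" "576 * (elog x)\<^sup>2 \<le> c' / 32 * x powr \<gamma>" using large[OF x(2)] by auto
  have lgD: "576 * (elog x)\<^sup>2 * Phi_o \<alpha> d \<eta> 1 \<le> ?\<Phi> m"
  proof -
    have "576 * (elog x)\<^sup>2 * Phi_o \<alpha> d \<eta> 1 \<le> c' / 32 * x powr \<gamma> * Phi_o \<alpha> d \<eta> 1"
      using lg(2) Phi_o_pos[of 1] by (intro mult_right_mono) auto
    then show ?thesis using D by (rule order_trans)
  qed
  \<comment> \<open>The rate at m exceeds log^2 times the rate at sparsity 1, so the maximum in
    \<open>Phi_adp\<close> is attained by \<open>Phi_star\<close>, which \<open>G\<close>
    controls.\<close>
  have \<Phi>G: "?\<Phi> m \<le> (G x)\<^sup>2"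
  proof -
    have "Phi_star \<alpha> d \<eta> 1 * (elog x)\<^sup>2 \<le> Phi_o \<alpha> d \<eta> 1 * (elog x)\<^sup>2" using Phi_star_1_le by (intro mult_right_mono) auto
    also have "\<dots> < 576 * (elog x)\<^sup>2 * Phi_o \<alpha> d \<eta> 1" using xe Phi_o_pos[of 1] by simp
    also have "\<dots> \<le> ?\<Phi> m" by (rule lgD)
    finally have "?\<Phi> m = Phi_star \<alpha> d \<eta> x" using x by (auto simp: Phi_adp_eq x_def max_def split: if_splits)
    then show ?thesis using Phi_star_le_G[of x] x by simp
  qed
  have Gx: "G x > 0" using x by (intro G_pos)
  have G1: "24 * elog x * G 1 \<le> G x"
  proof -
    have "(24 * elog x * G 1)\<^sup>2 \<le> (G x)\<^sup>2" using lgD \<Phi>G by (simp add: power_mult_distrib Phi_o_1)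
    then show ?thesis using Gx by (rule power2_le_imp_le[OF _ less_imp_le])
  qed
  have one: "1 \<in> {1..d}" using d_pos by simp
  have R0: "0 \<le> 2 * C' * \<psi>' s1" "0 \<le> 2 * C' * \<psi>' 1" using C' \<psi>'[OF s1] \<psi>'[OF one] by auto
  have main: "cL * \<sigma> * \<kappa> * G x \<le> sqrt (2 * C' * \<psi>' s1) + sqrt (2 * C' * \<psi>' 1) * exp (B * \<kappa>\<^sup>2 * elog x)"
    unfolding x_def
    by (rule lower(2)[OF m(2,3) \<kappa>(1,2) lg(1)[unfolded x_def] G1[unfolded x_def] R0 risk_le_mono[OF risk[OF s1] m(4)] risk[OF one]])
  \<comment> \<open>The risk at s1 takes at most half of the left side of \<open>main\<close>: 256 =
    4 * 64, with 64 = 2 * 32.\<close>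
  have "sqrt (2 * C' * \<psi>' s1) \<le> cL * \<sigma> * \<kappa> * G x / 2"
  proof (rule real_le_lsqrt)
    have "2 * C' * \<psi>' s1 = 2 * C' * r * \<sigma>\<^sup>2 * ?\<Phi> s1" by (simp add: rs1)
    also have "\<dots> \<le> 2 * C' * r * \<sigma>\<^sup>2 * (32 * (G x)\<^sup>2)" using \<Phi>s1 \<Phi>G C' r0 by (intro mult_left_mono) auto
    also have "\<dots> = 64 * C' * \<sigma>\<^sup>2 * (G x)\<^sup>2 * r" by simp
    also have "\<dots> \<le> 64 * C' * \<sigma>\<^sup>2 * (G x)\<^sup>2 * (cL\<^sup>2 * \<kappa>\<^sup>2 / (256 * C'))" using small(2) C' by (intro mult_left_mono) auto
    also have "\<dots> = (cL * \<sigma> * \<kappa> * G x / 2)\<^sup>2" using C' by (simp add: power_mult_distrib power_divide field_simps)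
    finally show "2 * C' * \<psi>' s1 \<le> (cL * \<sigma> * \<kappa> * G x / 2)\<^sup>2" .
  qed (use cL \<sigma> \<kappa> Gx in auto)
  then have "cL * \<sigma> * \<kappa> * G x / 2 \<le> sqrt (2 * C' * \<psi>' 1) * exp (B * \<kappa>\<^sup>2 * elog x)" using main by linarith
  then have "(cL * \<sigma> * \<kappa> * G x / 2)\<^sup>2 \<le> (sqrt (2 * C' * \<psi>' 1) * exp (B * \<kappa>\<^sup>2 * elog x))\<^sup>2"
    using cL \<sigma> \<kappa> Gx by (intro power_mono) auto
  also have "\<dots> = 2 * C' * \<psi>' 1 * exp (2 * B * \<kappa>\<^sup>2 * elog x)"
    using R0(2) by (simp add: power_mult_distrib exp_double[symmetric] mult.assoc)
  also have "\<dots> \<le> 2 * C' * \<psi>' 1 * (exp (\<gamma> / 2) * x powr (\<gamma> / 2))"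
  proof (intro mult_left_mono R0(2))
    have "2 * B * \<kappa>\<^sup>2 * elog x \<le> \<gamma> / 2 * elog x" using \<kappa>(3) xe by (intro mult_right_mono) auto
    also have "\<dots> = \<gamma> / 2 + \<gamma> / 2 * ln x" using x by (simp add: elog_eq algebra_simps)
    finally have "exp (2 * B * \<kappa>\<^sup>2 * elog x) \<le> exp (\<gamma> / 2 + \<gamma> / 2 * ln x)" by simp
    then show "exp (2 * B * \<kappa>\<^sup>2 * elog x) \<le> exp (\<gamma> / 2) * x powr (\<gamma> / 2)" using x by (simp add: exp_add powr_def)
  qed
  finally have low: "(cL * \<sigma> * \<kappa> * G x / 2)\<^sup>2 \<le> 2 * C' * \<psi>' 1 * (exp (\<gamma> / 2) * x powr (\<gamma> / 2))" .
  define y where "y = x powr (\<gamma> / 2)"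
  have y: "y > 0" "x powr \<gamma> = y * y" using x by (auto simp: y_def powr_add[symmetric])
  \<comment> \<open>G^2 is at least of order x^\<gamma> times the rate at sparsity 1, and the
    chi-square cost takes back only x^(\<gamma>/2).\<close>
  have ratio1: "(cL * \<kappa> / 2)\<^sup>2 * exp (- \<gamma> / 2) * c' / (64 * C') * y \<le> \<psi>' 1 / (\<sigma>\<^sup>2 * Phi_adp \<alpha> d \<eta> (real 1))"
  proof -
    have "(cL * \<sigma> * \<kappa> / 2)\<^sup>2 * (c' / 32 * (y * y) * Phi_adp \<alpha> d \<eta> (real 1)) \<le> (cL * \<sigma> * \<kappa> / 2)\<^sup>2 * (G x)\<^sup>2"
    proof (intro mult_left_mono)
      have "Phi_adp \<alpha> d \<eta> (real 1) \<le> Phi_o \<alpha> d \<eta> 1"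
        using Phi_star_1_le s_zero_bounds by (simp add: Phi_adp_eq)
      then have "c' / 32 * (y * y) * Phi_adp \<alpha> d \<eta> (real 1) \<le> c' / 32 * (y * y) * Phi_o \<alpha> d \<eta> 1"
        using c' y by (intro mult_left_mono) auto
      then show "c' / 32 * (y * y) * Phi_adp \<alpha> d \<eta> (real 1) \<le> (G x)\<^sup>2" using D \<Phi>G by (simp only: y(2))
    qed auto
    also have "\<dots> = (cL * \<sigma> * \<kappa> * G x / 2)\<^sup>2" by (simp add: power_mult_distrib power_divide)
    also have "\<dots> \<le> 2 * C' * \<psi>' 1 * (exp (\<gamma> / 2) * y)" using low by (simp only: y_def)
    finally have "y * ((cL * \<sigma> * \<kappa> / 2)\<^sup>2 * (c' / 32 * y * Phi_adp \<alpha> d \<eta> (real 1))) \<le> y * (2 * C' * \<psi>' 1 * exp (\<gamma> / 2))"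
      by (simp only: mult_ac)
    then have main1: "(cL * \<sigma> * \<kappa> / 2)\<^sup>2 * (c' / 32 * y * Phi_adp \<alpha> d \<eta> (real 1)) \<le> 2 * C' * \<psi>' 1 * exp (\<gamma> / 2)"
      using y(1) by (simp only: mult_le_cancel_left_pos)
    define E where "E = exp (\<gamma> / 2)"
    have E: "E > 0" "exp (- \<gamma> / 2) = 1 / E"
    proof -
      show "E > 0" by (simp add: E_def)
      have "exp (- \<gamma> / 2) = exp (- (\<gamma> / 2))" by simp
      then show "exp (- \<gamma> / 2) = 1 / E" by (simp only: exp_minus inverse_eq_divide E_def)
    qed
    have P: "\<sigma>\<^sup>2 * Phi_adp \<alpha> d \<eta> (real 1) > 0" using \<sigma> \<Phi>pos[of 1] by simp
    have "((cL * \<kappa> / 2)\<^sup>2 * (1 / E) * c' / (64 * C') * y) * (\<sigma>\<^sup>2 * Phi_adp \<alpha> d \<eta> (real 1))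
        = ((cL * \<sigma> * \<kappa> / 2)\<^sup>2 * (c' / 32 * y * Phi_adp \<alpha> d \<eta> (real 1))) / (2 * C' * E)"
      using C' E(1) by (simp add: power_mult_distrib power_divide field_simps)
    also have "\<dots> \<le> (2 * C' * \<psi>' 1 * E) / (2 * C' * E)"
      using main1 C' E(1) by (intro divide_right_mono) (auto simp: E_def)
    also have "\<dots> = \<psi>' 1" using C' E(1) by simp
    finally show ?thesis unfolding E(2) using P by (simp only: pos_le_divide_eq)
  qed
  \<comment> \<open>The nonadaptive lower bound at m, together with \<open>Phi_adp_le_o\<close>;
    1600 = 2 * 32 * 25.\<close>
  have ratio2: "cL / (1600 * C' * Ko\<^sup>2) / (elog x)\<^sup>2 \<le> r"
  proof -
    have "cL * ?\<Phi>o m \<le> 2 * C' * r * ?\<Phi> s1" using m by (intro nonadaptive) auto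
    also have "\<dots> \<le> 2 * C' * r * (32 * (25 * Ko\<^sup>2 * (elog x)\<^sup>2 * ?\<Phi>o m))"
      using \<Phi>s1 Phi_adp_le_o[of x] x C' r0 by (intro mult_left_mono) (auto simp: x_def)
    finally have "cL * ?\<Phi>o m \<le> (1600 * C' * Ko\<^sup>2 * (elog x)\<^sup>2 * r) * ?\<Phi>o m" by (simp add: mult_ac)
    then have "cL \<le> 1600 * C' * Ko\<^sup>2 * (elog x)\<^sup>2 * r" using \<Phi>opos[of m] m by simp
    moreover have "1600 * C' * Ko\<^sup>2 * (elog x)\<^sup>2 > 0" using C' Ko_ge_1 xe by simp
    ultimately have "cL / (1600 * C' * Ko\<^sup>2 * (elog x)\<^sup>2) \<le> r" by (simp add: pos_divide_le_eq mult.commute)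
    then show ?thesis by (simp add: divide_divide_eq_left)
  qed
  have swap: "(p * q) * (u / e) = (p * u) * (q / e)" for p q u e :: real by simp
  have "c5 * (y / (elog x)\<^sup>2)
      = ((cL * \<kappa> / 2)\<^sup>2 * exp (- \<gamma> / 2) * c' / (64 * C') * y) * (cL / (1600 * C' * Ko\<^sup>2) / (elog x)\<^sup>2)"
    unfolding c5_def by (rule swap)
  also have "\<dots> \<le> \<psi>' 1 / (\<sigma>\<^sup>2 * Phi_adp \<alpha> d \<eta> (real 1)) * r"
    using ratio1 ratio2 cL C' c' y(1) \<psi>'[OF one] \<Phi>pos[of 1] by (intro mult_mono) auto
  finally show ?thesis using m(1) by (auto simp: x_def y_def)
qed

end

section \<open>From finite risk bounds to normalised risks in \<open>ennreal\<close>\<close>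

lemma ennreal_divide_le_iff:
  assumes "p > 0" "C \<ge> 0"
  shows "(x::ennreal) / ennreal p \<le> ennreal C \<longleftrightarrow> x \<le> ennreal (C * p)"
proof (cases x)
  case (real q)
  then show ?thesis using assms by (simp add: divide_ennreal ennreal_le_iff pos_divide_le_eq)
next
  case top
  then show ?thesis using assms by (simp add: ennreal_top_divide top_unique)
qed

lemma max_normalized_risk_le_iff:
  assumes "d \<ge> 1" "C \<ge> 0" "\<And>s. s \<in> {1..d} \<Longrightarrow> \<psi> s > 0"
  shows "max_normalized_risk \<alpha> \<tau> \<sigma> d \<eta> \<psi> T \<le> ennreal C \<longleftrightarrow> (\<forall>s\<in>{1..d}. risk_le \<alpha> \<tau> \<sigma> d \<eta> T s (C * \<psi> s))"
  unfolding max_normalized_risk_def risk_le_def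
  using assms by (subst Max_le_iff) (auto simp: SUP_le_iff ennreal_divide_le_iff)

lemma loadingI:
  assumes "\<alpha> > 0" "d \<ge> 1" "antimono_on {1..d} (\<lambda>j. \<bar>\<eta> j\<bar>)" "\<bar>\<eta> d\<bar> > 0"
  shows "loading \<alpha> d \<eta>"
proof
  fix j assume j: "j \<in> {1..d}"
  then have "\<bar>\<eta> d\<bar> \<le> \<bar>\<eta> j\<bar>" using assms(2) by (intro monotone_onD[OF assms(3)]) auto
  then show "\<eta> j \<noteq> 0" using assms(4) by auto
qed (use assms in auto)

lemma adaptive_rate_upper:
  assumes \<alpha>: "\<alpha> > 0" and \<tau>: "\<tau> > 0" and \<sigma>: "\<sigma> > 0" and ld: "\<And>d. d \<ge> d0 \<Longrightarrow> loading \<alpha> d (\<eta> d)"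
  shows "\<exists>L. \<exists>C::real. C > 0 \<and> (\<forall>d\<ge>d0. L d \<in> estimators d \<and>
    max_normalized_risk \<alpha> \<tau> \<sigma> d (\<eta> d) (\<lambda>s. \<sigma>\<^sup>2 * Phi_adp \<alpha> d (\<eta> d) (real s)) (L d) \<le> ennreal C)"
proof -
  obtain Cv where Cv: "variance_const \<alpha> \<tau> Cv"
    using noise_clipped_variance[OF \<alpha> \<tau>] unfolding variance_const_def by blast
  obtain Cm where Cm: "mgf_const \<alpha> \<tau> Cm"
    using noise_clipped_mgf[OF \<alpha> \<tau>] unfolding mgf_const_def by blast
  define C where "C = 3 * (2 * \<tau>\<^sup>2 + 2 * (5 + Cv)) + 768 * \<tau>\<^sup>2 + 12 * (8 * opt_const \<alpha> * \<tau> + (Cm / \<tau> + 4 * \<tau>))\<^sup>2"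
  have C: "C > 0"
  proof -
    have "Cv \<ge> 1" using Cv by (simp add: variance_const_def)
    then have "3 * (2 * \<tau>\<^sup>2 + 2 * (5 + Cv)) > 0" by (simp add: add_nonneg_pos)
    then show ?thesis unfolding C_def by (intro add_pos_nonneg) auto
  qed
  have "\<exists>T. d \<ge> d0 \<longrightarrow> T \<in> estimators d \<and>
      max_normalized_risk \<alpha> \<tau> \<sigma> d (\<eta> d) (\<lambda>s. \<sigma>\<^sup>2 * Phi_adp \<alpha> d (\<eta> d) (real s)) T \<le> ennreal C" for d
  proof (cases "d \<ge> d0")
    case True
    interpret loading \<alpha> d "\<eta> d" by (rule ld[OF True])
    obtain T where T: "T \<in> estimators d"
      "\<forall>s\<in>{1..d}. risk_le \<alpha> \<tau> \<sigma> d (\<eta> d) T s (C * (\<sigma>\<^sup>2 * Phi_adp \<alpha> d (\<eta> d) (real s)))"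
      using lepski_upper_bound[OF Cv Cm \<tau> \<sigma>] unfolding C_def by blast
    have "max_normalized_risk \<alpha> \<tau> \<sigma> d (\<eta> d) (\<lambda>s. \<sigma>\<^sup>2 * Phi_adp \<alpha> d (\<eta> d) (real s)) T \<le> ennreal C"
      using T(2) C \<sigma> d_pos Phi_adp_pos by (subst max_normalized_risk_le_iff) auto
    then show ?thesis using T(1) by blast
  qed simp
  then obtain L where "\<forall>d. d \<ge> d0 \<longrightarrow> L d \<in> estimators d \<and>
      max_normalized_risk \<alpha> \<tau> \<sigma> d (\<eta> d) (\<lambda>s. \<sigma>\<^sup>2 * Phi_adp \<alpha> d (\<eta> d) (real s)) (L d) \<le> ennreal C"
    by metis
  then show ?thesis using C by blast
qed

lemma min_ratio_attained:
  assumes "d \<ge> 1"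
  obtains s where "s \<in> {1..d}" "min_ratio \<psi>' \<psi> d = \<psi>' s d / \<psi> s d"
proof -
  have "min_ratio \<psi>' \<psi> d \<in> (\<lambda>s. \<psi>' s d / \<psi> s d) ` {1..d}"
    unfolding min_ratio_def using assms by (intro Min_in) auto
  then show ?thesis by (rule imageE) (rule that)
qed

theorem proposition3:
  fixes \<alpha> \<gamma>0 :: real
  assumes "\<alpha> > 0" and "0 < \<gamma>0" and "\<gamma>0 < 2"
  shows "\<exists>\<tau>0::real. \<tau>0 > 0 \<and>
    (\<forall>(\<sigma>::real) (d0::nat) (\<eta>::nat \<Rightarrow> nat \<Rightarrow> real) (c::real) (c'::real) (s_cut::nat \<Rightarrow> nat).
      \<sigma> > 0 \<and> d0 \<ge> 1
      \<and> (\<forall>d\<ge>d0. antimono_on {1..d} (\<lambda>j. \<bar>\<eta> d j\<bar>) \<and> \<bar>\<eta> d d\<bar> > 0)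
      \<and> c > 0 \<and> c' > 0
      \<and> (\<forall>d\<ge>d0. s_cut d \<in> {1..d})
      \<and> filterlim s_cut at_top sequentially
      \<and> (\<forall>d\<ge>d0. \<forall>s::nat. 1 \<le> s \<and> s \<le> s_cut d \<longrightarrow>
            Phi_adp \<alpha> d (\<eta> d) (real s) / Phi_o \<alpha> d (\<eta> d) (real s) \<le> c)
      \<and> (\<forall>d\<ge>d0. \<forall>s::nat. s_cut d \<le> s \<and> s \<le> d \<longrightarrow>
            Phi_adp \<alpha> d (\<eta> d) (real s) / Phi_o \<alpha> d (\<eta> d) 1
              \<ge> c' * (real (min s (s_zero \<alpha> d (\<eta> d)))) powr \<gamma>0)
      \<longrightarrow> (\<forall>\<tau>\<ge>\<tau>0. adaptive_rate \<alpha> \<tau> \<sigma> d0 \<eta> (\<lambda>s d. \<sigma>\<^sup>2 * Phi_adp \<alpha> d (\<eta> d) (real s))))"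
proof -
  \<comment> \<open>\<tau>0 is the scale from which on the law with density proportional to exp(-b
    |x|^\<alpha>) belongs to the noise class, as the lower bound requires.\<close>
  obtain \<tau>0 cL B where \<tau>0: "\<tau>0 > 0" and cL: "cL > 0" and B: "B > 0" and LB: "adaptive_lower_bound \<alpha> \<tau>0 cL B"
    using risk_lower_bounds[OF assms(1)] by blast
  have main: "adaptive_rate \<alpha> \<tau> \<sigma> d0 \<eta> (\<lambda>s d. \<sigma>\<^sup>2 * Phi_adp \<alpha> d (\<eta> d) (real s))"
    if \<sigma>: "\<sigma> > 0" and d0: "d0 \<ge> 1"
      and eta: "\<forall>d\<ge>d0. antimono_on {1..d} (\<lambda>j. \<bar>\<eta> d j\<bar>) \<and> \<bar>\<eta> d d\<bar> > 0"
      and c: "c > 0" and c': "c' > 0"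
      and s_cut: "\<forall>d\<ge>d0. s_cut d \<in> {1..d}" "filterlim s_cut at_top sequentially"
      and below: "\<forall>d\<ge>d0. \<forall>s::nat. 1 \<le> s \<and> s \<le> s_cut d \<longrightarrow>
            Phi_adp \<alpha> d (\<eta> d) (real s) / Phi_o \<alpha> d (\<eta> d) (real s) \<le> c"
      and above: "\<forall>d\<ge>d0. \<forall>s::nat. s_cut d \<le> s \<and> s \<le> d \<longrightarrow>
            Phi_adp \<alpha> d (\<eta> d) (real s) / Phi_o \<alpha> d (\<eta> d) 1
              \<ge> c' * (real (min s (s_zero \<alpha> d (\<eta> d)))) powr \<gamma>0"
      and \<tau>: "\<tau> \<ge> \<tau>0"
    for \<sigma> d0 \<eta> c c' s_cut \<tau>
  proof -
    define \<psi> where "\<psi> s d = \<sigma>\<^sup>2 * Phi_adp \<alpha> d (\<eta> d) (real s)" for s d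
    have ld: "loading \<alpha> d (\<eta> d)" if "d \<ge> d0" for d
      using eta that d0 assms(1) by (intro loadingI) auto
    have pos: "positive_rate d0 \<psi>"
      unfolding positive_rate_def \<psi>_def using \<sigma> loading.Phi_adp_pos[OF ld] by auto
    have lower: "\<exists>s_bar. (\<forall>d\<ge>d0. s_bar d \<in> {1..d})
              \<and> filterlim (\<lambda>d. \<psi>' (s_bar d) d / \<psi> (s_bar d) d * min_ratio \<psi>' \<psi> d) at_top sequentially"
      if \<psi>': "positive_rate d0 \<psi>'" and C': "C' > 0"
        and risk: "\<forall>d\<ge>d0. (INF T\<in>estimators d. max_normalized_risk \<alpha> \<tau> \<sigma> d (\<eta> d) (\<lambda>s. \<psi>' s d) T) \<le> ennreal C'"
        and lim: "min_ratio \<psi>' \<psi> \<longlonglongrightarrow> 0" for \<psi>' C'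
    proof -
      \<comment> \<open>Makes the squared chi-square factor exp(2 B \<kappa>^2 elog m) at most (e
        m)^(\<gamma>0/2), half of the power guaranteed above s_cut.\<close>
      define \<kappa> where "\<kappa> = min 1 (sqrt (\<gamma>0 / (4 * B)))"
      have \<kappa>: "0 < \<kappa>" "\<kappa> \<le> 1" "2 * B * \<kappa>\<^sup>2 \<le> \<gamma>0 / 2"
      proof -
        show "0 < \<kappa>" "\<kappa> \<le> 1" using assms(2) B by (auto simp: \<kappa>_def)
        have "\<kappa>\<^sup>2 \<le> (sqrt (\<gamma>0 / (4 * B)))\<^sup>2" using \<open>0 < \<kappa>\<close> by (intro power_mono) (auto simp: \<kappa>_def)
        also have "\<dots> = \<gamma>0 / (4 * B)" using assms(2) B by simp
        finally have "2 * B * \<kappa>\<^sup>2 \<le> 2 * B * (\<gamma>0 / (4 * B))" using B by (intro mult_left_mono) auto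
        then show "2 * B * \<kappa>\<^sup>2 \<le> \<gamma>0 / 2" using B by simp
      qed
      define c5 where "c5 = ((cL * \<kappa> / 2)\<^sup>2 * exp (- \<gamma>0 / 2) * c' / (64 * C')) * (cL / (1600 * C' * (opt_const \<alpha>)\<^sup>2))"
      have c5: "c5 > 0"
      proof -
        have "opt_const \<alpha> > 0" using opt_const(1)[OF assms(1)] by simp
        then show ?thesis using cL \<kappa>(1) c' C' by (simp add: c5_def)
      qed
      define \<epsilon> where "\<epsilon> = min (cL / (2 * c * C')) (cL\<^sup>2 * \<kappa>\<^sup>2 / (256 * C'))"
      have \<epsilon>: "\<epsilon> > 0" using cL c C' \<kappa>(1) by (simp add: \<epsilon>_def)
      have "eventually (\<lambda>x. 8 * elog x \<le> x \<and> 576 * (elog x)\<^sup>2 \<le> c' / 32 * x powr \<gamma>0) at_top"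
        unfolding elog_def using c' assms(2) by (intro eventually_conj) real_asymp+
      then obtain N0 where N0: "\<And>x. x \<ge> N0 \<Longrightarrow> 8 * elog x \<le> x \<and> 576 * (elog x)\<^sup>2 \<le> c' / 32 * x powr \<gamma>0"
        unfolding eventually_at_top_linorder by blast
      have q: "filterlim (\<lambda>x. c5 * (x powr (\<gamma>0 / 2) / (elog x)\<^sup>2)) at_top at_top"
        unfolding elog_def using c5 assms(2) by real_asymp
      have step: "\<exists>m\<ge>s_cut d. c5 * (real m powr (\<gamma>0 / 2) / (elog (real m))\<^sup>2) \<le> \<psi>' 1 d / \<psi> 1 d * min_ratio \<psi>' \<psi> d"
        if d: "d \<ge> d0" and sc: "real (s_cut d) \<ge> N0" and small: "min_ratio \<psi>' \<psi> d < \<epsilon>" for d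
      proof -
        interpret loading \<alpha> d "\<eta> d" by (rule ld[OF d])
        have \<psi>'pos: "\<psi>' s d > 0" if "s \<in> {1..d}" for s using \<psi>' d that by (simp add: positive_rate_def)
        \<comment> \<open>The infimum need not be attained. Passing to 2 C' yields one estimator T
          that satisfies all risk bounds simultaneously.\<close>
        have "(INF T\<in>estimators d. max_normalized_risk \<alpha> \<tau> \<sigma> d (\<eta> d) (\<lambda>s. \<psi>' s d) T) < ennreal (2 * C')"
        proof -
          have "(INF T\<in>estimators d. max_normalized_risk \<alpha> \<tau> \<sigma> d (\<eta> d) (\<lambda>s. \<psi>' s d) T) \<le> ennreal C'"
            using risk d by blast
          also have "\<dots> < ennreal (2 * C')" using C' by (simp add: ennreal_less_iff)
          finally show ?thesis .
        qed
        then obtain T where T: "T \<in> estimators d" "max_normalized_risk \<alpha> \<tau> \<sigma> d (\<eta> d) (\<lambda>s. \<psi>' s d) T < ennreal (2 * C')"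
          unfolding INF_less_iff by blast
        then have Tr: "\<forall>s\<in>{1..d}. risk_le \<alpha> \<tau> \<sigma> d (\<eta> d) T s (2 * C' * \<psi>' s d)"
          using max_normalized_risk_le_iff[of d "2 * C'" "\<lambda>s. \<psi>' s d" \<alpha> \<tau> \<sigma> "\<eta> d" T] d_pos C' \<psi>'pos
          by (metis less_imp_le mult_pos_pos zero_less_numeral)
        obtain s1 where s1: "s1 \<in> {1..d}" "min_ratio \<psi>' \<psi> d = \<psi>' s1 d / \<psi> s1 d"
          using min_ratio_attained[OF d_pos] by blast
        have "\<exists>m\<ge>s_cut d. c5 * (real m powr (\<gamma>0 / 2) / (elog (real m))\<^sup>2)
            \<le> \<psi>' 1 d / (\<sigma>\<^sup>2 * Phi_adp \<alpha> d (\<eta> d) (real 1)) * min_ratio \<psi>' \<psi> d"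
          unfolding c5_def
        proof (rule adaptivity_cost[OF LB \<tau> \<sigma> T(1) cL B c c' C' \<kappa> assms(2), where \<psi>' = "\<lambda>s. \<psi>' s d" and ?s1.0 = s1])
          show "s_cut d \<in> {1..d}" using s_cut(1) d by blast
          show "Phi_adp \<alpha> d (\<eta> d) (real s) / Phi_o \<alpha> d (\<eta> d) (real s) \<le> c" if "1 \<le> s" "s \<le> s_cut d" for s
            using below d that by blast
          show "c' * (real (min s (s_zero \<alpha> d (\<eta> d)))) powr \<gamma>0 \<le> Phi_adp \<alpha> d (\<eta> d) (real s) / Phi_o \<alpha> d (\<eta> d) 1"
            if "s_cut d \<le> s" "s \<le> d" for s using above d that by blast
          show "min_ratio \<psi>' \<psi> d = \<psi>' s1 d / (\<sigma>\<^sup>2 * Phi_adp \<alpha> d (\<eta> d) (real s1))" using s1(2) by (simp only: \<psi>_def)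
          show "min_ratio \<psi>' \<psi> d < cL / (2 * c * C')" "min_ratio \<psi>' \<psi> d \<le> cL\<^sup>2 * \<kappa>\<^sup>2 / (256 * C')"
            using small by (auto simp: \<epsilon>_def)
          show "8 * elog x \<le> x \<and> 576 * (elog x)\<^sup>2 \<le> c' / 32 * x powr \<gamma>0" if "real (s_cut d) \<le> x" for x
            using N0[of x] that sc by simp
        qed (use \<psi>'pos Tr s1 in auto)
        then show ?thesis by (simp only: \<psi>_def)
      qed
      have "filterlim (\<lambda>d. \<psi>' 1 d / \<psi> 1 d * min_ratio \<psi>' \<psi> d) at_top sequentially"
        unfolding filterlim_at_top
      proof
        fix Z :: real
        have "eventually (\<lambda>x. Z \<le> c5 * (x powr (\<gamma>0 / 2) / (elog x)\<^sup>2)) at_top"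
          using q unfolding filterlim_at_top by blast
        then obtain N1 where N1: "\<And>x. x \<ge> N1 \<Longrightarrow> Z \<le> c5 * (x powr (\<gamma>0 / 2) / (elog x)\<^sup>2)"
          unfolding eventually_at_top_linorder by blast
        have e1: "eventually (\<lambda>d. s_cut d \<ge> nat \<lceil>max N0 N1\<rceil>) sequentially"
          using s_cut(2) unfolding filterlim_at_top by blast
        have e2: "eventually (\<lambda>d. min_ratio \<psi>' \<psi> d < \<epsilon>) sequentially"
          using lim \<epsilon> by (rule order_tendstoD(2))
        show "eventually (\<lambda>d. Z \<le> \<psi>' 1 d / \<psi> 1 d * min_ratio \<psi>' \<psi> d) sequentially"
          using e1 e2 eventually_ge_at_top[of d0]
        proof eventually_elim
          case (elim d)
          then have big: "real (s_cut d) \<ge> max N0 N1" by linarith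
          then obtain m where m: "m \<ge> s_cut d"
            "c5 * (real m powr (\<gamma>0 / 2) / (elog (real m))\<^sup>2) \<le> \<psi>' 1 d / \<psi> 1 d * min_ratio \<psi>' \<psi> d"
            using step[of d] elim by auto
          have "N1 \<le> real m" using big m(1) by simp
          then show ?case using N1[of "real m"] m(2) by linarith
        qed
      qed
      \<comment> \<open>The loss always occurs at sparsity 1, so the constant sequence 1 is the
        witness.\<close>
      then show ?thesis using d0 by (intro exI[of _ "\<lambda>_. 1"]) auto
    qed
    have upper: "\<exists>L. \<exists>C::real. C > 0 \<and> (\<forall>d\<ge>d0. L d \<in> estimators d \<and>
           max_normalized_risk \<alpha> \<tau> \<sigma> d (\<eta> d) (\<lambda>s. \<psi> s d) (L d) \<le> ennreal C)"
      unfolding \<psi>_def using \<tau> \<tau>0 by (intro adaptive_rate_upper assms(1) \<sigma> ld) auto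
    have "adaptive_rate \<alpha> \<tau> \<sigma> d0 \<eta> \<psi>"
      unfolding adaptive_rate_def
    proof (intro conjI allI impI)
      show "positive_rate d0 \<psi>" by (rule pos)
      show "\<exists>L. \<exists>C::real. C > 0 \<and> (\<forall>d\<ge>d0. L d \<in> estimators d \<and>
           max_normalized_risk \<alpha> \<tau> \<sigma> d (\<eta> d) (\<lambda>s. \<psi> s d) (L d) \<le> ennreal C)" by (rule upper)
      fix \<psi>' assume "positive_rate d0 \<psi>'
        \<and> (\<exists>C'::real. C' > 0 \<and>
             (\<forall>d\<ge>d0. (INF T\<in>estimators d.
                max_normalized_risk \<alpha> \<tau> \<sigma> d (\<eta> d) (\<lambda>s. \<psi>' s d) T) \<le> ennreal C'))
        \<and> min_ratio \<psi>' \<psi> \<longlonglongrightarrow> 0"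
      then show "\<exists>s_bar. (\<forall>d\<ge>d0. s_bar d \<in> {1..d})
              \<and> filterlim (\<lambda>d. \<psi>' (s_bar d) d / \<psi> (s_bar d) d * min_ratio \<psi>' \<psi> d) at_top sequentially"
        using lower by blast
    qed
    then show ?thesis by (simp only: \<psi>_def[abs_def])
  qed
  show ?thesis
    by (intro exI[of _ \<tau>0] conjI allI impI \<tau>0) (elim conjE, rule main; assumption)
qed

end
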